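(* Let $\mathcal T$ be an FLD$_1$-theory which is actually Vaught's. Then Vaught's conjecture holds for $\mathcal T$; more precisely, $I(\mathcal T)=\mathfrak c$ if there are $\sum_{\mathbb I}\mathbb X_i\in\mathcal D(\mathcal T)$ and $i\in I$ with $I(\mathbb X_i)=\mathfrak c$, or $\mathcal T$ is large; $I(\mathcal T)=1$ if there is $\sum_{\mathbb I}\mathbb X_i\in\mathcal D(\mathcal T)$ with $I(\mathbb X_i)=1$ for all $i\in I$; and $3\le I(\mathcal T)\le\omega$ otherwise.
   Context: All structures are partial orders in the language $L_b=\langle\le\rangle$; $\mathfrak c=2^{\aleph_0}$. For a complete $L_b$-theory $\mathcal T$, $I(\mathcal T)$ is the number of non-isomorphic countable models; for an $L_b$-structure $\mathbb Z$, $I(\mathbb Z):=I(\mathrm{Th}(\mathbb Z))$, with $I(\mathbb Z)=1$ when $\mathbb Z$ is finite. A complete theory is small if it has countably many complete $n$-types over $\emptyset$ for every $n$, large otherwise. Lexicographic sum: for a partial order $\mathbb I=\langle I,\le_{\mathbb I}\rangle$ and partial orders $\mathbb X_i$ ($i\in I$) with pairwise disjoint domains, $\sum_{\mathbb I}\mathbb X_i$ is the partial order on $\bigcup_i X_i$ with $x\le x'$ iff either $x,x'\in X_i$ and $x\le_{\mathbb X_i}x'$, or $x\in X_i$, $x'\in X_j$ with $i<_{\mathbb I}j$. A partial order $\mathbb X$ is FLD$_1$ iff $\mathbb X=\sum_{\mathbb I}\mathbb X_i$ for some finite partial order $\mathbb I$ and partition $\{X_i\}_{i\in I}$ of its domain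 (induced suborders $\mathbb X_i$) with each $\mathbb X_i$ having a largest element; this is an FLD$_1$ decomposition. A complete theory of partial order is an FLD$_1$-theory iff some (equivalently every) model is FLD$_1$; $\mathcal D(\mathcal T)$ is the class of all FLD$_1$ decompositions of models of $\mathcal T$. An FLD$_1$-theory $\mathcal T$ is actually Vaught's iff there are $\sum_{\mathbb I}\mathbb X_i\in\mathcal D(\mathcal T)$ and sentences $\tau_i\in\mathrm{Th}(\mathbb X_i)$ ($i\in I$) such that for every $i\in I$ and every structure $\mathbb Z\models\tau_i$ we have $I(\mathbb Z)\le\omega$ or $I(\mathbb Z)=\mathfrak c$. *)

theory Defs
  imports "HOL-Library.Infinite_Typeclass" "HOL-Library.Countable_Set" "HOL-Library.Disjoint_Sets"
begin

unbundle cardinal_syntax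

subsection \<open>First-order logic with equality over one binary relation symbol\<close>

datatype fm =
    Eq nat nat
  | Le nat nat
  | Neg fm
  | Conj fm fm
  | Ex nat fm

primrec fv :: "fm \<Rightarrow> nat set" where
  "fv (Eq m n) = {m, n}"
| "fv (Le m n) = {m, n}"
| "fv (Neg \<phi>) = fv \<phi>"
| "fv (Conj \<phi> \<psi>) = fv \<phi> \<union> fv \<psi>"
| "fv (Ex n \<phi>) = fv \<phi> - {n}"

definition sentence :: "fm \<Rightarrow> bool" where
  "sentence \<phi> \<longleftrightarrow> fv \<phi> = {}"

record 'a struc =
  univ :: "'a set"
  leq :: "'a rel"

definition is_struc :: "'a struc \<Rightarrow> bool" where
  "is_struc M \<longleftrightarrow> univ M \<noteq> {} \<and> leq M \<subseteq> univ M \<times> univ M"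

primrec sat :: "'a struc \<Rightarrow> (nat \<Rightarrow> 'a) \<Rightarrow> fm \<Rightarrow> bool" where
  "sat M s (Eq m n) \<longleftrightarrow> s m = s n"
| "sat M s (Le m n) \<longleftrightarrow> (s m, s n) \<in> leq M"
| "sat M s (Neg \<phi>) \<longleftrightarrow> \<not> sat M s \<phi>"
| "sat M s (Conj \<phi> \<psi>) \<longleftrightarrow> sat M s \<phi> \<and> sat M s \<psi>"
| "sat M s (Ex n \<phi>) \<longleftrightarrow> (\<exists>a\<in>univ M. sat M (s(n := a)) \<phi>)"

definition holds :: "'a struc \<Rightarrow> fm \<Rightarrow> bool" where
  "holds M \<phi> \<longleftrightarrow> (\<forall>s. range s \<subseteq> univ M \<longrightarrow> sat M s \<phi>)"

definition is_model :: "'a struc \<Rightarrow> fm set \<Rightarrow> bool" where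
  "is_model M T \<longleftrightarrow> is_struc M \<and> (\<forall>\<phi>\<in>T. holds M \<phi>)"

definition Th :: "'a struc \<Rightarrow> fm set" where
  "Th M = {\<phi>. sentence \<phi> \<and> holds M \<phi>}"

text \<open>
  HOL cannot quantify over structures on all types at once.  Notions that quantify over all
  structures therefore carry a type argument \<open>U :: 'a itself\<close> and range over the structures
  whose domain is a subset of \<^typ>\<open>'a\<close>.  By the Loewenheim-Skolem theorem every infinite
  \<^typ>\<open>'a\<close> yields the same satisfiable theories, consequences and types.
\<close>

definition entails :: "'a itself \<Rightarrow> fm set \<Rightarrow> fm \<Rightarrow> bool" where
  "entails U T \<phi> \<longleftrightarrow> (\<forall>M :: 'a struc. is_model M T \<longrightarrow> holds M \<phi>)"

definition complete_theory :: "'a itself \<Rightarrow> fm set \<Rightarrow> bool" where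
  "complete_theory U T \<longleftrightarrow>
     (\<forall>\<phi>\<in>T. sentence \<phi>) \<and>
     (\<exists>M :: 'a struc. is_model M T) \<and>
     (\<forall>\<phi>. sentence \<phi> \<longrightarrow> entails U T \<phi> \<or> entails U T (Neg \<phi>))"

definition complete_types :: "'a itself \<Rightarrow> nat \<Rightarrow> fm set \<Rightarrow> fm set set" where
  "complete_types U n T =
     {p. (\<forall>\<phi>\<in>p. fv \<phi> \<subseteq> {..<n}) \<and>
         (\<exists>(M :: 'a struc) s. is_model M T \<and> range s \<subseteq> univ M \<and> (\<forall>\<phi>\<in>p. sat M s \<phi>)) \<and>
         (\<forall>\<phi>. fv \<phi> \<subseteq> {..<n} \<longrightarrow> \<phi> \<in> p \<or> Neg \<phi> \<in> p)}"

definition small_theory :: "'a itself \<Rightarrow> fm set \<Rightarrow> bool" where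
  "small_theory U T \<longleftrightarrow> (\<forall>n. countable (complete_types U n T))"

abbreviation large_theory :: "'a itself \<Rightarrow> fm set \<Rightarrow> bool" where
  "large_theory U T \<equiv> \<not> small_theory U T"


subsection \<open>The number of countable models\<close>

definition isomorphic :: "'a struc \<Rightarrow> 'b struc \<Rightarrow> bool" where
  "isomorphic M N \<longleftrightarrow>
     (\<exists>f. bij_betw f (univ M) (univ N) \<and>
          (\<forall>x\<in>univ M. \<forall>y\<in>univ M. (x, y) \<in> leq M \<longleftrightarrow> (f x, f y) \<in> leq N))"

definition iso_rel :: "'a struc rel" where
  "iso_rel = {(M, N). is_struc M \<and> is_struc N \<and> isomorphic M N}"

text \<open>
  Every countable structure is isomorphic to one whose domain is a set of natural numbers.
  Finite domains are included, so the theory of a finite structure has exactly one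
  isomorphism class of countable models, in accordance with the convention that the number
  is 1 in that case.
\<close>

definition num_models :: "fm set \<Rightarrow> nat struc set rel" where
  "num_models T = |{M :: nat struc. is_model M T} // iso_rel|"

definition num_models_of :: "'a struc \<Rightarrow> nat struc set rel" where
  "num_models_of Z = num_models (Th Z)"

definition continuum :: "(nat \<Rightarrow> bool) rel" where
  "continuum = ctwo ^c natLeq"


subsection \<open>Lexicographic sums and decompositions\<close>

definition poset :: "'a struc \<Rightarrow> bool" where
  "poset M \<longleftrightarrow> is_struc M \<and> partial_order_on (univ M) (leq M)"

definition has_largest :: "'a struc \<Rightarrow> bool" where
  "has_largest M \<longleftrightarrow> (\<exists>m\<in>univ M. \<forall>x\<in>univ M. (x, m) \<in> leq M)"

definition lex_sum :: "'i struc \<Rightarrow> ('i \<Rightarrow> 'a struc) \<Rightarrow> 'a struc" where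
  "lex_sum I X =
     \<lparr>univ = (\<Union>i\<in>univ I. univ (X i)),
      leq = {(x, x').
        (\<exists>i\<in>univ I. x \<in> univ (X i) \<and> x' \<in> univ (X i) \<and> (x, x') \<in> leq (X i)) \<or>
        (\<exists>i\<in>univ I. \<exists>j\<in>univ I. x \<in> univ (X i) \<and> x' \<in> univ (X j) \<and> (i, j) \<in> leq I \<and> i \<noteq> j)}\<rparr>"

text \<open>
  Finite index orders are represented, up to isomorphism, on sets of natural numbers.  As the
  summands are disjoint, the order of the sum induces on each summand its own order, so the
  domains of the summands form a partition into induced suborders.
\<close>

definition fld1_decomposition :: "nat struc \<Rightarrow> (nat \<Rightarrow> 'a struc) \<Rightarrow> bool" where
  "fld1_decomposition I X \<longleftrightarrow>
     poset I \<and> finite (univ I) \<and>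
     (\<forall>i\<in>univ I. poset (X i) \<and> has_largest (X i)) \<and>
     disjoint_family_on (\<lambda>i. univ (X i)) (univ I)"

definition fld1 :: "'a struc \<Rightarrow> bool" where
  "fld1 M \<longleftrightarrow> (\<exists>I X. fld1_decomposition I X \<and> M = lex_sum I X)"

definition fld1_theory :: "'a itself \<Rightarrow> fm set \<Rightarrow> bool" where
  "fld1_theory U T \<longleftrightarrow>
     complete_theory U T \<and>
     (\<forall>M :: 'a struc. is_model M T \<longrightarrow> poset M) \<and>
     (\<exists>M :: 'a struc. is_model M T \<and> fld1 M)"

definition decompositions :: "'a itself \<Rightarrow> fm set \<Rightarrow> (nat struc \<times> (nat \<Rightarrow> 'a struc)) set" where
  "decompositions U T = {(I, X). fld1_decomposition I X \<and> is_model (lex_sum I X) T}"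

definition actually_vaught :: "'a itself \<Rightarrow> fm set \<Rightarrow> bool" where
  "actually_vaught U T \<longleftrightarrow>
     (\<exists>(I, X) \<in> decompositions U T. \<exists>\<tau> :: nat \<Rightarrow> fm.
        (\<forall>i\<in>univ I. \<tau> i \<in> Th (X i)) \<and>
        (\<forall>i\<in>univ I. \<forall>Z :: 'a struc. poset Z \<and> holds Z (\<tau> i) \<longrightarrow>
           num_models_of Z \<le>o natLeq \<or> num_models_of Z =o continuum))"

end

theory Submission
  imports Defs
begin

text \<open>
  Let \<open>\<Sum>X i\<close> be a decomposition of a model of \<open>T\<close>. The largest elements of the summands form a tuple
  over which the summands are definable, so every model of \<open>T\<close> contains such a tuple, and a countable
  model has only countably many of them. Conversely, by a Feferman-Vaught argument the theories
  (and types) of the summands determine those of the sum.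

  If some summand has continuum many countable models, exchanging it for these yields continuum many
  models of \<open>T\<close>, since each countable model arises from only countably many choices. If \<open>T\<close> is large, a
  Cantor tree of formulas gives continuum many types, and each countable model realizes only
  countably many. Otherwise a countable model is determined by the isomorphism classes of its summands;
  their theories depend only on the type of the tuple, for which there are countably many choices, and
  each of these theories has countably many countable models.

  Uniqueness of the countable model is equivalent to finiteness of the type spaces, which passes from
  the summands to the sum and back. If \<open>T\<close> is small with an infinite type space, Vaught's argument
  yields three models: the atomic one, the countable saturated one, and one that is atomic over a
  realization of a non-isolated type. Saturated models are cut out of an ultrapower.
\<close>

subsection \<open>Satisfaction, types and elementary substructures\<close>

text \<open>The obstacle in counting is that a countable model of \<open>T\<close> need not split
  into summands elementarily equivalent to the given \<open>X i\<close>. A whole theory is not a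
  finite condition on the tuple of largest elements, so it can be lost when the tuple is chosen in
  another model. The single sentences \<open>\<tau> i\<close> survive: together with the formula
  saying that the tuple decomposes the model they form a finite set of formulas, satisfied by some
  tuple in every model. This brings the summands of each countable model within reach of the
  hypothesis.

  That hypothesis speaks of structures on \<open>'a\<close>, while the models counted live on the
  natural numbers. Everything is therefore phrased through \<open>Th\<close>, which compares
  structures on different types, and injections move single structures across.

  Tuples are total assignments of which only the coordinates below some \<open>n\<close> matter.
  Coordinates may repeat, so finiteness of all type spaces holds for finite structures as well and
  describes uniqueness of the countable model without a case distinction.\<close>

instance fm :: countable
  by countable_datatype

abbreviation asg :: "'a struc \<Rightarrow> (nat \<Rightarrow> 'a) \<Rightarrow> bool" where
  "asg M s \<equiv> range s \<subseteq> univ M"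

lemma finite_fv [simp]: "finite (fv \<phi>)"
  by (induction \<phi>) auto

lemma fv_bounded: "\<exists>n. fv \<phi> \<subseteq> {..<n}"
  using finite_nat_set_iff_bounded[of "fv \<phi>"] by auto

lemma sat_cong: "(\<And>v. v \<in> fv \<phi> \<Longrightarrow> s v = t v) \<Longrightarrow> sat M s \<phi> = sat M t \<phi>"
proof (induction \<phi> arbitrary: s t)
  case (Ex n \<phi>)
  have "sat M (s(n := a)) \<phi> = sat M (t(n := a)) \<phi>" for a
    by (rule Ex.IH) (use Ex.prems in auto)
  then show ?case by simp
next
  case (Neg \<phi>)
  from Neg.IH[of s t] Neg.prems show ?case by auto
next
  case (Conj \<phi> \<psi>)
  from Conj.IH[of s t] Conj.prems show ?case by auto
qed auto

lemma sat_sentence: "sentence \<phi> \<Longrightarrow> sat M s \<phi> = sat M t \<phi>"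
  by (rule sat_cong) (auto simp: sentence_def)

lemma asg_upd: "asg M s \<Longrightarrow> a \<in> univ M \<Longrightarrow> asg M (s(n := a))"
  by auto

lemma ex_asg: "is_struc M \<Longrightarrow> \<exists>s. asg M s"
  unfolding is_struc_def by (metis all_not_in_conv image_subset_iff)

definition iso_map :: "('a \<Rightarrow> 'b) \<Rightarrow> 'a struc \<Rightarrow> 'b struc \<Rightarrow> bool" where
  "iso_map f M N \<longleftrightarrow> bij_betw f (univ M) (univ N) \<and>
     (\<forall>x\<in>univ M. \<forall>y\<in>univ M. (x, y) \<in> leq M \<longleftrightarrow> (f x, f y) \<in> leq N)"

lemma isomorphic_iff: "isomorphic M N \<longleftrightarrow> (\<exists>f. iso_map f M N)"
  by (simp add: isomorphic_def iso_map_def)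

lemma iso_map_inv:
  assumes "iso_map f M N"
  shows "iso_map (the_inv_into (univ M) f) N M"
proof -
  have "bij_betw (the_inv_into (univ M) f) (univ N) (univ M)"
    using assms by (simp add: iso_map_def bij_betw_the_inv_into)
  moreover have "f (the_inv_into (univ M) f x) = x" "the_inv_into (univ M) f x \<in> univ M"
    if "x \<in> univ N" for x
    using assms that by (auto simp: iso_map_def bij_betw_def f_the_inv_into_f the_inv_into_into)
  ultimately show ?thesis using assms by (auto simp: iso_map_def)
qed

lemma iso_map_comp: "iso_map f M N \<Longrightarrow> iso_map g N K \<Longrightarrow> iso_map (g \<circ> f) M K"
  unfolding iso_map_def by (auto intro: bij_betw_trans simp: bij_betwE)

lemma isomorphic_refl: "isomorphic M M"
  unfolding isomorphic_def by (rule exI[of _ id]) auto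

lemma isomorphic_sym: "isomorphic M N \<Longrightarrow> isomorphic N M"
  unfolding isomorphic_iff using iso_map_inv by blast

lemma isomorphic_trans: "isomorphic M N \<Longrightarrow> isomorphic N K \<Longrightarrow> isomorphic M K"
  unfolding isomorphic_iff using iso_map_comp by blast

lemma iso_map_asg: "iso_map f M N \<Longrightarrow> asg M s \<Longrightarrow> asg N (f \<circ> s)"
  unfolding iso_map_def bij_betw_def by auto

lemma sat_iso: "iso_map f M N \<Longrightarrow> asg M s \<Longrightarrow> sat N (f \<circ> s) \<phi> = sat M s \<phi>"
proof (induction \<phi> arbitrary: s)
  case (Eq m n)
  then show ?case unfolding iso_map_def bij_betw_def
    by (auto simp: inj_on_eq_iff range_subsetD)
next
  case (Le m n)
  then show ?case unfolding iso_map_def by (auto simp: range_subsetD)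
next
  case (Ex n \<phi>)
  have *: "sat N ((f \<circ> s)(n := f a)) \<phi> = sat M (s(n := a)) \<phi>" if "a \<in> univ M" for a
    using Ex.IH[OF Ex.prems(1) asg_upd[OF Ex.prems(2) that, of n]]
    by (simp only: fun_upd_comp)
  have "univ N = f ` univ M" using Ex.prems(1) by (auto simp: iso_map_def bij_betw_def)
  then show ?case using * by (simp add: comp_def)
qed auto

lemma iso_map_asg_lift:
  assumes "iso_map f M N" "asg N t"
  obtains s where "asg M s" "t = f \<circ> s"
proof
  let ?g = "the_inv_into (univ M) f"
  have "iso_map ?g N M" by (rule iso_map_inv[OF assms(1)])
  then show "asg M (?g \<circ> t)" using assms(2) by (rule iso_map_asg)
  show "t = f \<circ> (?g \<circ> t)"
    using assms by (auto simp: iso_map_def bij_betw_def f_the_inv_into_f fun_eq_iff range_subsetD)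
qed

lemma Th_iff: "asg M s \<Longrightarrow> \<phi> \<in> Th M \<longleftrightarrow> sentence \<phi> \<and> sat M s \<phi>"
  unfolding Th_def holds_def using sat_sentence by blast

lemma Th_iso: assumes "is_struc M" "iso_map f M N" shows "Th N = Th M"
proof -
  obtain s where s: "asg M s" using ex_asg assms by blast
  then show ?thesis using Th_iff[OF s] Th_iff[OF iso_map_asg[OF assms(2) s]] sat_iso[OF assms(2) s] by blast
qed

lemma Th_eq_sat: "Th M = Th N \<Longrightarrow> asg M s \<Longrightarrow> asg N t \<Longrightarrow> sentence \<phi> \<Longrightarrow> sat M s \<phi> = sat N t \<phi>"
  using Th_iff by metis

lemma model_Th_iff:
  fixes M :: "'a struc" and N :: "'b struc"
  assumes "is_struc M" 
  shows "is_model N (Th M) \<longleftrightarrow> is_struc N \<and> Th N = Th M"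
proof 
  assume N: "is_model N (Th M)"
  then have "is_struc N" by (simp add: is_model_def)
  obtain s where s: "asg M s" using ex_asg assms by blast
  obtain t where t: "asg N t" using ex_asg \<open>is_struc N\<close> by blast
  have sub: "Th M \<subseteq> Th N" using N by (auto simp: is_model_def Th_def)
  have "Th N \<subseteq> Th M"
  proof
    fix \<phi> assume p: "\<phi> \<in> Th N"
    show "\<phi> \<in> Th M"
    proof (rule ccontr)
      assume "\<phi> \<notin> Th M"
      then have "Neg \<phi> \<in> Th M" using p Th_iff[OF s] Th_iff[OF t] by (simp add: sentence_def)
      then show False using sub p Th_iff[OF t] by auto
    qed
  qed
  then show "is_struc N \<and> Th N = Th M" using sub \<open>is_struc N\<close> by auto
qed (auto simp: is_model_def Th_def)

section \<open>Types of tuples\<close>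

definition tp :: "nat \<Rightarrow> 'a struc \<Rightarrow> (nat \<Rightarrow> 'a) \<Rightarrow> fm set" where
  "tp n M s = {\<phi>. fv \<phi> \<subseteq> {..<n} \<and> sat M s \<phi>}"

lemma tp_eq_iff: "tp n M s = tp n N t \<longleftrightarrow> (\<forall>\<phi>. fv \<phi> \<subseteq> {..<n} \<longrightarrow> sat M s \<phi> = sat N t \<phi>)"
  unfolding tp_def set_eq_iff by simp blast

lemma tp_eq_sat: "tp n M s = tp n N t \<Longrightarrow> fv \<phi> \<subseteq> {..<n} \<Longrightarrow> sat M s \<phi> = sat N t \<phi>"
  by (simp add: tp_eq_iff)

lemma tp_cong: "(\<And>i. i < n \<Longrightarrow> s i = t i) \<Longrightarrow> tp n M s = tp n M t"
  unfolding tp_eq_iff by (intro allI impI sat_cong) auto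

lemma tp_mono: "tp n M s = tp n N t \<Longrightarrow> m \<le> n \<Longrightarrow> tp m M s = tp m N t"
  unfolding tp_eq_iff using lessThan_subset_iff subset_trans by meson

lemma tp_0_iff: "asg M s \<Longrightarrow> asg N t \<Longrightarrow> tp 0 M s = tp 0 N t \<longleftrightarrow> Th M = Th N"
  using Th_iff[of s M] Th_iff[of t N] unfolding tp_def sentence_def by auto

lemma tp_Th: "asg M s \<Longrightarrow> asg N t \<Longrightarrow> tp n M s = tp n N t \<Longrightarrow> Th M = Th N"
  using tp_mono[of n M s N t 0] tp_0_iff[of s M t N] by simp

lemma tp_iso: "iso_map f M N \<Longrightarrow> asg M s \<Longrightarrow> tp n N (f \<circ> s) = tp n M s"
  by (simp add: tp_eq_iff sat_iso)

text \<open>Complete types are maximal: a formula in the variables below \<open>n\<close> or its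
  negation belongs to the type.\<close>

lemma tp_sub_eq: "tp n M s \<subseteq> tp n N t \<Longrightarrow> tp n M s = tp n N t"
proof
  show "tp n N t \<subseteq> tp n M s" if "tp n M s \<subseteq> tp n N t"
  proof
    fix \<phi> assume p: "\<phi> \<in> tp n N t"
    show "\<phi> \<in> tp n M s"
    proof (rule ccontr)
      assume "\<phi> \<notin> tp n M s"
      then have "Neg \<phi> \<in> tp n M s" using p by (simp add: tp_def)
      then have "Neg \<phi> \<in> tp n N t" using that by blast
      then show False using p by (simp add: tp_def)
    qed
  qed
qed

text \<open>Each bound variable is replaced by one outside the image of the free variables, so
  \<open>r\<close> may be any map. Non-injective maps occur when a tuple lists an element several
  times.\<close>

primrec rename :: "(nat \<Rightarrow> nat) \<Rightarrow> fm \<Rightarrow> fm" where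
  "rename r (Eq m n) = Eq (r m) (r n)"
| "rename r (Le m n) = Le (r m) (r n)"
| "rename r (Neg \<phi>) = Neg (rename r \<phi>)"
| "rename r (Conj \<phi> \<psi>) = Conj (rename r \<phi>) (rename r \<psi>)"
| "rename r (Ex n \<phi>) = (let z = (SOME z. z \<notin> r ` fv \<phi>) in Ex z (rename (r(n := z)) \<phi>))"

lemma fresh_some: fixes r :: "nat \<Rightarrow> nat" shows "(SOME z. z \<notin> r ` fv \<phi>) \<notin> r ` fv \<phi>"
  by (rule someI_ex[OF ex_new_if_finite[OF infinite_UNIV_nat finite_imageI[OF finite_fv]]])

lemma fv_rename: "fv (rename r \<phi>) \<subseteq> r ` fv \<phi>"
proof (induction \<phi> arbitrary: r)
  case (Ex n \<phi>)
  define z where "z = (SOME z. z \<notin> r ` fv \<phi>)"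
  have "fv (rename (r(n := z)) \<phi>) - {z} \<subseteq> r ` (fv \<phi> - {n})"
  proof
    fix x assume x: "x \<in> fv (rename (r(n := z)) \<phi>) - {z}"
    then obtain y where "y \<in> fv \<phi>" "x = (r(n := z)) y" using Ex.IH[of "r(n := z)"] by blast
    with x show "x \<in> r ` (fv \<phi> - {n})" by (cases "y = n") auto
  qed
  then show ?case by (simp add: Let_def z_def)
next
  case (Conj \<phi> \<psi>)
  from Conj.IH(1)[of r] Conj.IH(2)[of r] show ?case by auto
qed auto

lemma sat_rename: "sat M s (rename r \<phi>) = sat M (s \<circ> r) \<phi>"
proof (induction \<phi> arbitrary: r s)
  case (Ex n \<phi>)
  define z where "z = (SOME z. z \<notin> r ` fv \<phi>)"
  have z: "z \<notin> r ` fv \<phi>" unfolding z_def by (rule fresh_some)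
  have "sat M (s(z := a) \<circ> r(n := z)) \<phi> = sat M ((s \<circ> r)(n := a)) \<phi>" for a
    by (rule sat_cong) (use z in auto)
  moreover have "sat M s (rename r (Ex n \<phi>)) \<longleftrightarrow> (\<exists>a\<in>univ M. sat M (s(z := a)) (rename (r(n := z)) \<phi>))"
    by (simp add: Let_def z_def)
  ultimately show ?case unfolding Ex.IH by (simp only: sat.simps)
qed auto

definition Ex_list :: "nat list \<Rightarrow> fm \<Rightarrow> fm" where
  "Ex_list xs \<phi> = foldr Ex xs \<phi>"

lemma fv_Ex_list: "fv (Ex_list xs \<phi>) = fv \<phi> - set xs"
  by (induction xs) (auto simp: Ex_list_def)

lemma sat_Ex_list:
  "asg M s \<Longrightarrow> sat M s (Ex_list xs \<phi>) \<longleftrightarrow> (\<exists>t. asg M t \<and> (\<forall>i. i \<notin> set xs \<longrightarrow> t i = s i) \<and> sat M t \<phi>)"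
proof (induction xs arbitrary: s)
  case Nil
  then have "(\<forall>i. t i = s i) \<longleftrightarrow> t = s" for t by auto
  with Nil show ?case by (auto simp: Ex_list_def)
next
  case (Cons x xs)
  have "sat M s (Ex_list (x # xs) \<phi>) \<longleftrightarrow> (\<exists>a\<in>univ M. sat M (s(x := a)) (Ex_list xs \<phi>))"
    by (simp add: Ex_list_def)
  also have "\<dots> \<longleftrightarrow> (\<exists>a\<in>univ M. \<exists>t. asg M t \<and> (\<forall>i. i \<notin> set xs \<longrightarrow> t i = (s(x := a)) i) \<and> sat M t \<phi>)"
    using Cons.IH[OF asg_upd[OF Cons.prems]] by blast
  also have "\<dots> \<longleftrightarrow> (\<exists>t. asg M t \<and> (\<forall>i. i \<notin> set (x # xs) \<longrightarrow> t i = s i) \<and> sat M t \<phi>)" (is "?L \<longleftrightarrow> ?R")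
  proof
    assume ?R
    then obtain t where t: "asg M t" "\<forall>i. i \<notin> set (x # xs) \<longrightarrow> t i = s i" "sat M t \<phi>" by blast
    then have "t x \<in> univ M" "\<forall>i. i \<notin> set xs \<longrightarrow> t i = (s(x := t x)) i" by auto
    with t show ?L by blast
  qed (metis fun_upd_apply list.set_intros)
  finally show ?case .
qed

text \<open>The empty conjunction is the sentence \<open>Ex 0 (Eq 0 0)\<close>, which contributes no
  free variable and is true in every nonempty structure.\<close>

definition Conj_set :: "fm set \<Rightarrow> fm" where
  "Conj_set F = foldr Conj (SOME xs. set xs = F) (Ex 0 (Eq 0 0))"

lemma set_Conj_set_list: "finite F \<Longrightarrow> set (SOME xs. set xs = F) = F"
  by (rule someI_ex) (rule finite_list)

lemma fv_Conj_set: assumes "finite F" shows "fv (Conj_set F) = \<Union> (fv ` F)"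
proof -
  have "fv (foldr Conj xs (Ex 0 (Eq 0 0))) = \<Union> (fv ` set xs)" for xs
    by (induction xs) auto
  then show ?thesis using set_Conj_set_list[OF assms] by (simp add: Conj_set_def)
qed

lemma sat_Conj_set:
  assumes "finite F" "univ M \<noteq> {}"
  shows "sat M s (Conj_set F) \<longleftrightarrow> (\<forall>\<phi>\<in>F. sat M s \<phi>)"
proof -
  have "sat M s (foldr Conj xs (Ex 0 (Eq 0 0))) \<longleftrightarrow> (\<forall>\<phi>\<in>set xs. sat M s \<phi>)" for xs
    using assms(2) by (induction xs) auto
  then show ?thesis using set_Conj_set_list[OF assms(1)] by (simp add: Conj_set_def)
qed

lemma asg_nonempty: "asg M s \<Longrightarrow> univ M \<noteq> {}"
  by auto

abbreviation satisfiable :: "'a struc \<Rightarrow> nat \<Rightarrow> (nat \<Rightarrow> 'a) \<Rightarrow> fm set \<Rightarrow> bool" where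
  "satisfiable M n s F \<equiv> \<exists>t. asg M t \<and> (\<forall>i<n. t i = s i) \<and> (\<forall>\<phi>\<in>F. sat M t \<phi>)"

text \<open>The finite set becomes one conjunction; quantifying its variables from \<open>n\<close>
  on leaves a formula in the first \<open>n\<close> variables, on which the two sides agree.\<close>

lemma tp_transfer:
  assumes st: "tp n M s = tp n N t" "asg M s" "asg N t"
    and s': "asg M s'" "\<forall>i<n. s' i = s i" and F: "finite F" "\<forall>\<phi>\<in>F. sat M s' \<phi>"
  shows "\<exists>t'. asg N t' \<and> (\<forall>i<n. t' i = t i) \<and> (\<forall>\<phi>\<in>F. sat N t' \<phi>)"
proof -
  obtain m where m: "fv (Conj_set F) \<subseteq> {..<m}" using fv_bounded by blast
  let ?e = "Ex_list [n..<m] (Conj_set F)"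
  have fe: "fv ?e \<subseteq> {..<n}" using m by (auto simp: fv_Ex_list)
  have c: "sat M s' (Conj_set F)" using F s' by (simp add: sat_Conj_set asg_nonempty)
  \<comment> \<open>The quantifier block may change only the variables from \<open>n\<close> to
    \<open>m\<close>, so \<open>s'\<close> is cut off at \<open>m\<close>, beyond which the
    conjunction has no free variable.\<close>
  let ?w = "\<lambda>i. if i < m then s' i else s i"
  have "sat M ?w (Conj_set F)" using c m by (subst sat_cong[where t=s']) auto
  moreover have "asg M ?w" using st s' by auto
  moreover have "\<forall>i. i \<notin> set [n..<m] \<longrightarrow> ?w i = s i" using s' by auto
  ultimately have "sat M s ?e" using sat_Ex_list[OF st(2)] by blast
  then have "sat N t ?e" using tp_eq_sat[OF st(1) fe] by simp
  then obtain t' where "asg N t'" "\<forall>i. i \<notin> set [n..<m] \<longrightarrow> t' i = t i" "sat N t' (Conj_set F)"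
    using sat_Ex_list[OF st(3)] by blast
  then show ?thesis using F by (auto simp: sat_Conj_set asg_nonempty intro!: exI[of _ t'])
qed

lemma Th_transfer:
  assumes "Th M = Th N" "is_struc N" "asg M s" "finite F" "\<forall>\<phi>\<in>F. sat M s \<phi>"
  shows "\<exists>t. asg N t \<and> (\<forall>\<phi>\<in>F. sat N t \<phi>)"
proof -
  obtain t where t: "asg N t" using ex_asg assms by blast
  then have "tp 0 M s = tp 0 N t" using tp_0_iff assms by blast
  from tp_transfer[OF this assms(3) t assms(3)] assms show ?thesis by simp
qed

section \<open>Elementary substructures and the Loewenheim-Skolem theorem\<close>

definition substruc :: "'a struc \<Rightarrow> 'a set \<Rightarrow> 'a struc" where
  "substruc M D = \<lparr>univ = D, leq = leq M \<inter> D \<times> D\<rparr>"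

lemma univ_substruc [simp]: "univ (substruc M D) = D" by (simp add: substruc_def)
lemma leq_substruc [simp]: "leq (substruc M D) = leq M \<inter> D \<times> D" by (simp add: substruc_def)
lemma is_struc_substruc: "D \<noteq> {} \<Longrightarrow> is_struc (substruc M D)" by (auto simp: is_struc_def)

definition elem_sub :: "'a struc \<Rightarrow> 'a set \<Rightarrow> bool" where
  "elem_sub M D \<longleftrightarrow> D \<subseteq> univ M \<and> D \<noteq> {} \<and> (\<forall>s \<phi>. range s \<subseteq> D \<longrightarrow> sat (substruc M D) s \<phi> = sat M s \<phi>)"

lemma elem_sub_struc: "elem_sub M D \<Longrightarrow> is_struc (substruc M D)"
  by (simp add: elem_sub_def is_struc_substruc)

lemma elem_sub_tp: "elem_sub M D \<Longrightarrow> range s \<subseteq> D \<Longrightarrow> tp n (substruc M D) s = tp n M s"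
  by (simp add: elem_sub_def tp_def)

lemma elem_sub_Th:
  assumes "elem_sub M D" shows "Th (substruc M D) = Th M"
proof -
  obtain s where s: "asg (substruc M D) s" using ex_asg elem_sub_struc assms by blast
  then have "asg M s" using assms by (auto simp: elem_sub_def)
  with s show ?thesis using elem_sub_tp[OF assms, of s 0] tp_0_iff[of s "substruc M D" s M] by simp
qed

text \<open>Witnesses are demanded only for variable \<open>n\<close> in formulas over the variables
  up to \<open>n\<close>, the form in which the constructions below provide them. Any other bound
  variable is first renamed to a fresh \<open>n\<close> above all variables of the formula.\<close>

lemma Tarski_Vaught:
  assumes D: "D \<subseteq> univ M" "D \<noteq> {}"
    and tv: "\<And>s n \<phi> a. range s \<subseteq> D \<Longrightarrow> fv \<phi> \<subseteq> {..n} \<Longrightarrow> a \<in> univ M \<Longrightarrow> sat M (s(n := a)) \<phi>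
       \<Longrightarrow> \<exists>b\<in>D. sat M (s(n := b)) \<phi>"
  shows "elem_sub M D"
proof -
  have "range s \<subseteq> D \<Longrightarrow> sat (substruc M D) s \<phi> = sat M s \<phi>" for s \<phi>
  proof (induction \<phi> arbitrary: s)
    case (Ex v \<phi>)
    have 1: "sat (substruc M D) (s(v := a)) \<phi> = sat M (s(v := a)) \<phi>" if "a \<in> D" for a
      by (rule Ex.IH) (use Ex.prems that in auto)
    have "\<exists>b\<in>D. sat M (s(v := b)) \<phi>" if a: "a \<in> univ M" "sat M (s(v := a)) \<phi>" for a
    proof -
      obtain n where n: "fv \<phi> \<subseteq> {..<n}" using fv_bounded by blast
      let ?r = "id(v := n)"
      have c: "sat M (s(n := b)) (rename ?r \<phi>) = sat M (s(v := b)) \<phi>" for b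
        unfolding sat_rename by (rule sat_cong) (use n in auto)
      have "fv (rename ?r \<phi>) \<subseteq> {..n}" using fv_rename[of ?r \<phi>] n by (fastforce split: if_splits)
      from tv[OF Ex.prems this a(1)] a(2) c show ?thesis by simp
    qed
    with 1 D show ?case by auto
  qed auto
  with D show ?thesis by (simp add: elem_sub_def)
qed

text \<open>The closure is the union of an increasing chain: a finite list already lies in some
  stage, and its values enter at the next one.\<close>

lemma countable_closure:
  fixes h :: "'x list \<Rightarrow> 'i \<Rightarrow> 'x set"
  assumes "countable C" "C \<subseteq> A" "countable J" "\<And>xs j. countable (h xs j)"
    "\<And>xs j. h xs j \<subseteq> A"
  obtains D where "countable D" "C \<subseteq> D" "D \<subseteq> A" "\<And>xs j. set xs \<subseteq> D \<Longrightarrow> j \<in> J \<Longrightarrow> h xs j \<subseteq> D"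
proof -
  define E where "E = rec_nat C (\<lambda>_ B. B \<union> (\<Union>xs\<in>lists B. \<Union>j\<in>J. h xs j))"
  have E0: "E 0 = C" and ES: "E (Suc n) = E n \<union> (\<Union>xs\<in>lists (E n). \<Union>j\<in>J. h xs j)" for n
    by (simp_all add: E_def)
  have mono: "m \<le> n \<Longrightarrow> E m \<subseteq> E n" for m n
    by (rule lift_Suc_mono_le[of E]) (auto simp: ES)
  show thesis
  proof (rule that[of "\<Union>n. E n"])
    have "countable (E n)" for n
      by (induction n) (use assms in \<open>auto simp: E0 ES intro!: countable_UN countable_lists\<close>)
    then show "countable (\<Union>n. E n)" by simp
    show "C \<subseteq> (\<Union>n. E n)" using E0 by blast
    have "E n \<subseteq> A" for n
    proof (induction n)
      case (Suc n)
      then show ?case unfolding ES using assms(5) by blast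
    qed (simp add: E0 assms)
    then show "(\<Union>n. E n) \<subseteq> A" by blast
    show "h xs j \<subseteq> (\<Union>n. E n)" if "set xs \<subseteq> (\<Union>n. E n)" "j \<in> J" for xs j
    proof -
      have "\<exists>n. set xs \<subseteq> E n" using that(1)
      proof (induction xs)
        case (Cons x xs)
        then obtain m n where "set xs \<subseteq> E n" "x \<in> E m" by auto
        then have "set (x # xs) \<subseteq> E (max m n)" using mono[of n "max m n"] mono[of m "max m n"] by auto
        then show ?case by blast
      qed simp
      then obtain n where "set xs \<subseteq> E n" by blast
      then have "h xs j \<subseteq> E (Suc n)" using that(2) by (auto simp: ES)
      then show ?thesis by blast
    qed
  qed
qed

lemma Loewenheim_Skolem:
  assumes M: "is_struc M" and C: "countable C" "C \<subseteq> univ M"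
  obtains D where "countable D" "C \<subseteq> D" "elem_sub M D"
proof -
  obtain m where m: "m \<in> univ M" using M by (auto simp: is_struc_def)
  \<comment> \<open>The list fills the variables below its length and every other variable receives
    the candidate. Hence \<open>a\<close> is a witness for the variable numbered
    \<open>length xs\<close>.\<close>
  define P where "P xs \<phi> a \<longleftrightarrow> a \<in> univ M \<and> sat M (\<lambda>i. if i < length xs then xs ! i else a) \<phi>" for xs \<phi> a
  define h where "h xs \<phi> = (if \<exists>a. P xs \<phi> a then {SOME a. P xs \<phi> a} else {})" for xs \<phi>
  have hP: "b \<in> h xs \<phi> \<Longrightarrow> P xs \<phi> b" for b xs \<phi>
    by (auto simp: h_def intro: someI split: if_splits)
  have 1: "countable (insert m C)" "insert m C \<subseteq> univ M" using C m by auto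
  have 2: "countable (h xs j)" for xs j by (simp add: h_def)
  have 3: "h xs j \<subseteq> univ M" for xs j using hP by (auto simp: P_def)
  obtain D where D: "countable D" "insert m C \<subseteq> D" "D \<subseteq> univ M"
    "\<And>xs j. set xs \<subseteq> D \<Longrightarrow> j \<in> (UNIV :: fm set) \<Longrightarrow> h xs j \<subseteq> D"
    using countable_closure[where h=h and J=UNIV, OF 1 countableI_type 2 3] by metis
  have "elem_sub M D"
  proof (rule Tarski_Vaught)
    fix s n \<phi> a
    assume s: "range s \<subseteq> D" and f: "fv \<phi> \<subseteq> {..n}" and a: "a \<in> univ M" "sat M (s(n := a)) \<phi>"
    let ?xs = "map s [0..<n]"
    have c: "sat M (\<lambda>i. if i < length ?xs then ?xs ! i else b) \<phi> = sat M (s(n := b)) \<phi>" for b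
      by (rule sat_cong) (use f in auto)
    have "\<exists>a. P ?xs \<phi> a" unfolding P_def c using a by blast
    then obtain b where b: "b \<in> h ?xs \<phi>" by (auto simp: h_def)
    have "b \<in> D" using D(4)[of ?xs \<phi>] s b by auto
    moreover have "sat M (s(n := b)) \<phi>" using hP[OF b] unfolding P_def c by blast
    ultimately show "\<exists>b\<in>D. sat M (s(n := b)) \<phi>" by blast
  qed (use D in auto)
  with D that show thesis by auto
qed

section \<open>Copies on other types, and type spaces\<close>

definition image_struc :: "('a \<Rightarrow> 'b) \<Rightarrow> 'a struc \<Rightarrow> 'b struc" where
  "image_struc f M = \<lparr>univ = f ` univ M, leq = map_prod f f ` leq M\<rparr>"

lemma univ_image_struc [simp]: "univ (image_struc f M) = f ` univ M" by (simp add: image_struc_def)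

lemma is_struc_image_struc: "is_struc M \<Longrightarrow> is_struc (image_struc f M)"
  by (auto simp: is_struc_def image_struc_def)

lemma iso_map_image_struc: "is_struc M \<Longrightarrow> inj_on f (univ M) \<Longrightarrow> iso_map f M (image_struc f M)"
  unfolding iso_map_def is_struc_def image_struc_def
  by (force simp: bij_betw_def inj_on_eq_iff subset_iff)

lemma countable_nat_copy:
  assumes "is_struc M" "countable (univ M)"
  obtains f and N :: "nat struc" where "is_struc N" "iso_map f M N"
  using is_struc_image_struc[OF assms(1), of "to_nat_on (univ M)"]
    iso_map_image_struc[OF assms(1) inj_on_to_nat_on[OF assms(2)]] by blast

text \<open>The whole range of \<open>s\<close> is countable, so one submodel keeps the types of all
  initial segments of \<open>s\<close> simultaneously.\<close>

lemma nat_model_realizing: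
  assumes M: "is_struc M" "asg M s"
  obtains N :: "nat struc" and t where "is_struc N" "asg N t" "Th N = Th M" "\<And>n. tp n N t = tp n M s"
proof -
  obtain D where D: "countable D" "range s \<subseteq> D" "elem_sub M D"
    using Loewenheim_Skolem[OF M(1), of "range s"] M by auto
  have sD: "is_struc (substruc M D)" using D elem_sub_struc by blast
  obtain f and N :: "nat struc" where N: "is_struc N" "iso_map f (substruc M D) N"
    using countable_nat_copy[OF sD] D(1) univ_substruc by metis
  have "asg (substruc M D) s" using D by simp
  then show thesis
    using that[of N "f \<circ> s"] N iso_map_asg[OF N(2)] tp_iso[OF N(2)] elem_sub_tp[OF D(3,2)]
      Th_iso[OF sD N(2)] elem_sub_Th[OF D(3)] by simp
qed

lemma nat_model_of:
  assumes "is_struc M"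
  obtains N :: "nat struc" where "is_struc N" "Th N = Th M"
  using nat_model_realizing[OF assms] ex_asg[OF assms] that by metis

text \<open>The way back from countable models to structures on \<open>'a\<close>, where the
  hypotheses of the theorem apply.\<close>

lemma copy_to_infinite:
  fixes N :: "nat struc"
  assumes "is_struc N"
  obtains f and M :: "'a::infinite struc" where "is_struc M" "iso_map f N M"
proof -
  obtain f :: "nat \<Rightarrow> 'a" where "inj f" 
    using infinite_UNIV[where 'a='a] infinite_iff_countable_subset[of "UNIV :: 'a set"] by auto
  then have "inj_on f (univ N)" using inj_on_subset by blast
  then show thesis using that[of "image_struc f N" f] is_struc_image_struc[OF assms] iso_map_image_struc[OF assms] by blast
qed

text \<open>Countable models realize every type of the theory, so natural numbers suffice and the
  notion carries no type parameter.\<close>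

definition types :: "nat \<Rightarrow> fm set \<Rightarrow> fm set set" where
  "types n T = {tp n N s | (N :: nat struc) s. is_model N T \<and> asg N s}"

lemma tp_in_types:
  assumes "is_struc M" "asg M s"
  shows "tp n M s \<in> types n (Th M)"
proof -
  obtain N :: "nat struc" and t where "is_struc N" "asg N t" "Th N = Th M" "\<And>n. tp n N t = tp n M s"
    using nat_model_realizing[OF assms] by metis
  then show ?thesis unfolding types_def using model_Th_iff[OF assms(1)] by blast
qed

lemma typesE:
  assumes "p \<in> types n (Th M)" "is_struc M"
  obtains N :: "nat struc" and s where "is_struc N" "Th N = Th M" "asg N s" "p = tp n N s"
  using assms model_Th_iff[OF assms(2)] unfolding types_def by blast

subsection \<open>Ultrapowers and saturated models\<close>

text \<open>The infimum of a chain of filters is the union of their families of events, so the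
  impossible event would already belong to one member.\<close>

lemma chain_Inf_nonbot:
  fixes C :: "'a filter set"
  assumes "C \<noteq> {}" "\<And>F G. F \<in> C \<Longrightarrow> G \<in> C \<Longrightarrow> F \<le> G \<or> G \<le> F" "bot \<notin> C"
  shows "Inf C \<noteq> bot"
proof
  assume "Inf C = bot"
  then have "eventually (\<lambda>_. False) (Inf C)" by simp
  moreover have "eventually P (Inf C) \<longleftrightarrow> (\<exists>b\<in>C. eventually P b)" for P
  proof (rule eventually_Inf_base)
    show "\<exists>x\<in>C. x \<le> inf F G" if "F \<in> C" "G \<in> C" for F G
      using assms(2)[OF that] that by auto
  qed (use assms in auto)
  ultimately obtain b where "b \<in> C" "eventually (\<lambda>_. False) b" by blast
  then show False using assms(3) trivial_limit_def by (metis eventually_False)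
qed

text \<open>Zorn's lemma yields a minimal proper filter below \<open>F\<close>. If it does not
  already contain the complement of \<open>P\<close>, adjoining \<open>P\<close> keeps it proper,
  and minimality says that \<open>P\<close> was there before.\<close>

lemma ex_ultrafilter:
  fixes F :: "'a filter"
  assumes "F \<noteq> bot"
  obtains U where "U \<le> F" "U \<noteq> bot" "\<forall>P. eventually P U \<or> eventually (\<lambda>x. \<not> P x) U"
proof -
  let ?A = "{G. G \<le> F \<and> G \<noteq> bot}"
  have "\<exists>U\<in>?A. \<forall>G\<in>?A. G \<le> U \<longrightarrow> G = U"
  proof (rule predicate_Zorn[of ?A "\<lambda>x y. y \<le> x"])
    show "partial_order_on {G. G \<le> F \<and> G \<noteq> bot} (relation_of (\<lambda>x y. y \<le> x) {G. G \<le> F \<and> G \<noteq> bot})"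
      by (rule partial_order_on_relation_ofI) auto
    fix C assume C: "C \<in> Chains (relation_of (\<lambda>x y. y \<le> x) {G. G \<le> F \<and> G \<noteq> bot})"
    have "\<exists>u\<le>F. u \<noteq> bot \<and> (\<forall>a\<in>C. u \<le> a)"
    proof (cases "C = {}")
      case False
      have CA: "C \<subseteq> ?A" using C by (auto simp: Chains_def relation_of_def)
      have "Inf C \<noteq> bot"
        by (rule chain_Inf_nonbot) (use C False CA in \<open>auto simp: Chains_def relation_of_def\<close>)
      moreover have "Inf C \<le> F" using False CA by (auto intro: Inf_lower2)
      ultimately show ?thesis by (intro exI[of _ "Inf C"]) (auto intro: Inf_lower)
    qed (use assms in auto)
    then show "\<exists>u\<in>?A. \<forall>a\<in>C. u \<le> a" by auto
  qed
  then obtain U where U: "U \<le> F" "U \<noteq> bot" and min: "\<And>G. G \<le> F \<Longrightarrow> G \<noteq> bot \<Longrightarrow> G \<le> U \<Longrightarrow> G = U" by auto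
  have "eventually P U \<or> eventually (\<lambda>x. \<not> P x) U" for P
  proof (cases "inf U (principal (Collect P)) = bot")
    case True
    then have "eventually (\<lambda>x. \<not> P x) U"
      by (simp add: eventually_False[symmetric] eventually_inf_principal)
    then show ?thesis ..
  next
    case False
    have "inf U (principal (Collect P)) = U"
      by (rule min) (use U False in \<open>auto intro: order.trans[OF inf_le1]\<close>)
    then have "U \<le> principal (Collect P)" by (metis inf_le2)
    then show ?thesis by (simp add: le_principal)
  qed
  with U that show thesis by blast
qed

section \<open>Ultrapowers over the natural numbers\<close>

locale ultra =
  fixes U :: "nat filter" and M :: "'a struc"
  assumes U: "U \<noteq> bot" "\<And>P. eventually P U \<or> eventually (\<lambda>x. \<not> P x) U" "U \<le> sequentially"
    and M: "is_struc M"
begin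

definition fns :: "(nat \<Rightarrow> 'a) set" where
  "fns = {f. range f \<subseteq> univ M}"

text \<open>Equality is interpreted by equality, so the classes modulo the ultrafilter are replaced by
  chosen representatives.\<close>

definition rep :: "(nat \<Rightarrow> 'a) \<Rightarrow> nat \<Rightarrow> 'a" where
  "rep f = (SOME g. g \<in> fns \<and> eventually (\<lambda>i. g i = f i) U)"

definition P :: "(nat \<Rightarrow> 'a) struc" where
  "P = \<lparr>univ = rep ` fns, leq = {(f, g). f \<in> rep ` fns \<and> g \<in> rep ` fns \<and> eventually (\<lambda>i. (f i, g i) \<in> leq M) U}\<rparr>"

lemma ev_not: "eventually (\<lambda>x. \<not> Q x) U \<longleftrightarrow> \<not> eventually Q U"
  using U(1) U(2)[of Q] eventually_conj[of Q U "\<lambda>x. \<not> Q x"] by (auto simp: eventually_False)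

lemma rep: "f \<in> fns \<Longrightarrow> rep f \<in> fns \<and> eventually (\<lambda>i. rep f i = f i) U"
  unfolding rep_def by (rule someI[of _ f]) auto

lemma rep_eqI: 
  assumes "f \<in> fns" "g \<in> fns" "eventually (\<lambda>i. f i = g i) U"
  shows "rep f = rep g"
proof -
  have "eventually (\<lambda>i. h i = f i) U \<longleftrightarrow> eventually (\<lambda>i. h i = g i) U" for h
    using assms(3) by (auto elim: eventually_elim2)
  then show ?thesis by (simp add: rep_def)
qed

lemma univ_P_eqI: 
  assumes "f \<in> univ P" "g \<in> univ P" "eventually (\<lambda>i. f i = g i) U"
  shows "f = g"
proof -
  obtain f' g' where f: "f' \<in> fns" "f = rep f'" and g: "g' \<in> fns" "g = rep g'"
    using assms by (auto simp: P_def)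
  have "eventually (\<lambda>i. f' i = g' i) U"
    using rep[OF f(1), THEN conjunct2] rep[OF g(1), THEN conjunct2] assms(3)[unfolded f g]
    by eventually_elim simp
  then show ?thesis unfolding f(2) g(2) by (rule rep_eqI[OF f(1) g(1)])
qed

lemma univ_P_fns: "f \<in> univ P \<Longrightarrow> f \<in> fns"
  using rep by (auto simp: P_def)

lemma rep_univ: "f \<in> fns \<Longrightarrow> rep f \<in> univ P"
  by (simp add: P_def)

lemma struc_P: "is_struc P"
  using M by (auto simp: is_struc_def P_def fns_def)

lemma Los: "asg P s \<Longrightarrow> sat P s \<phi> \<longleftrightarrow> eventually (\<lambda>i. sat M (\<lambda>v. s v i) \<phi>) U"
proof (induction \<phi> arbitrary: s)
  case (Eq m n)
  then have "s m \<in> univ P" "s n \<in> univ P" by auto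
  then show ?case using univ_P_eqI by auto
next
  case (Le m n)
  then have "s m \<in> univ P" "s n \<in> univ P" by auto
  then show ?case by (auto simp: P_def)
next
  case (Neg \<phi>)
  then show ?case by (simp add: ev_not)
next
  case (Conj \<phi> \<psi>)
  then show ?case by (simp add: eventually_conj_iff)
next
  case (Ex n \<phi>)
  have IH: "sat P (s(n := f)) \<phi> \<longleftrightarrow> eventually (\<lambda>i. sat M ((\<lambda>v. s v i)(n := f i)) \<phi>) U" if "f \<in> univ P" for f
  proof -
    have *: "(\<lambda>v. (s(n := f)) v i) = (\<lambda>v. s v i)(n := f i)" for i by auto
    show ?thesis using Ex.IH[OF asg_upd[OF Ex.prems that, of n]] unfolding * .
  qed
  show ?case
  proof
    assume "sat P s (Ex n \<phi>)"
    then obtain f where f: "f \<in> univ P" "sat P (s(n := f)) \<phi>" by auto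
    have fi: "f i \<in> univ M" for i using univ_P_fns[OF f(1)] by (auto simp: fns_def)
    show "eventually (\<lambda>i. sat M (\<lambda>v. s v i) (Ex n \<phi>)) U"
      using f IH[OF f(1)] fi by (auto elim!: eventually_mono)
  next
    assume ev: "eventually (\<lambda>i. sat M (\<lambda>v. s v i) (Ex n \<phi>)) U"
    obtain m where m: "m \<in> univ M" using M by (auto simp: is_struc_def)
    \<comment> \<open>A witness is chosen in each coordinate separately; \<open>m\<close> keeps
      \<open>f\<close> inside the structure at the negligible set of coordinates without
      one.\<close>
    define f where "f i = (if \<exists>a\<in>univ M. sat M ((\<lambda>v. s v i)(n := a)) \<phi>
       then SOME a. a \<in> univ M \<and> sat M ((\<lambda>v. s v i)(n := a)) \<phi> else m)" for i
    have *: "(\<exists>a\<in>univ M. sat M ((\<lambda>v. s v i)(n := a)) \<phi>) \<Longrightarrow> f i \<in> univ M \<and> sat M ((\<lambda>v. s v i)(n := f i)) \<phi>" for i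
      unfolding f_def by (simp, rule someI_ex, blast)
    then have "f i \<in> univ M" for i
      using m by (cases "\<exists>a\<in>univ M. sat M ((\<lambda>v. s v i)(n := a)) \<phi>") (auto simp: f_def)
    then have f: "f \<in> fns" by (auto simp: fns_def)
    have "eventually (\<lambda>i. sat M ((\<lambda>v. s v i)(n := f i)) \<phi>) U" 
      using ev * by (auto elim!: eventually_mono)
    then have "eventually (\<lambda>i. sat M ((\<lambda>v. s v i)(n := rep f i)) \<phi>) U"
      using rep[OF f] by (auto elim: eventually_elim2)
    then show "sat P s (Ex n \<phi>)" using IH[OF rep_univ[OF f]] rep_univ[OF f] by auto
  qed
qed

text \<open>There are only countably many formulas, so a diagonal argument works: each coordinate
  satisfies as long an initial part of the enumeration as it can.\<close>

lemma saturation: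
  assumes s: "asg P s"
    and fin: "\<And>G. finite G \<Longrightarrow> G \<subseteq> \<Gamma> \<Longrightarrow> satisfiable P n s G"
  shows "satisfiable P n s \<Gamma>"
proof -
  define G where "G k = {\<phi> \<in> \<Gamma>. to_nat \<phi> < k}" for k
  have Gf: "finite (G k)" for k
  proof (rule finite_subset)
    show "G k \<subseteq> from_nat ` {..<k}" by (force simp: G_def)
  qed simp
  have G0: "G 0 = {}" by (simp add: G_def)
  define W where "W k i w \<longleftrightarrow> asg M w \<and> (\<forall>v<n. w v = s v i) \<and> (\<forall>\<phi>\<in>G k. sat M w \<phi>)" for k i w
  have sM: "s v i \<in> univ M" for v i using s univ_P_fns[of "s v"] by (auto simp: fns_def)
  have W0: "W 0 i (\<lambda>v. s v i)" for i using sM by (auto simp: W_def G0)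
  \<comment> \<open>The bound \<open>k \<le> i\<close> makes the maximum exist, and
    \<open>k = 0\<close> always qualifies because \<open>G 0\<close> is empty. For fixed
    \<open>k\<close>, Los's theorem makes \<open>G k\<close> solvable on a set in the ultrafilter
    and \<open>U \<le> sequentially\<close> makes \<open>k \<le> i\<close> hold there too, so
    \<open>m i\<close> eventually reaches \<open>k\<close>.\<close>
  define m where "m i = (GREATEST k. k \<le> i \<and> (\<exists>w. W k i w))" for i
  have m: "\<exists>w. W (m i) i w" for i
    using GreatestI_nat[of "\<lambda>k. k \<le> i \<and> (\<exists>w. W k i w)" 0 i] W0 by (auto simp: m_def)
  have mge: "k \<le> m i" if "k \<le> i" "\<exists>w. W k i w" for k i
    unfolding m_def by (rule Greatest_le_nat[of _ k i]) (use that in auto)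
  obtain w where w: "\<And>i. W (m i) i (w i)" using m by metis
  define t where "t v = (if v < n then s v else rep (\<lambda>i. w i v))" for v
  have fw: "(\<lambda>i. w i v) \<in> fns" for v using w by (force simp: fns_def W_def)
  have tP: "asg P t" using s rep_univ[OF fw] by (auto simp: t_def)
  have tw: "eventually (\<lambda>i. t v i = w i v) U" for v
    using rep[OF fw, of v] w by (auto simp: t_def W_def)
  have "sat P t \<phi>" if p: "\<phi> \<in> \<Gamma>" for \<phi>
  proof -
    define k where "k = Suc (to_nat \<phi>)"
    have pk: "\<phi> \<in> G k" using p by (simp add: G_def k_def)
    obtain u where u: "asg P u" "\<forall>i<n. u i = s i" "\<forall>\<phi>\<in>G k. sat P u \<phi>"
      using fin[OF Gf, of k] by (auto simp: G_def)
    have "eventually (\<lambda>i. \<forall>\<phi>\<in>G k. sat M (\<lambda>v. u v i) \<phi>) U"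
      using u Los[OF u(1)] by (auto simp: eventually_ball_finite_distrib[OF Gf])
    moreover have "asg M (\<lambda>v. u v i)" for i
      using u(1) univ_P_fns by (fastforce simp: fns_def)
    ultimately have "eventually (\<lambda>i. W k i (\<lambda>v. u v i)) U"
      using u(2) by (simp add: W_def)
    then have "eventually (\<lambda>i. \<exists>w. W k i w) U"
      by (rule eventually_mono) blast
    moreover have "eventually (\<lambda>i. k \<le> i) U"
      using U(3) eventually_ge_at_top filter_leD by blast
    ultimately have "eventually (\<lambda>i. k \<le> m i) U"
      by eventually_elim (rule mge)
    then have a: "eventually (\<lambda>i. sat M (w i) \<phi>) U"
    proof (rule eventually_mono)
      fix i assume "k \<le> m i"
      then have "\<phi> \<in> G (m i)" using pk by (auto simp: G_def)
      then show "sat M (w i) \<phi>" using w[of i] by (simp add: W_def)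
    qed
    have "eventually (\<lambda>i. \<forall>v\<in>fv \<phi>. t v i = w i v) U"
      by (rule eventually_ball_finite) (auto simp: tw)
    with a have "eventually (\<lambda>i. sat M (\<lambda>v. t v i) \<phi>) U"
    proof (rule eventually_elim2)
      fix i assume "sat M (w i) \<phi>" "\<forall>v\<in>fv \<phi>. t v i = w i v"
      then show "sat M (\<lambda>v. t v i) \<phi>" by (subst sat_cong[where t="w i"]) auto
    qed
    then show ?thesis using Los[OF tP] by simp
  qed
  moreover have "\<forall>i<n. t i = s i" by (simp add: t_def)
  ultimately show ?thesis using tP by blast
qed

lemma diag_sat:
  assumes "asg M s"
  shows "asg P (\<lambda>v. rep (\<lambda>_. s v))" "sat P (\<lambda>v. rep (\<lambda>_. s v)) \<phi> = sat M s \<phi>"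
proof -
  have c: "(\<lambda>_. s v) \<in> fns" for v using assms by (auto simp: fns_def)
  show a: "asg P (\<lambda>v. rep (\<lambda>_. s v))" using rep_univ[OF c] by auto
  have "eventually (\<lambda>i. \<forall>v\<in>fv \<phi>. rep (\<lambda>_. s v) i = s v) U"
    by (rule eventually_ball_finite) (use rep[OF c] in auto)
  then have "eventually (\<lambda>i. sat M (\<lambda>v. rep (\<lambda>_. s v) i) \<phi> = sat M s \<phi>) U"
    by (rule eventually_mono) (rule sat_cong, blast)
  then have "eventually (\<lambda>i. sat M (\<lambda>v. rep (\<lambda>_. s v) i) \<phi>) U \<longleftrightarrow> eventually (\<lambda>i. sat M s \<phi>) U"
    by (auto elim: eventually_elim2)
  then show "sat P (\<lambda>v. rep (\<lambda>_. s v)) \<phi> = sat M s \<phi>" using Los[OF a] U(1) by (simp add: trivial_limit_def)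
qed

end

text \<open>Several variables are realized at once. The bound \<open>k\<close> on them lets a
  countable submodel inherit the property by realizing complete types in finitely many
  variables.\<close>

definition saturated :: "'a struc \<Rightarrow> bool" where
  "saturated M \<longleftrightarrow> (\<forall>s n k \<Gamma>. asg M s \<longrightarrow> (\<forall>\<phi>\<in>\<Gamma>. fv \<phi> \<subseteq> {..<k}) \<longrightarrow>
     (\<forall>G. finite G \<and> G \<subseteq> \<Gamma> \<longrightarrow> (satisfiable M n s G)) \<longrightarrow>
     (satisfiable M n s \<Gamma>))"

lemma saturatedD:
  assumes "saturated M" "asg M s" "\<And>\<phi>. \<phi> \<in> \<Gamma> \<Longrightarrow> fv \<phi> \<subseteq> {..<k}"
    "\<And>G. finite G \<Longrightarrow> G \<subseteq> \<Gamma> \<Longrightarrow> satisfiable M n s G"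
  shows "satisfiable M n s \<Gamma>"
  using assms(1)[unfolded saturated_def, rule_format, of s \<Gamma> k n] assms(2-) by blast

lemma ex_saturated_extension:
  fixes M :: "'a struc"
  assumes "is_struc M"
  obtains N :: "(nat \<Rightarrow> 'a) struc" and e where "is_struc N" "saturated N"
    "\<And>s. asg M s \<Longrightarrow> asg N (e \<circ> s)" "\<And>s n. asg M s \<Longrightarrow> tp n N (e \<circ> s) = tp n M s"
proof -
  obtain U :: "nat filter" where U: "U \<le> sequentially" "U \<noteq> bot"
    "\<forall>P. eventually P U \<or> eventually (\<lambda>x. \<not> P x) U"
    using ex_ultrafilter[OF sequentially_bot] by blast
  interpret ultra U M by (rule ultra.intro[OF U(2) spec[OF U(3)] U(1) assms])
  have "saturated P" unfolding saturated_def by (intro allI impI, rule saturation) blast+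
  then show thesis
    using that[of P "\<lambda>a. rep (\<lambda>_. a)"] struc_P diag_sat by (simp add: comp_def tp_def)
qed

lemma saturated_iso:
  assumes f: "iso_map f M N" and M: "saturated M"
  shows "saturated N"
  unfolding saturated_def
proof (intro allI impI)
  fix s n k \<Gamma>
  assume s: "asg N s" and G: "\<forall>\<phi>\<in>\<Gamma>. fv \<phi> \<subseteq> {..<k::nat}"
    and fin: "\<forall>G. finite G \<and> G \<subseteq> \<Gamma> \<longrightarrow> (satisfiable N (n::nat) s G)"
  obtain s' where s': "asg M s'" "s = f \<circ> s'" using iso_map_asg_lift[OF f s] by blast
  have "satisfiable M n s' \<Gamma>"
  proof (rule saturatedD[where k=k, OF M s'(1)])
    fix G assume G: "finite G" "G \<subseteq> \<Gamma>"
    from fin[THEN spec, of G] G obtain t where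
      t: "asg N t" "\<forall>i<n. t i = s i" "\<forall>\<phi>\<in>G. sat N t \<phi>" by (elim impE exE conjE) auto
    obtain t' where t': "asg M t'" "t = f \<circ> t'" using iso_map_asg_lift[OF f t(1)] by blast
    have "\<forall>i<n. t' i = s' i"
      using t(2) t' s' f by (auto simp: iso_map_def bij_betw_def inj_on_def range_subsetD)
    moreover have "\<forall>\<phi>\<in>G. sat M t' \<phi>" using t(3) t'(2) sat_iso[OF f t'(1)] by simp
    ultimately show "satisfiable M n s' G"
      using t'(1) by (intro exI[of _ t']) simp
  qed (use G in simp)
  then obtain t where "asg M t" "\<forall>i<n. t i = s' i" "\<forall>\<phi>\<in>\<Gamma>. sat M t \<phi>" by blast
  then show "satisfiable N n s \<Gamma>"
    using sat_iso[OF f] iso_map_asg[OF f] s' by (intro exI[of _ "f \<circ> t"]) simp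
qed

definition small :: "fm set \<Rightarrow> bool" where
  "small T \<longleftrightarrow> (\<forall>n. countable (types n T))"

text \<open>Smallness leaves countably many pairs of a number \<open>k\<close> and a
  \<open>k\<close>-type. A countable set can thus be closed under realizing, over each of its
  tuples, every type that the ultrapower realizes over it.\<close>

lemma ex_countable_saturated:
  fixes M :: "'a struc"
  assumes M: "is_struc M" and sm: "small (Th M)"
  obtains S :: "nat struc" where "is_struc S" "Th S = Th M" "saturated S"
proof -
  obtain N :: "(nat \<Rightarrow> 'a) struc" and e where N: "is_struc N" "saturated N"
    "\<And>s. asg M s \<Longrightarrow> asg N (e \<circ> s)" "\<And>s n. asg M s \<Longrightarrow> tp n N (e \<circ> s) = tp n M s"
    using ex_saturated_extension[OF M] by blast
  obtain s0 where s0: "asg M s0" using ex_asg M by blast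
  have NM: "Th N = Th M" using tp_Th[OF N(3)[OF s0] s0 N(4)[OF s0, of 0]] .
  define Q where "Q xs k p t \<longleftrightarrow> asg N t \<and> (\<forall>i<length xs. t i = xs ! i) \<and> tp k N t = p" for xs k p t
  define h where "h xs = (\<lambda>(k, p). if \<exists>t. Q xs k p t then (SOME t. Q xs k p t) ` {..<k} else {})" for xs
  have hQ: "h xs (k, p) = t ` {..<k}" if "Q xs k p t" "t = (SOME t. Q xs k p t)" for xs k p t
    using that by (auto simp: h_def)
  have 1: "countable (range (e \<circ> s0))" "range (e \<circ> s0) \<subseteq> univ N" using N(3)[OF s0] by auto
  have 2: "countable (SIGMA k:UNIV. types k (Th M))"
    using sm by (auto simp: small_def)
  have 3: "countable (h xs j)" for xs j by (cases j) (simp add: h_def)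
  have 4: "h xs j \<subseteq> univ N" for xs j
  proof (cases j)
    case (Pair k p)
    have "asg N (SOME t. Q xs k p t)" if "\<exists>t. Q xs k p t"
      using someI_ex[OF that] by (simp add: Q_def)
    then show ?thesis by (auto simp: h_def Pair)
  qed
  obtain D where D: "countable D" "range (e \<circ> s0) \<subseteq> D" "D \<subseteq> univ N"
    and cl: "\<And>xs j. set xs \<subseteq> D \<Longrightarrow> j \<in> (SIGMA k:UNIV. types k (Th M)) \<Longrightarrow> h xs j \<subseteq> D"
    using countable_closure[where h=h, OF 1 2 3 4] by metis
  \<comment> \<open>The single closure property from which both the Tarski-Vaught criterion and
    saturation follow. Beyond \<open>k\<close> the assignment is continued by \<open>s\<close>,
    since only the first \<open>k\<close> values of the chosen realization are known to lie in
    \<open>D\<close>.\<close>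
  have real: "\<exists>t'. range t' \<subseteq> D \<and> (\<forall>i<n. t' i = s i) \<and> tp k N t' = tp k N t"
    if s: "range s \<subseteq> D" and t: "asg N t" "\<forall>i<n. t i = s i" and nk: "n \<le> k" for s t n k
  proof -
    let ?xs = "map s [0..<n]" and ?p = "tp k N t"
    have Q: "Q ?xs k ?p t" using t by (auto simp: Q_def)
    define u where "u = (SOME t. Q ?xs k ?p t)"
    have u: "Q ?xs k ?p u" using someI[of "Q ?xs k ?p", OF Q] by (simp add: u_def)
    have "h ?xs (k, ?p) \<subseteq> D"
      by (rule cl) (use s tp_in_types[OF N(1) t(1)] NM in auto)
    then have uD: "u ` {..<k} \<subseteq> D" using hQ[OF u u_def] by simp
    let ?v = "\<lambda>i. if i < k then u i else s i"
    have "range ?v \<subseteq> D" using uD s by auto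
    moreover have "\<forall>i<n. ?v i = s i" using u nk by (auto simp: Q_def)
    moreover have "tp k N ?v = tp k N t" using u tp_cong[of k ?v u N] by (simp add: Q_def)
    ultimately show ?thesis by blast
  qed
  have el: "elem_sub N D"
  proof (rule Tarski_Vaught)
    fix s n \<phi> a
    assume s: "range s \<subseteq> D" and f: "fv \<phi> \<subseteq> {..n}" and a: "a \<in> univ N" "sat N (s(n := a)) \<phi>"
    obtain t' where t': "range t' \<subseteq> D" "\<forall>i<n. t' i = s i" "tp (Suc n) N t' = tp (Suc n) N (s(n := a))"
      using real[OF s, of "s(n := a)" n "Suc n"] s a D by force
    have "sat N t' \<phi>" using tp_eq_sat[OF t'(3), of \<phi>] f a by (auto simp: lessThan_Suc_atMost)
    then have "sat N (s(n := t' n)) \<phi>"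
      using t'(2) f by (subst sat_cong[where t=t']) (auto simp: le_less)
    then show "\<exists>b\<in>D. sat N (s(n := b)) \<phi>" using t'(1) by blast
  qed (use D in auto)
  have "saturated (substruc N D)"
    unfolding saturated_def
  proof (intro allI impI)
    fix s n k \<Gamma>
    assume s: "asg (substruc N D) s" and G: "\<forall>\<phi>\<in>\<Gamma>. fv \<phi> \<subseteq> {..<k::nat}"
      and fin: "\<forall>G. finite G \<and> G \<subseteq> \<Gamma> \<longrightarrow> (satisfiable (substruc N D) (n::nat) s G)"
    have sN: "asg N s" using s D by auto
    have eq: "sat (substruc N D) t \<phi> = sat N t \<phi>" if "range t \<subseteq> D" for t \<phi>
      using el that by (auto simp: elem_sub_def)
    have "satisfiable N n s \<Gamma>"
    proof (rule saturatedD[where k=k, OF N(2) sN])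
      fix G assume G: "finite G" "G \<subseteq> \<Gamma>"
      from fin[THEN spec, of G] G obtain t where
        "asg (substruc N D) t" "\<forall>i<n. t i = s i" "\<forall>\<phi>\<in>G. sat (substruc N D) t \<phi>" by (elim impE exE conjE) auto
      then show "satisfiable N n s G"
        using D eq by (intro exI[of _ t]) auto
    qed (use G in simp)
    then obtain t where t: "asg N t" "\<forall>i<n. t i = s i" "\<forall>\<phi>\<in>\<Gamma>. sat N t \<phi>" by blast
    obtain t' where t': "range t' \<subseteq> D" "\<forall>i<n. t' i = s i" "tp (max n k) N t' = tp (max n k) N t"
      using real[of s t n "max n k"] s t by auto
    have "sat N t' \<phi>" if "\<phi> \<in> \<Gamma>" for \<phi>
    proof -
      have "fv \<phi> \<subseteq> {..<max n k}" using G that by fastforce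
      then show ?thesis using tp_eq_sat[OF t'(3)] t(3) that by blast
    qed
    then show "satisfiable (substruc N D) n s \<Gamma>"
      using t' eq by (intro exI[of _ t']) simp
  qed
  moreover obtain f and S :: "nat struc" where "is_struc S" "iso_map f (substruc N D) S"
    using countable_nat_copy[OF elem_sub_struc[OF el]] D(1) univ_substruc by metis
  ultimately show thesis
    using that[of S] saturated_iso Th_iso[OF elem_sub_struc[OF el]] elem_sub_Th[OF el] NM by metis
qed

subsection \<open>Atomic models\<close>

lemma uncountable_nat_bool: "uncountable (UNIV :: (nat \<Rightarrow> bool) set)"
proof
  assume "countable (UNIV :: (nat \<Rightarrow> bool) set)"
  then have r: "range (from_nat_into (UNIV :: (nat \<Rightarrow> bool) set)) = UNIV"
    by (rule range_from_nat_into[rotated]) simp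
  obtain n where "from_nat_into UNIV n = (\<lambda>m. \<not> from_nat_into (UNIV :: (nat \<Rightarrow> bool) set) m m)"
    using r by (metis UNIV_I imageE)
  then have "from_nat_into (UNIV :: (nat \<Rightarrow> bool) set) n n = (\<not> from_nat_into (UNIV :: (nat \<Rightarrow> bool) set) n n)"
    by (rule fun_cong)
  then show False by simp
qed

lemma iso_map_eq_iff:
  "iso_map f M N \<Longrightarrow> asg M s \<Longrightarrow> asg M t \<Longrightarrow> f (s i) = f (t i) \<longleftrightarrow> s i = t i"
  unfolding iso_map_def bij_betw_def by (auto simp: inj_on_eq_iff range_subsetD)

text \<open>A binary tree of \<open>B\<close>-formulas in which siblings contradict each other. The
  formulas along a branch imply all earlier ones, so each branch is finitely satisfiable and hence
  realized in a saturated extension. \<open>B\<close> is kept abstract because it serves twice: for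
  formulas without isolated realizations, and for formulas in uncountably many types.\<close>

lemma splitting_many_types:
  fixes M :: "'a struc"
  assumes M: "is_struc M" and s: "asg M s"
    and B: "\<And>\<phi>. B \<phi> \<Longrightarrow> fv \<phi> \<subseteq> {..<k} \<and> (\<exists>t. asg M t \<and> (\<forall>i<n. t i = s i) \<and> sat M t \<phi>)"
    and split: "\<And>\<phi>. B \<phi> \<Longrightarrow> \<exists>\<psi>. B (Conj \<phi> \<psi>) \<and> B (Conj \<phi> (Neg \<psi>))"
    and B0: "B \<phi>0"
  obtains g :: "(nat \<Rightarrow> bool) \<Rightarrow> fm set" where "inj g" "range g \<subseteq> types k (Th M)"
proof -
  obtain sp where sp: "\<And>\<phi>. B \<phi> \<Longrightarrow> B (Conj \<phi> (sp \<phi>)) \<and> B (Conj \<phi> (Neg (sp \<phi>)))"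
    using split by metis
  \<comment> \<open>Nodes are bit lists with the latest choice at the head, so a branch runs through
    the reversed initial segments \<open>p \<beta> m\<close>.\<close>
  define F where "F = rec_list \<phi>0 (\<lambda>b _ \<phi>. Conj \<phi> (if b then sp \<phi> else Neg (sp \<phi>)))"
  have F0: "F [] = \<phi>0" and FS: "F (b # bs) = Conj (F bs) (if b then sp (F bs) else Neg (sp (F bs)))" for b bs
    by (simp_all add: F_def)
  have BF: "B (F bs)" for bs
    by (induction bs) (use B0 sp in \<open>auto simp: F0 FS\<close>)
  define p where "p \<beta> m = rev (map \<beta> [0..<m])" for \<beta> :: "nat \<Rightarrow> bool" and m
  have pS: "p \<beta> (Suc m) = \<beta> m # p \<beta> m" for \<beta> m by (simp add: p_def)
  have dec: "m \<le> m' \<Longrightarrow> sat K t (F (p \<beta> m')) \<Longrightarrow> sat K t (F (p \<beta> m))"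
    for m m' \<beta> t and K :: "'b struc"
    by (induction m' rule: dec_induct) (auto simp: pS FS)
  obtain N :: "(nat \<Rightarrow> 'a) struc" and e where N: "is_struc N" "saturated N"
    "\<And>s. asg M s \<Longrightarrow> asg N (e \<circ> s)" "\<And>s n. asg M s \<Longrightarrow> tp n N (e \<circ> s) = tp n M s"
    using ex_saturated_extension[OF M] by blast
  have NM: "Th N = Th M" using tp_Th[OF N(3)[OF s] s N(4)[OF s, of 0]] .
  have "satisfiable N n (e \<circ> s) (range (\<lambda>m. F (p \<beta> m)))" for \<beta>
  proof (rule saturatedD[where k=k, OF N(2) N(3)[OF s]])
    fix G assume "finite G" "G \<subseteq> range (\<lambda>m. F (p \<beta> m))"
    then obtain A where A: "finite A" "G = (\<lambda>m. F (p \<beta> m)) ` A"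
      using finite_subset_image[of G "\<lambda>m. F (p \<beta> m)" UNIV] by auto
    obtain m where m: "A \<subseteq> {..<m}" using A(1) finite_nat_set_iff_bounded[of A] by auto
    obtain t where t: "asg M t" "\<forall>i<n. t i = s i" "sat M t (F (p \<beta> m))" using B[OF BF] by blast
    have "satisfiable N n (e \<circ> s) {F (p \<beta> m)}"
      by (rule tp_transfer[OF N(4)[OF s, symmetric] s N(3)[OF s] t(1,2)]) (use t(3) in auto)
    then obtain t' where t': "asg N t'" "\<forall>i<n. t' i = (e \<circ> s) i" "sat N t' (F (p \<beta> m))" by auto
    have "\<forall>\<phi>\<in>G. sat N t' \<phi>"
    proof
      fix \<phi> assume "\<phi> \<in> G"
      then obtain j where "j < m" "\<phi> = F (p \<beta> j)" using A m by auto
      then show "sat N t' \<phi>" using dec[OF _ t'(3), of j] by simp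
    qed
    then show "satisfiable N n (e \<circ> s) G"
      using t' by (intro exI[of _ t']) simp
  qed (use B[OF BF] in auto)
  then obtain t where t: "\<And>\<beta>. asg N (t \<beta>)" "\<And>\<beta> m. sat N (t \<beta>) (F (p \<beta> m))" 
    by (metis rangeI)
  define g where "g \<beta> = tp k N (t \<beta>)" for \<beta>
  have "range g \<subseteq> types k (Th M)" using tp_in_types[OF N(1) t(1)] NM by (auto simp: g_def)
  moreover have "inj g"
  proof
    fix \<beta> \<gamma> assume eq: "g \<beta> = g \<gamma>"
    show "\<beta> = \<gamma>"
    proof (rule ccontr)
      assume "\<beta> \<noteq> \<gamma>"
      then have ex: "\<exists>m. \<beta> m \<noteq> \<gamma> m" by auto
      define m where "m = (LEAST m. \<beta> m \<noteq> \<gamma> m)"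
      have m: "\<beta> m \<noteq> \<gamma> m" using LeastI_ex[OF ex] by (simp add: m_def)
      have "\<beta> i = \<gamma> i" if "i < m" for i using not_less_Least that unfolding m_def by blast
      then have pm: "p \<beta> m = p \<gamma> m" by (simp add: p_def)
      let ?S = "sp (F (p \<beta> m))"
      have "fv ?S \<subseteq> {..<k}" using B[OF conjunct1[OF sp[OF BF]]] by simp
      then have "sat N (t \<beta>) ?S = sat N (t \<gamma>) ?S" using eq tp_eq_sat unfolding g_def by blast
      then show False using t(2)[of \<beta> "Suc m"] t(2)[of \<gamma> "Suc m"] m pm by (auto simp: pS FS split: if_splits)
    qed
  qed
  ultimately show thesis using that by blast
qed

text \<open>Isolation is relative to the first \<open>n\<close> coordinates as parameters.\<close>

definition isolated :: "'a struc \<Rightarrow> nat \<Rightarrow> nat \<Rightarrow> (nat \<Rightarrow> 'a) \<Rightarrow> bool" where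
  "isolated M n k t \<longleftrightarrow> (\<exists>\<theta>. fv \<theta> \<subseteq> {..<k} \<and> sat M t \<theta> \<and>
     (\<forall>t'. asg M t' \<and> (\<forall>i<n. t' i = t i) \<and> sat M t' \<theta> \<longrightarrow> tp k M t' = tp k M t))"

lemma isolatedI:
  assumes "fv \<theta> \<subseteq> {..<k}" "sat M t \<theta>"
    "\<And>t'. asg M t' \<Longrightarrow> (\<forall>i<n. t' i = t i) \<Longrightarrow> sat M t' \<theta> \<Longrightarrow> tp k M t' = tp k M t"
  shows "isolated M n k t"
  using assms unfolding isolated_def by blast

text \<open>Otherwise every satisfiable formula all of whose realizations are non-isolated splits
  into two of the same kind, and the tree yields uncountably many types, against smallness.\<close>

lemma isolated_dense:
  assumes M: "is_struc M" and sm: "small (Th M)" and s: "asg M s"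
    and t: "asg M t" "\<forall>i<n. t i = s i" "sat M t \<phi>" and fv: "fv \<phi> \<subseteq> {..<k}"
  shows "\<exists>t. asg M t \<and> (\<forall>i<n. t i = s i) \<and> sat M t \<phi> \<and> isolated M n k t"
proof (rule ccontr)
  assume no: "\<not> ?thesis"
  define A where "A \<phi> t \<longleftrightarrow> asg M t \<and> (\<forall>i<n. t i = s i) \<and> sat M t \<phi>" for \<phi> t
  define B where "B \<phi> \<longleftrightarrow> fv \<phi> \<subseteq> {..<k} \<and> (\<exists>t. A \<phi> t) \<and> (\<forall>t. A \<phi> t \<longrightarrow> \<not> isolated M n k t)" for \<phi>
  have B0: "B \<phi>" using fv t no unfolding A_def B_def by blast
  have B1: "B \<phi> \<Longrightarrow> fv \<phi> \<subseteq> {..<k} \<and> (\<exists>t. asg M t \<and> (\<forall>i<n. t i = s i) \<and> sat M t \<phi>)" for \<phi>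
    by (simp add: B_def A_def)
  have B2: "\<exists>\<psi>. B (Conj \<phi> \<psi>) \<and> B (Conj \<phi> (Neg \<psi>))" if \<phi>: "B \<phi>" for \<phi>
  proof -
    obtain t where t: "A \<phi> t" "\<not> isolated M n k t" using \<phi> by (auto simp: B_def)
    have "\<exists>t'. asg M t' \<and> (\<forall>i<n. t' i = t i) \<and> sat M t' \<phi> \<and> tp k M t' \<noteq> tp k M t"
    proof (rule ccontr)
      assume c: "\<not> ?thesis"
      have "isolated M n k t"
      proof (rule isolatedI)
        show "fv \<phi> \<subseteq> {..<k}" "sat M t \<phi>" using \<phi> t(1) by (simp_all add: B_def A_def)
      qed (use c in blast)
      with t(2) show False by simp
    qed
    then obtain t' where t': "asg M t'" "\<forall>i<n. t' i = t i" "sat M t' \<phi>" "tp k M t' \<noteq> tp k M t"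
      by (elim exE conjE)
    have At': "A \<phi> t'" using t t' by (simp add: A_def)
    obtain \<psi> where \<psi>: "fv \<psi> \<subseteq> {..<k}" "sat M t' \<psi> \<noteq> sat M t \<psi>" using t'(4) tp_eq_iff by blast
    \<comment> \<open>Exactly one of \<open>t\<close> and \<open>t'\<close> satisfies
      \<open>\<psi>\<close>; whichever it is, together they realize both halves.\<close>
    have "\<exists>t. A (Conj \<phi> \<psi>) t" "\<exists>t. A (Conj \<phi> (Neg \<psi>)) t"
      using t(1) At' \<psi>(2) unfolding A_def sat.simps by blast+
    moreover have "A (Conj \<phi> \<psi>) t \<Longrightarrow> A \<phi> t" for \<psi> t by (simp add: A_def)
    ultimately have "B (Conj \<phi> \<psi>)" "B (Conj \<phi> (Neg \<psi>))" using \<phi> \<psi>(1) by (auto simp: B_def)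
    then show ?thesis by blast
  qed
  obtain g :: "(nat \<Rightarrow> bool) \<Rightarrow> fm set" where g: "inj g" "range g \<subseteq> types k (Th M)"
    using splitting_many_types[of M s B k n \<phi>, OF M s B1 B2 B0] by blast
  have "countable (range g)" using g(2) sm countable_subset by (auto simp: small_def)
  then have "countable (UNIV :: (nat \<Rightarrow> bool) set)" using g(1) by (rule countable_image_inj_on)
  then show False using uncountable_nat_bool by blast
qed

text \<open>Density gives an isolated tuple \<open>u\<close> satisfying \<open>\<phi>\<close>, but
  its first \<open>k\<close> coordinates need not be those of \<open>t\<close>. Conjoining the
  formula that isolates \<open>t\<close> forces them to have the same type, and the existence of a
  suitable last coordinate moves from \<open>u\<close> to \<open>t\<close>.\<close>

lemma isolated_extend:
  assumes M: "is_struc M" and sm: "small (Th M)" and t: "asg M t" "isolated M n k t" and nk: "n \<le> k"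
    and fv: "fv \<phi> \<subseteq> {..k}" and a: "a \<in> univ M" "sat M (t(k := a)) \<phi>"
  shows "\<exists>b\<in>univ M. sat M (t(k := b)) \<phi> \<and> isolated M n (Suc k) (t(k := b))"
proof -
  obtain \<theta> where \<theta>: "fv \<theta> \<subseteq> {..<k}" "sat M t \<theta>"
    and \<theta>i: "\<And>t'. asg M t' \<Longrightarrow> (\<forall>i<n. t' i = t i) \<Longrightarrow> sat M t' \<theta> \<Longrightarrow> tp k M t' = tp k M t"
    using t(2) unfolding isolated_def by blast
  have ta: "asg M (t(k := a))" using t a by auto
  have "sat M (t(k := a)) \<theta>" using \<theta> by (subst sat_cong[where t=t]) auto
  then have "sat M (t(k := a)) (Conj \<theta> \<phi>)" using a by simp
  moreover have "fv (Conj \<theta> \<phi>) \<subseteq> {..<Suc k}" using \<theta> fv by (auto simp: less_Suc_eq_le)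
  moreover have "\<forall>i<n. (t(k := a)) i = t i" using nk by auto
  ultimately obtain u where u: "asg M u" "\<forall>i<n. u i = t i" "sat M u (Conj \<theta> \<phi>)" "isolated M n (Suc k) u"
    using isolated_dense[OF M sm t(1) ta] by blast
  have tu: "tp k M u = tp k M t" using \<theta>i u by simp
  obtain \<psi> where \<psi>: "fv \<psi> \<subseteq> {..<Suc k}" "sat M u \<psi>"
    and \<psi>i: "\<And>t'. asg M t' \<Longrightarrow> (\<forall>i<n. t' i = u i) \<Longrightarrow> sat M t' \<psi> \<Longrightarrow> tp (Suc k) M t' = tp (Suc k) M u"
    using u(4) unfolding isolated_def by blast
  have "u(k := u k) = u" by simp
  then have "sat M u (Ex k (Conj \<psi> \<phi>))" using u \<psi>
    by (auto simp del: fun_upd_triv intro!: bexI[of _ "u k"])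
  moreover have "fv (Ex k (Conj \<psi> \<phi>)) \<subseteq> {..<k}" using \<psi> fv by (auto simp: less_Suc_eq_le)
  ultimately have "sat M t (Ex k (Conj \<psi> \<phi>))" using tp_eq_sat[OF tu] by blast
  then obtain b where b: "b \<in> univ M" "sat M (t(k := b)) \<psi>" "sat M (t(k := b)) \<phi>" by auto
  have tb: "asg M (t(k := b))" "\<forall>i<n. (t(k := b)) i = u i" using t b u nk by auto
  have eq: "tp (Suc k) M (t(k := b)) = tp (Suc k) M u" using \<psi>i[OF tb b(2)] .
  have "isolated M n (Suc k) (t(k := b))"
  proof (rule isolatedI[OF \<psi>(1) b(2)])
    fix t' assume "asg M t'" "\<forall>i<n. t' i = (t(k := b)) i" "sat M t' \<psi>"
    then show "tp (Suc k) M t' = tp (Suc k) M (t(k := b))" using \<psi>i[of t'] tb(2) eq by simp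
  qed
  with b show ?thesis by blast
qed

definition atomic_over :: "'a struc \<Rightarrow> nat \<Rightarrow> (nat \<Rightarrow> 'a) \<Rightarrow> bool" where
  "atomic_over M n s \<longleftrightarrow> (\<forall>k t. n \<le> k \<longrightarrow> asg M t \<longrightarrow> (\<forall>i<n. t i = s i) \<longrightarrow> isolated M n k t)"

text \<open>If \<open>\<theta>\<close> isolates the type of \<open>d\<close>, then the existence of \<open>y\<close> with \<open>\<theta>(y)\<close> and \<open>t i = y (g i)\<close> isolates
  that of \<open>t\<close>.\<close>

lemma isolated_reindex:
  assumes d: "asg M d" "isolated M n m d" and t: "asg M t" "\<And>i. i < n \<Longrightarrow> t i = d i"
    and g: "\<And>i. i < k \<Longrightarrow> t i = d (g i) \<and> g i < m" and nm: "n \<le> m" "n \<le> k"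
  shows "isolated M n k t"
proof -
  obtain \<theta> where \<theta>: "fv \<theta> \<subseteq> {..<m}" "sat M d \<theta>"
    and \<theta>i: "\<And>t'. asg M t' \<Longrightarrow> (\<forall>i<n. t' i = d i) \<Longrightarrow> sat M t' \<theta> \<Longrightarrow> tp m M t' = tp m M d"
    using d(2) unfolding isolated_def by blast
  \<comment> \<open>The copy of \<open>y\<close> occupies the variables from \<open>k\<close> on.
    The first equations fix its initial part to the parameters, which is the condition under which
    \<open>\<theta>\<close> isolates.\<close>
  let ?E = "(\<lambda>i. Eq i (k + i)) ` {..<n} \<union> (\<lambda>i. Eq i (k + g i)) ` {..<k}"
  let ?c = "Conj_set (insert (rename (\<lambda>i. k + i) \<theta>) ?E)"
  let ?\<Theta> = "Ex_list [k..<k + m] ?c"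
  have ne: "univ M \<noteq> {}" using d by auto
  have sc: "sat M w ?c \<longleftrightarrow> sat M (\<lambda>i. w (k + i)) \<theta> \<and> (\<forall>i<n. w i = w (k + i)) \<and> (\<forall>i<k. w i = w (k + g i))" for w
    by (simp add: sat_Conj_set ne sat_rename comp_def ball_Un) (simp add: Ball_def)
  have "fv (rename (\<lambda>i. k + i) \<theta>) \<subseteq> {..<k + m}" using fv_rename[of "\<lambda>i. k + i" \<theta>] \<theta>(1) by force
  then have "fv ?c \<subseteq> {..<k + m}" using nm g by (subst fv_Conj_set) auto
  then have f: "fv ?\<Theta> \<subseteq> {..<k}" by (auto simp: fv_Ex_list)
  let ?w = "\<lambda>i. if i < k then t i else if i < k + m then d (i - k) else t i"
  have "asg M ?w" using t d by auto
  moreover have "\<forall>i. i \<notin> set [k..<k + m] \<longrightarrow> ?w i = t i" by auto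
  moreover have "sat M ?w ?c" unfolding sc
  proof (intro conjI)
    have "sat M (\<lambda>i. ?w (k + i)) \<theta> = sat M d \<theta>" by (rule sat_cong) (use \<theta>(1) in auto)
    then show "sat M (\<lambda>i. ?w (k + i)) \<theta>" using \<theta> by simp
    show "\<forall>i<n. ?w i = ?w (k + i)" using nm t by auto
    show "\<forall>i<k. ?w i = ?w (k + g i)" using g by auto
  qed
  ultimately have st: "sat M t ?\<Theta>" using sat_Ex_list[OF t(1)] by blast
  have "tp k M t' = tp k M t" if t': "asg M t'" "\<forall>i<n. t' i = t i" "sat M t' ?\<Theta>" for t'
  proof -
    obtain w where w: "asg M w" "\<forall>i. i \<notin> set [k..<k + m] \<longrightarrow> w i = t' i" "sat M w ?c"
      using sat_Ex_list[OF t'(1)] t'(3) by blast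
    let ?y = "\<lambda>i. w (k + i)"
    have y: "asg M ?y" using w by auto
    have yd: "\<forall>i<n. ?y i = d i" using w(3) w(2) t' t(2) nm unfolding sc by auto
    have eq: "tp m M ?y = tp m M d" by (rule \<theta>i[OF y yd]) (use w(3) sc in blast)
    show ?thesis unfolding tp_eq_iff
    proof (intro allI impI)
      fix \<phi> assume p: "fv \<phi> \<subseteq> {..<k}"
      have "sat M t' \<phi> = sat M (?y \<circ> g) \<phi>" by (rule sat_cong) (use p w(2,3) sc in auto)
      also have "\<dots> = sat M ?y (rename g \<phi>)" by (simp add: sat_rename)
      also have "\<dots> = sat M d (rename g \<phi>)"
        by (rule tp_eq_sat[OF eq]) (use fv_rename[of g \<phi>] p g in force)
      also have "\<dots> = sat M (d \<circ> g) \<phi>" by (simp add: sat_rename)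
      also have "\<dots> = sat M t \<phi>" by (rule sat_cong) (use p g in auto)
      finally show "sat M t' \<phi> = sat M t \<phi>" .
    qed
  qed
  then show ?thesis unfolding isolated_def using f st by blast
qed

lemma isolated_elem_sub:
  assumes "elem_sub M D" "range t \<subseteq> D" "isolated M n k t"
  shows "isolated (substruc M D) n k t"
proof -
  obtain \<theta> where \<theta>: "fv \<theta> \<subseteq> {..<k}" "sat M t \<theta>"
    and \<theta>i: "\<And>t'. asg M t' \<Longrightarrow> (\<forall>i<n. t' i = t i) \<Longrightarrow> sat M t' \<theta> \<Longrightarrow> tp k M t' = tp k M t"
    using assms(3) unfolding isolated_def by blast
  have D: "D \<subseteq> univ M" and el: "\<And>s \<phi>. range s \<subseteq> D \<Longrightarrow> sat (substruc M D) s \<phi> = sat M s \<phi>"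
    using assms(1) by (auto simp: elem_sub_def)
  show ?thesis 
  proof (rule isolatedI[OF \<theta>(1)])
    show "sat (substruc M D) t \<theta>" using el assms(2) \<theta>(2) by simp
    fix t' assume t': "asg (substruc M D) t'" "\<forall>i<n. t' i = t i" "sat (substruc M D) t' \<theta>"
    then have t'D: "range t' \<subseteq> D" by simp
    have "tp k M t' = tp k M t" by (rule \<theta>i) (use t' t'D D el in auto)
    then show "tp k (substruc M D) t' = tp k (substruc M D) t"
      using elem_sub_tp[OF assms(1)] t'D assms(2) by simp
  qed
qed

text \<open>A Henkin construction inside \<open>M\<close>: elements are added one at a time, keeping
  the tuple isolated over the parameters, and every formula with a witness eventually receives one
  in the sequence. The range is then an elementary submodel in which each tuple is a reindexing of
  an initial segment.\<close>

lemma ex_atomic_over: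
  fixes M :: "'a struc"
  assumes M: "is_struc M" and sm: "small (Th M)" and s: "asg M s"
  obtains A :: "nat struc" and u where "is_struc A" "Th A = Th M" "asg A u" "tp n A u = tp n M s"
    "atomic_over A n u"
proof -
  \<comment> \<open>Discarding the first component of the pair makes every task occur at arbitrarily
    late stages.\<close>
  define task :: "nat \<Rightarrow> fm \<times> nat list" where "task k = from_nat (snd (prod_decode k))" for k
  \<comment> \<open>Variables below the length of the list point to earlier elements of the
    sequence, all others to the new element number \<open>k\<close>.\<close>
  define r where "r gs k i = (if i < length gs then gs ! i else k)" for gs :: "nat list" and k i :: nat
  define ch where "ch k = rename (r (snd (task k)) k) (fst (task k))" for k
  define Q where "Q k t t' \<longleftrightarrow> (\<forall>i. i \<noteq> n + k \<longrightarrow> t' i = t i) \<and>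
     (fv (ch (n + k)) \<subseteq> {..n + k} \<longrightarrow> (\<exists>a\<in>univ M. sat M (t(n + k := a)) (ch (n + k))) \<longrightarrow> sat M t' (ch (n + k)))"
    for k :: nat and t t' :: "nat \<Rightarrow> 'a"
  have "\<exists>T. \<forall>k. (asg M (T k) \<and> isolated M n (n + k) (T k) \<and> (\<forall>i<n. T k i = s i)) \<and> Q k (T k) (T (Suc k))"
  proof (rule dependent_nat_choice)
    \<comment> \<open>At the start the tuple consists of its own parameters, so any true formula
      isolates it.\<close>
    have "isolated M n n s" 
    proof (rule isolatedI[of "Ex 0 (Eq 0 0)"])
      fix t' assume "\<forall>i<n. t' i = s i"
      then show "tp n M t' = tp n M s" using tp_cong by blast
    qed (use s in auto)
    then show "\<exists>t. asg M t \<and> isolated M n (n + 0) t \<and> (\<forall>i<n. t i = s i)" using s by auto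
    fix t k assume t: "asg M t \<and> isolated M n (n + k) t \<and> (\<forall>i<n. t i = s i)"
    have ext: "\<exists>b\<in>univ M. sat M (t(n + k := b)) \<phi> \<and> isolated M n (Suc (n + k)) (t(n + k := b))"
      if "fv \<phi> \<subseteq> {..n + k}" "a \<in> univ M" "sat M (t(n + k := a)) \<phi>" for \<phi> a
      using isolated_extend[OF M sm _ _ _ that] t by simp
    have "\<exists>b\<in>univ M. isolated M n (Suc (n + k)) (t(n + k := b)) \<and> Q k t (t(n + k := b))"
    proof (cases "fv (ch (n + k)) \<subseteq> {..n + k} \<and> (\<exists>a\<in>univ M. sat M (t(n + k := a)) (ch (n + k)))")
      case True
      then obtain a where "fv (ch (n + k)) \<subseteq> {..n + k}" "a \<in> univ M" "sat M (t(n + k := a)) (ch (n + k))" by blast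
      from ext[OF this] show ?thesis by (auto simp: Q_def)
    next
      \<comment> \<open>Nothing is to be witnessed at this stage; a trivial formula still extends
        the tuple in an isolated way.\<close>
      case False
      obtain a where "a \<in> univ M" using s by auto
      then have "\<exists>b\<in>univ M. sat M (t(n + k := b)) (Ex 0 (Eq 0 0)) \<and> isolated M n (Suc (n + k)) (t(n + k := b))"
        by (intro ext[of _ a]) auto
      with False show ?thesis by (auto simp: Q_def)
    qed
    then obtain b where "b \<in> univ M" "isolated M n (Suc (n + k)) (t(n + k := b))" "Q k t (t(n + k := b))" by blast
    then show "\<exists>t'. (asg M t' \<and> isolated M n (n + Suc k) t' \<and> (\<forall>i<n. t' i = s i)) \<and> Q k t t'"
      using t by (intro exI[of _ "t(n + k := b)"]) auto
  qed
  then obtain T where T: "\<And>k. asg M (T k)" "\<And>k. isolated M n (n + k) (T k)" "\<And>k i. i < n \<Longrightarrow> T k i = s i"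
    "\<And>k. Q k (T k) (T (Suc k))" by blast
  define d where "d i = T (Suc i) i" for i
  have step: "T (Suc k) i = T k i" if "i \<noteq> n + k" for i k using T(4)[of k] that by (simp add: Q_def)
  have Td: "T k i = d i" if "i < n + k" for i k
  proof -
    have A: "T (k' + m) i = T k' i" if "i < n + k'" for k' m
      using that by (induction m) (auto simp: step)
    have "T k i = T (k + Suc i) i" using A[of k "Suc i"] that by simp
    also have "\<dots> = T (Suc i) i" using A[of "Suc i" k] by (simp add: add.commute)
    finally show ?thesis by (simp add: d_def)
  qed
  have d: "asg M d" using T(1) by (auto simp: d_def)
  have ds: "d i = s i" if "i < n" for i using T(3) that by (simp add: d_def)
  have diso: "isolated M n (n + k) d" for k
  proof -
    have "isolated M n (n + k) (T k)" by (rule T(2))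
    then show ?thesis
      by (rule isolated_reindex[OF T(1) _ d, where g=id]) (use Td in auto)
  qed
  have ran: "\<exists>g. (\<forall>i. t i = d (g i))" if "range t \<subseteq> range d" for t :: "nat \<Rightarrow> 'a"
  proof -
    have "\<forall>i. \<exists>j. t i = d j" using that by auto
    then show ?thesis by (rule choice)
  qed
  have el: "elem_sub M (range d)"
  proof (rule Tarski_Vaught)
    fix t m \<phi> a
    assume t: "range t \<subseteq> range d" and f: "fv \<phi> \<subseteq> {..m}" and a: "a \<in> univ M" "sat M (t(m := a)) \<phi>"
    obtain g where g: "\<And>i. t i = d (g i)" using ran[OF t] by blast
    let ?gs = "map g [0..<m]"
    define N where "N = n + Suc (Max (insert 0 (g ` {..<m})))"
    \<comment> \<open>The component \<open>N\<close> delays the task until all elements named by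
      \<open>g\<close> on the first \<open>m\<close> variables have been chosen.\<close>
    define k' where "k' = prod_encode (N, to_nat (\<phi>, ?gs))"
    have k'N: "N \<le> k'" unfolding k'_def by (rule le_prod_encode_1)
    then obtain k where k: "k' = n + k" using le_Suc_ex unfolding N_def by (metis add.assoc)
    have gk: "g i < n + k" if "i < m" for i
    proof -
      have "g i \<le> Max (insert 0 (g ` {..<m}))" using that by (intro Max_ge) auto
      then show ?thesis using k'N k by (simp add: N_def)
    qed
    have tk: "task (n + k) = (\<phi>, ?gs)" by (simp add: task_def k'_def flip: k)
    have ch: "ch (n + k) = rename (r ?gs (n + k)) \<phi>" by (simp add: ch_def tk)
    have "fv (ch (n + k)) \<subseteq> r ?gs (n + k) ` fv \<phi>" unfolding ch by (rule fv_rename)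
    then have fc: "fv (ch (n + k)) \<subseteq> {..n + k}" using gk by (fastforce simp: r_def)
    have eq: "sat M u (ch (n + k)) = sat M (t(m := u (n + k))) \<phi>" if "\<forall>i<n + k. u i = d i" for u
      unfolding ch sat_rename by (rule sat_cong) (use f that gk in \<open>auto simp: r_def g le_less\<close>)
    have "sat M ((T k)(n + k := a)) (ch (n + k))" by (subst eq) (use a Td in auto)
    then have "sat M (T (Suc k)) (ch (n + k))" using T(4)[of k] fc a by (auto simp: Q_def)
    then have "sat M (t(m := d (n + k))) \<phi>" using eq[of "T (Suc k)"] Td[of _ "Suc k"] by simp
    then show "\<exists>b\<in>range d. sat M (t(m := b)) \<phi>" by blast
  qed (use d in auto)
  have at: "atomic_over (substruc M (range d)) n d"
    unfolding atomic_over_def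
  proof (intro allI impI)
    fix k t assume nk: "n \<le> k" and t: "asg (substruc M (range d)) t" "\<forall>i<n. t i = d i"
    have tD: "range t \<subseteq> range d" using t by simp
    obtain g where g: "\<And>i. t i = d (g i)" using ran[OF tD] by blast
    define N where "N = Suc (Max (insert 0 (g ` {..<k})))"
    have gN: "g i < n + N" if "i < k" for i
    proof -
      have "g i \<le> Max (insert 0 (g ` {..<k}))" using that by (intro Max_ge) auto
      then show ?thesis by (simp add: N_def)
    qed
    have tM: "asg M t" using tD d by auto
    have "isolated M n k t"
      by (rule isolated_reindex[OF d diso[of N] tM, where g=g]) (use t g gN nk in auto)
    then show "isolated (substruc M (range d)) n k t" by (rule isolated_elem_sub[OF el tD])
  qed
  obtain f and A :: "nat struc" where A: "is_struc A" "iso_map f (substruc M (range d)) A"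
    using countable_nat_copy[OF elem_sub_struc[OF el]] univ_substruc by (metis countable_image countableI_type)
  have da: "asg (substruc M (range d)) d" by simp
  show thesis
  proof (rule that[of A "f \<circ> d"])
    show "is_struc A" by (rule A)
    show "Th A = Th M" using Th_iso[OF elem_sub_struc[OF el] A(2)] elem_sub_Th[OF el] by simp
    show "asg A (f \<circ> d)" by (rule iso_map_asg[OF A(2) da])
    show "tp n A (f \<circ> d) = tp n M s"
      using tp_iso[OF A(2) da] elem_sub_tp[OF el] tp_cong[of n d s M] ds by simp
    show "atomic_over A n (f \<circ> d)"
      unfolding atomic_over_def
    proof (intro allI impI)
      fix k t assume nk: "n \<le> k" and t: "asg A t" "\<forall>i<n. t i = (f \<circ> d) i"
      let ?S = "substruc M (range d)"
      obtain t0 where t0: "asg ?S t0" "t = f \<circ> t0" using iso_map_asg_lift[OF A(2) t(1)] by blast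
      have "\<forall>i<n. t0 i = d i"
        using t(2) iso_map_eq_iff[OF A(2) t0(1) da] unfolding t0(2) by simp
      then have "isolated ?S n k t0" using at nk t0(1) unfolding atomic_over_def by blast
      then obtain \<theta> where \<theta>: "fv \<theta> \<subseteq> {..<k}" "sat ?S t0 \<theta>"
        and \<theta>i: "\<And>t'. asg ?S t' \<Longrightarrow> (\<forall>i<n. t' i = t0 i) \<Longrightarrow> sat ?S t' \<theta> \<Longrightarrow> tp k ?S t' = tp k ?S t0"
        unfolding isolated_def by blast
      show "isolated A n k t" 
      proof (rule isolatedI[OF \<theta>(1)])
        show "sat A t \<theta>" unfolding t0(2) sat_iso[OF A(2) t0(1)] by (rule \<theta>(2))
        fix t' assume t': "asg A t'" "\<forall>i<n. t' i = t i" "sat A t' \<theta>"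
        obtain t1 where t1: "asg ?S t1" "t' = f \<circ> t1" using iso_map_asg_lift[OF A(2) t'(1)] by blast
        have "\<forall>i<n. t1 i = t0 i"
          using t'(2) iso_map_eq_iff[OF A(2) t1(1) t0(1)] unfolding t0(2) t1(2) by simp
        moreover have "sat ?S t1 \<theta>" using t'(3) unfolding t1(2) sat_iso[OF A(2) t1(1)] .
        ultimately have "tp k ?S t1 = tp k ?S t0" using \<theta>i t1(1) by blast
        then show "tp k A t' = tp k A t" unfolding t0(2) t1(2) tp_iso[OF A(2) t0(1)] tp_iso[OF A(2) t1(1)] .
      qed
    qed
  qed
qed

subsection \<open>The number of countable models\<close>

definition fin_types :: "fm set \<Rightarrow> bool" where
  "fin_types T \<longleftrightarrow> (\<forall>k. finite (types k T))"

text \<open>An unrealized type would contain, for each of the finitely many realized ones, a formula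
  missing from it. These formulas are jointly satisfied by some tuple of \<open>M\<close>, whose own
  type is then contradicted.\<close>

lemma fin_types_realized:
  assumes M: "is_struc M" and fin: "finite {tp k M t | t. asg M t}"
  shows "finite (types k (Th M))"
proof (rule finite_subset[OF _ fin], rule subsetI, rule ccontr)
  define R where "R = {tp k M t | t. asg M t}"
  fix q assume q: "q \<in> types k (Th M)" and "q \<notin> {tp k M t | t. asg M t}"
  then have nq: "q \<notin> R" by (simp add: R_def)
  obtain N :: "nat struc" and u where N: "is_struc N" "Th N = Th M" "asg N u" "q = tp k N u"
    using typesE[OF q M] by blast
  have "\<exists>\<phi>. \<phi> \<in> q \<and> \<phi> \<notin> p" if p: "p \<in> R" for p
  proof (rule ccontr)
    assume "\<nexists>\<phi>. \<phi> \<in> q \<and> \<phi> \<notin> p"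
    then have "q \<subseteq> p" by blast
    moreover obtain t where t: "p = tp k M t" using p by (auto simp: R_def)
    ultimately have "q = p" unfolding N(4) t by (intro tp_sub_eq)
    then show False using p nq by simp
  qed
  then have "\<forall>p\<in>R. \<exists>\<phi>. \<phi> \<in> q \<and> \<phi> \<notin> p" by blast
  from bchoice[OF this] obtain c where c: "\<forall>p\<in>R. c p \<in> q \<and> c p \<notin> p" by blast
  have cR: "finite (c ` R)" using fin by (simp add: R_def)
  have "\<forall>\<phi>\<in>c ` R. sat N u \<phi>" using c N(4) by (auto simp: tp_def)
  from Th_transfer[OF N(2) M N(3) cR this] obtain t where t: "asg M t" "\<forall>\<phi>\<in>c ` R. sat M t \<phi>" by blast
  then have p: "tp k M t \<in> R" by (auto simp: R_def)
  then have "sat M t (c (tp k M t))" "c (tp k M t) \<in> q" "c (tp k M t) \<notin> tp k M t" using t(2) c by blast+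
  then show False using N(4) by (simp add: tp_def)
qed

text \<open>Atomicity covers the tuples over \<open>s\<close> by isolating formulas, and saturation
  makes finitely many of them suffice. Each contributes a single type.\<close>

lemma saturated_atomic_fin_types:
  assumes M: "is_struc M" "saturated M" and s: "asg M s" and at: "atomic_over M n s"
  shows "fin_types (Th M)"
  unfolding fin_types_def
proof
  fix k
  let ?K = "n + k"
  define A where "A t \<longleftrightarrow> asg M t \<and> (\<forall>i<n. t i = s i)" for t
  \<comment> \<open>Formulas that determine the type of their realizations over
    \<open>s\<close>.\<close>
  define cpl where "cpl \<psi> \<longleftrightarrow> fv \<psi> \<subseteq> {..<?K} \<and> (\<forall>t t'. A t \<longrightarrow> A t' \<longrightarrow> sat M t \<psi> \<longrightarrow> sat M t' \<psi> \<longrightarrow> tp ?K M t = tp ?K M t')" for \<psi>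
  have cov: "\<exists>\<psi>. cpl \<psi> \<and> sat M t \<psi>" if t: "A t" for t
  proof -
    have "isolated M n ?K t" using at t unfolding atomic_over_def A_def by simp
    then obtain \<theta> where \<theta>: "fv \<theta> \<subseteq> {..<?K}" "sat M t \<theta>"
      and \<theta>i: "\<And>t'. asg M t' \<Longrightarrow> (\<forall>i<n. t' i = t i) \<Longrightarrow> sat M t' \<theta> \<Longrightarrow> tp ?K M t' = tp ?K M t"
      unfolding isolated_def by blast
    have "tp ?K M t' = tp ?K M t" if "A t'" "sat M t' \<theta>" for t'
      by (rule \<theta>i) (use that t in \<open>auto simp: A_def\<close>)
    then have "cpl \<theta>" using \<theta>(1) by (simp add: cpl_def)
    with \<theta>(2) show ?thesis by blast
  qed
  have "\<exists>G. finite G \<and> G \<subseteq> Neg ` {\<psi>. cpl \<psi>} \<and> \<not> (\<exists>t. A t \<and> (\<forall>\<phi>\<in>G. sat M t \<phi>))"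
  proof (rule ccontr)
    assume no: "\<not> ?thesis"
    have "satisfiable M n s (Neg ` {\<psi>. cpl \<psi>})"
    proof (rule saturatedD[where k="?K", OF M(2) s])
      fix G assume "finite G" "G \<subseteq> Neg ` {\<psi>. cpl \<psi>}"
      then have "\<exists>t. A t \<and> (\<forall>\<phi>\<in>G. sat M t \<phi>)" using no by blast
      then show "satisfiable M n s G" by (simp add: A_def)
    qed (auto simp: cpl_def)
    then obtain t where "A t" "\<forall>\<phi>\<in>Neg ` {\<psi>. cpl \<psi>}. sat M t \<phi>" unfolding A_def by blast
    then show False using cov[of t] by auto
  qed
  then obtain G where "finite G" "G \<subseteq> Neg ` {\<psi>. cpl \<psi>}" and "\<not> (\<exists>t. A t \<and> (\<forall>\<phi>\<in>G. sat M t \<phi>))"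
    by (elim exE conjE)
  then have G: "finite G" "G \<subseteq> Neg ` {\<psi>. cpl \<psi>}" "\<And>t. A t \<Longrightarrow> \<exists>\<phi>\<in>G. \<not> sat M t \<phi>" by blast+
  define h where "h \<phi> = tp ?K M (SOME t. A t \<and> \<not> sat M t \<phi>)" for \<phi>
  have "{tp ?K M t | t. A t} \<subseteq> h ` G"
  proof
    fix p assume "p \<in> {tp ?K M t | t. A t}"
    then obtain t where t: "A t" "p = tp ?K M t" by blast
    obtain \<phi> where \<phi>: "\<phi> \<in> G" "\<not> sat M t \<phi>" using G(3) t(1) by blast
    then obtain \<psi> where \<psi>: "cpl \<psi>" "\<phi> = Neg \<psi>" using G(2) by blast
    define t0 where "t0 = (SOME t. A t \<and> \<not> sat M t \<phi>)"
    have "A t0 \<and> \<not> sat M t0 \<phi>" unfolding t0_def by (rule someI[of _ t]) (use t \<phi> in simp)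
    then have "A t0" "sat M t0 \<psi>" "sat M t \<psi>" using \<psi>(2) \<phi>(2) by simp_all
    then have "tp ?K M t0 = p" using \<psi>(1) t unfolding cpl_def by blast
    then have "h \<phi> = p" by (simp add: h_def t0_def)
    then show "p \<in> h ` G" using \<phi>(1) by blast
  qed
  then have fP: "finite {tp ?K M t | t. A t}" using G(1) finite_subset by blast
  \<comment> \<open>The type of \<open>t\<close> alone is read off from that of \<open>t\<close>
    preceded by the \<open>n\<close> parameters, by shifting variables.\<close>
  have "{tp k M t | t. asg M t} \<subseteq> (\<lambda>p. {\<phi>. fv \<phi> \<subseteq> {..<k} \<and> rename ((+) n) \<phi> \<in> p}) ` {tp ?K M t | t. A t}"
  proof
    fix p assume "p \<in> {tp k M t | t. asg M t}"
    then obtain t where t: "asg M t" "p = tp k M t" by blast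
    let ?t = "\<lambda>i. if i < n then s i else t (i - n)"
    have "A ?t" using s t by (auto simp: A_def)
    moreover have "p = {\<phi>. fv \<phi> \<subseteq> {..<k} \<and> rename ((+) n) \<phi> \<in> tp ?K M ?t}"
    proof -
      have "fv \<phi> \<subseteq> {..<k} \<Longrightarrow> fv (rename ((+) n) \<phi>) \<subseteq> {..<?K}" for \<phi>
        using fv_rename[of "(+) n" \<phi>] by force
      moreover have "sat M ?t (rename ((+) n) \<phi>) = sat M t \<phi>" for \<phi>
        by (simp add: sat_rename comp_def)
      ultimately show ?thesis unfolding t(2) tp_def by auto
    qed
    ultimately show "p \<in> (\<lambda>p. {\<phi>. fv \<phi> \<subseteq> {..<k} \<and> rename ((+) n) \<phi> \<in> p}) ` {tp ?K M t | t. A t}" by blast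
  qed
  then have "finite {tp k M t | t. asg M t}" using fP finite_subset by blast
  then show "finite (types k (Th M))" by (rule fin_types_realized[OF M(1)])
qed

text \<open>Without parameters, that \<open>\<theta>\<close> isolates is a property of the theory: a
  formula compatible with \<open>\<theta>\<close> in one model is compatible with it in the
  other.\<close>

lemma isolated_transfer:
  assumes M: "is_struc M" and N: "Th N = Th M" and s: "asg M s" and t: "asg N t" "tp k N t = tp k M s"
    and i: "isolated M 0 k s"
  shows "isolated N 0 k t"
proof -
  obtain \<theta> where \<theta>: "fv \<theta> \<subseteq> {..<k}" "sat M s \<theta>"
    and \<theta>i: "\<And>t'. asg M t' \<Longrightarrow> (\<forall>i<0. t' i = s i) \<Longrightarrow> sat M t' \<theta> \<Longrightarrow> tp k M t' = tp k M s"
    using i unfolding isolated_def by blast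
  show ?thesis
  proof (rule isolatedI[OF \<theta>(1)])
    show "sat N t \<theta>" using tp_eq_sat[OF t(2) \<theta>(1)] \<theta>(2) by simp
    fix t' assume t': "asg N t'" "sat N t' \<theta>"
    have "tp k N t' \<subseteq> tp k N t"
    proof
      fix \<phi> assume p: "\<phi> \<in> tp k N t'"
      have "\<exists>s'. asg M s' \<and> (\<forall>\<psi>\<in>{\<theta>, \<phi>}. sat M s' \<psi>)"
        by (rule Th_transfer[OF N M t'(1)]) (use t' p in \<open>auto simp: tp_def\<close>)
      then obtain s' where s': "asg M s'" "sat M s' \<theta>" "sat M s' \<phi>" by auto
      then have "tp k M s' = tp k M s" using \<theta>i by simp
      then show "\<phi> \<in> tp k N t" unfolding t(2) using s' p by (auto simp: tp_def)
    qed
    then show "tp k N t' = tp k N t" by (rule tp_sub_eq)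
  qed
qed

text \<open>The atomic model omits the non-isolated type that the other two realize. The remaining
  two differ because a model that is saturated and atomic over a tuple has finite type
  spaces.\<close>

lemma three_models:
  fixes M :: "'a struc"
  assumes M: "is_struc M" and sm: "small (Th M)" and nf: "\<not> fin_types (Th M)"
  obtains A B C :: "nat struc" where "is_model A (Th M)" "is_model B (Th M)" "is_model C (Th M)"
    "\<not> isomorphic A B" "\<not> isomorphic A C" "\<not> isomorphic B C"
proof -
  obtain S :: "nat struc" where S: "is_struc S" "Th S = Th M" "saturated S"
    using ex_countable_saturated[OF M sm] by blast
  obtain s where s: "asg S s" using ex_asg S by blast
  have "\<not> atomic_over S 0 s" using saturated_atomic_fin_types[OF S(1,3) s] nf S(2) by metis
  then obtain k t where t: "asg S t" "\<not> isolated S 0 k t" unfolding atomic_over_def by blast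
  have smS: "small (Th S)" using sm S by simp
  obtain A :: "nat struc" and a where A: "is_struc A" "Th A = Th S" "asg A a" "atomic_over A 0 a"
    using ex_atomic_over[OF S(1) smS s, of 0] by metis
  obtain B :: "nat struc" and b where B: "is_struc B" "Th B = Th S" "asg B b" "tp k B b = tp k S t" "atomic_over B k b"
    using ex_atomic_over[OF S(1) smS t(1), of k] by metis
  have om: "tp k A u \<noteq> tp k S t" if u: "asg A u" for u
  proof
    assume e: "tp k A u = tp k S t"
    have "isolated A 0 k u" using A(4) u unfolding atomic_over_def by simp
    then show False using isolated_transfer[OF A(1) A(2)[symmetric] u t(1) e[symmetric]] t(2) by blast
  qed
  have omit: "\<not> isomorphic A C" if C: "asg C c" "tp k C c = tp k S t" for C :: "nat struc" and c
  proof
    assume "isomorphic A C"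
    then obtain f where f: "iso_map f C A" using isomorphic_sym isomorphic_iff by blast
    then show False using om[OF iso_map_asg[OF f C(1)]] tp_iso[OF f C(1)] C(2) by simp
  qed
  have "\<not> isomorphic B S"
  proof
    assume "isomorphic B S"
    then obtain f where f: "iso_map f S B" using isomorphic_sym isomorphic_iff by blast
    have "saturated B" by (rule saturated_iso[OF f S(3)])
    then show False using saturated_atomic_fin_types[OF B(1) _ B(3,5)] B(2) S(2) nf by simp
  qed
  then show thesis
    using that[of A B S] omit[OF B(3,4)] omit[OF t(1)] A B S by (simp add: model_Th_iff[OF M])
qed

text \<open>In a finite type space, \<open>p\<close> is singled out by the conjunction of one
  formula separating it from each other type.\<close>

lemma fin_types_isolating:
  assumes M: "is_struc M" and fin: "finite (types k (Th M))" and p: "p \<in> types k (Th M)"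
  obtains \<theta> where "fv \<theta> \<subseteq> {..<k}" "\<And>q. q \<in> types k (Th M) \<Longrightarrow> \<theta> \<in> q \<longleftrightarrow> q = p"
proof -
  obtain N :: "nat struc" and u where N: "is_struc N" "asg N u" "p = tp k N u"
    using typesE[OF p M] by metis
  have "\<exists>\<phi>. \<phi> \<in> p \<and> \<phi> \<notin> q" if q: "q \<in> types k (Th M) - {p}" for q
  proof (rule ccontr)
    assume "\<nexists>\<phi>. \<phi> \<in> p \<and> \<phi> \<notin> q"
    then have "p \<subseteq> q" by blast
    moreover obtain K :: "nat struc" and t where "q = tp k K t" using q typesE[OF _ M, of q k] by blast
    ultimately have "p = q" unfolding N(3) by (metis tp_sub_eq)
    then show False using q by simp
  qed
  then have "\<forall>q\<in>types k (Th M) - {p}. \<exists>\<phi>. \<phi> \<in> p \<and> \<phi> \<notin> q" by blast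
  from bchoice[OF this] obtain c where c: "\<And>q. q \<in> types k (Th M) - {p} \<Longrightarrow> c q \<in> p \<and> c q \<notin> q" by blast
  let ?F = "c ` (types k (Th M) - {p})"
  have F: "finite ?F" using fin by simp
  have Fp: "\<phi> \<in> ?F \<Longrightarrow> \<phi> \<in> p" for \<phi> using c by blast
  have fF: "fv \<phi> \<subseteq> {..<k}" if "\<phi> \<in> ?F" for \<phi>
    using Fp[OF that] unfolding N(3) tp_def by simp
  show thesis
  proof (rule that[of "Conj_set ?F"])
    show f: "fv (Conj_set ?F) \<subseteq> {..<k}" unfolding fv_Conj_set[OF F] using fF by blast
    fix q assume q: "q \<in> types k (Th M)"
    obtain K :: "nat struc" and t where K: "asg K t" "q = tp k K t" using typesE[OF q M] by metis
    have "Conj_set ?F \<in> q \<longleftrightarrow> (\<forall>\<phi>\<in>?F. sat K t \<phi>)"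
      unfolding K(2) tp_def using f sat_Conj_set[OF F asg_nonempty[OF K(1)]] by blast
    also have "\<dots> \<longleftrightarrow> ?F \<subseteq> q" unfolding K(2) tp_def using fF by blast
    also have "\<dots> \<longleftrightarrow> q = p"
    proof
      show "?F \<subseteq> q" if "q = p" using Fp that by blast
      show "q = p" if "?F \<subseteq> q"
      proof (rule ccontr)
        assume "q \<noteq> p"
        then have "c q \<in> ?F" "c q \<notin> q" using c[of q] q by blast+
        then show False using that by blast
      qed
    qed
    finally show "Conj_set ?F \<in> q \<longleftrightarrow> q = p" .
  qed
qed

text \<open>The enumerations may repeat elements; agreement on the formulas \<open>Eq i j\<close>
  makes the induced map well defined and injective.\<close>

lemma enum_iso:
  assumes "range d = univ M" "range e = univ N" "\<And>k. tp k M d = tp k N e"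
  shows "isomorphic M N"
proof -
  have sat: "sat M d \<phi> = sat N e \<phi>" for \<phi>
    using fv_bounded[of \<phi>] tp_eq_sat[OF assms(3)] by blast
  have eq: "d i = d j \<longleftrightarrow> e i = e j" for i j using sat[of "Eq i j"] by simp
  have le: "(d i, d j) \<in> leq M \<longleftrightarrow> (e i, e j) \<in> leq N" for i j using sat[of "Le i j"] by simp
  define f where "f x = e (SOME i. d i = x)" for x
  have fd: "f (d i) = e i" for i
  proof -
    have "d (SOME j. d j = d i) = d i" by (rule someI[of _ i]) simp
    then show ?thesis unfolding f_def using eq by blast
  qed
  have "bij_betw f (univ M) (univ N)"
    unfolding bij_betw_def inj_on_def assms(1,2)[symmetric]
    by (auto simp: fd eq image_image)
  then have "iso_map f M N" unfolding iso_map_def assms(1)[symmetric] by (auto simp: fd le)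
  then show ?thesis unfolding isomorphic_iff by blast
qed

text \<open>The back-and-forth step: the extended type is isolated by a formula, and the existence
  of a last coordinate satisfying it belongs to the type of the shorter tuple.\<close>

lemma fin_types_extend:
  assumes M: "is_struc M" "fin_types (Th M)" and N: "is_struc N" "Th N = Th M" "is_struc N'" "Th N' = Th M"
    and t: "asg N t" "asg N' t'" "tp k N t = tp k N' t'" and a: "a \<in> univ N"
  shows "\<exists>b\<in>univ N'. tp (Suc k) N (t(k := a)) = tp (Suc k) N' (t'(k := b))"
proof -
  let ?p = "tp (Suc k) N (t(k := a))"
  have ta: "asg N (t(k := a))" by (rule asg_upd[OF t(1) a])
  have p: "?p \<in> types (Suc k) (Th M)" using tp_in_types[OF N(1) ta] N(2) by simp
  have fin: "finite (types (Suc k) (Th M))" using M(2) by (simp add: fin_types_def)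
  obtain \<theta> where \<theta>: "fv \<theta> \<subseteq> {..<Suc k}" "\<And>q. q \<in> types (Suc k) (Th M) \<Longrightarrow> \<theta> \<in> q \<longleftrightarrow> q = ?p"
    using fin_types_isolating[OF M(1) fin p] by blast
  have "sat N t (Ex k \<theta>)" using \<theta>(2)[OF p] a by (auto simp: tp_def)
  moreover have "fv (Ex k \<theta>) \<subseteq> {..<k}" using \<theta>(1) by (auto simp: less_Suc_eq)
  ultimately have "sat N' t' (Ex k \<theta>)" using tp_eq_sat[OF t(3)] by blast
  then obtain b where b: "b \<in> univ N'" "sat N' (t'(k := b)) \<theta>" by auto
  have "tp (Suc k) N' (t'(k := b)) \<in> types (Suc k) (Th M)"
    using tp_in_types[OF N(3) asg_upd[OF t(2) b(1)]] N(4) by simp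
  moreover have "\<theta> \<in> tp (Suc k) N' (t'(k := b))" using \<theta>(1) b(2) by (simp add: tp_def)
  ultimately show ?thesis using \<theta>(2) b(1) by blast
qed

lemma fin_types_categorical:
  fixes N N' :: "nat struc"
  assumes M: "is_struc M" "fin_types (Th M)" and N: "is_struc N" "Th N = Th M" and N': "is_struc N'" "Th N' = Th M"
  shows "isomorphic N N'"
proof -
  define P where "P k x \<longleftrightarrow> asg N (fst x) \<and> asg N' (snd x) \<and> tp k N (fst x) = tp k N' (snd x)"
    for k :: nat and x :: "(nat \<Rightarrow> nat) \<times> (nat \<Rightarrow> nat)"
  \<comment> \<open>Even stages put the number \<open>k div 2\<close> into the first sequence and
    odd stages into the second, if it belongs to the structure. Otherwise the new pair of elements
    is arbitrary, so finite structures are simply enumerated with repetitions.\<close>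
  define Q where "Q k x y \<longleftrightarrow> (\<forall>i<k. fst y i = fst x i \<and> snd y i = snd x i) \<and>
     (even k \<longrightarrow> k div 2 \<in> univ N \<longrightarrow> fst y k = k div 2) \<and>
     (odd k \<longrightarrow> k div 2 \<in> univ N' \<longrightarrow> snd y k = k div 2)"
    for k :: nat and x y :: "(nat \<Rightarrow> nat) \<times> (nat \<Rightarrow> nat)"
  have "\<exists>T. \<forall>k. P k (T k) \<and> Q k (T k) (T (Suc k))"
  proof (rule dependent_nat_choice)
    obtain t t' where "asg N t" "asg N' t'" using ex_asg N N' by metis
    then show "\<exists>x. P 0 x" using tp_0_iff[of t N t' N'] N(2) N'(2) by (intro exI[of _ "(t, t')"]) (simp add: P_def)
    fix x k assume P: "P k x"
    obtain t t' where x: "x = (t, t')" by (cases x)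
    have t: "asg N t" "asg N' t'" "tp k N t = tp k N' t'" using P by (auto simp: P_def x)
    have "\<exists>a b. a \<in> univ N \<and> b \<in> univ N' \<and> tp (Suc k) N (t(k := a)) = tp (Suc k) N' (t'(k := b)) \<and>
      (even k \<longrightarrow> k div 2 \<in> univ N \<longrightarrow> a = k div 2) \<and> (odd k \<longrightarrow> k div 2 \<in> univ N' \<longrightarrow> b = k div 2)"
    proof (cases "even k")
      case True
      have "\<exists>a\<in>univ N. k div 2 \<in> univ N \<longrightarrow> a = k div 2" using N(1) by (auto simp: is_struc_def)
      then obtain a where a: "a \<in> univ N" "k div 2 \<in> univ N \<longrightarrow> a = k div 2" by blast
      obtain b where "b \<in> univ N'" "tp (Suc k) N (t(k := a)) = tp (Suc k) N' (t'(k := b))"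
        using fin_types_extend[OF M N N' t a(1)] by blast
      then show ?thesis using a True by blast
    next
      case False
      have "\<exists>b\<in>univ N'. k div 2 \<in> univ N' \<longrightarrow> b = k div 2" using N'(1) by (auto simp: is_struc_def)
      then obtain b where b: "b \<in> univ N'" "k div 2 \<in> univ N' \<longrightarrow> b = k div 2" by blast
      obtain a where "a \<in> univ N" "tp (Suc k) N' (t'(k := b)) = tp (Suc k) N (t(k := a))"
        using fin_types_extend[OF M N' N t(2,1) t(3)[symmetric] b(1)] by blast
      then show ?thesis using b False by metis
    qed
    then obtain a b where ab: "a \<in> univ N" "b \<in> univ N'" "tp (Suc k) N (t(k := a)) = tp (Suc k) N' (t'(k := b))"
      "even k \<longrightarrow> k div 2 \<in> univ N \<longrightarrow> a = k div 2" "odd k \<longrightarrow> k div 2 \<in> univ N' \<longrightarrow> b = k div 2" by blast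
    then show "\<exists>y. P (Suc k) y \<and> Q k x y"
      using asg_upd[OF t(1) ab(1)] asg_upd[OF t(2) ab(2)]
      by (intro exI[of _ "(t(k := a), t'(k := b))"]) (simp add: P_def Q_def x)
  qed
  then obtain T where T: "\<And>k. P k (T k)" "\<And>k. Q k (T k) (T (Suc k))" by blast
  define d e where "d i = fst (T (Suc i)) i" and "e i = snd (T (Suc i)) i" for i
  have st: "fst (T (k + m)) i = fst (T k) i \<and> snd (T (k + m)) i = snd (T k) i" if "i < k" for i k m
    using that
  proof (induction m)
    case (Suc m)
    then show ?case using T(2)[of "k + m"] by (simp add: Q_def)
  qed simp
  have de: "fst (T k) i = d i" "snd (T k) i = e i" if "i < k" for i k
  proof -
    have "Suc i + (k - Suc i) = k" using that by simp
    then show "fst (T k) i = d i" "snd (T k) i = e i"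
      using st[of i "Suc i" "k - Suc i"] unfolding d_def e_def by (simp_all only: lessI simp_thms)
  qed
  show ?thesis
  proof (rule enum_iso)
    have "d i \<in> univ N" "e i \<in> univ N'" for i using T(1)[of "Suc i"] by (auto simp: P_def d_def e_def)
    moreover have "x \<in> range d" if "x \<in> univ N" for x
    proof -
      have "d (2 * x) = x" using T(2)[of "2 * x"] that by (simp add: Q_def d_def)
      then show ?thesis by (metis rangeI)
    qed
    moreover have "x \<in> range e" if "x \<in> univ N'" for x
    proof -
      have "e (Suc (2 * x)) = x" using T(2)[of "Suc (2 * x)"] that by (simp add: Q_def e_def)
      then show ?thesis by (metis rangeI)
    qed
    ultimately show "range d = univ N" "range e = univ N'" by auto
    fix k
    have "tp k N d = tp k N (fst (T k))" by (rule tp_cong) (simp add: de)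
    also have "\<dots> = tp k N' (snd (T k))" using T(1)[of k] by (simp add: P_def)
    also have "\<dots> = tp k N' e" by (rule tp_cong) (simp add: de)
    finally show "tp k N d = tp k N' e" .
  qed
qed

subsection \<open>Lexicographic sums\<close>

text \<open>The setting of the Feferman-Vaught argument: arbitrary structures as summands, disjoint
  so that every point has a unique index.\<close>

definition disj_fam :: "nat struc \<Rightarrow> (nat \<Rightarrow> 'a struc) \<Rightarrow> bool" where
  "disj_fam I X \<longleftrightarrow> (\<forall>i\<in>univ I. is_struc (X i)) \<and> disjoint_family_on (\<lambda>i. univ (X i)) (univ I)"

lemma disj_fam_unique:
  "disj_fam I X \<Longrightarrow> i \<in> univ I \<Longrightarrow> j \<in> univ I \<Longrightarrow> x \<in> univ (X i) \<Longrightarrow> x \<in> univ (X j) \<Longrightarrow> i = j"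
  unfolding disj_fam_def disjoint_family_on_def by blast

lemma univ_lex_sum: "univ (lex_sum I X) = (\<Union>i\<in>univ I. univ (X i))"
  by (simp add: lex_sum_def)

lemma leq_lex_sum:
  assumes "disj_fam I X" "i \<in> univ I" "j \<in> univ I" "x \<in> univ (X i)" "y \<in> univ (X j)"
  shows "(x, y) \<in> leq (lex_sum I X) \<longleftrightarrow> (if i = j then (x, y) \<in> leq (X i) else (i, j) \<in> leq I)"
proof -
  have ux: "i' = i" if "i' \<in> univ I" "x \<in> univ (X i')" for i'
    using disj_fam_unique[OF assms(1)] assms that by blast
  have uy: "j' = j" if "j' \<in> univ I" "y \<in> univ (X j')" for j'
    using disj_fam_unique[OF assms(1)] assms that by blast
  have "(x, y) \<in> leq (lex_sum I X) \<longleftrightarrow>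
    (\<exists>i'\<in>univ I. x \<in> univ (X i') \<and> y \<in> univ (X i') \<and> (x, y) \<in> leq (X i')) \<or>
    (\<exists>i'\<in>univ I. \<exists>j'\<in>univ I. x \<in> univ (X i') \<and> y \<in> univ (X j') \<and> (i', j') \<in> leq I \<and> i' \<noteq> j')"
    by (simp add: lex_sum_def)
  also have "(\<exists>i'\<in>univ I. x \<in> univ (X i') \<and> y \<in> univ (X i') \<and> (x, y) \<in> leq (X i')) \<longleftrightarrow>
      i = j \<and> (x, y) \<in> leq (X i)"
    using ux uy assms(2-) by blast
  also have "(\<exists>i'\<in>univ I. \<exists>j'\<in>univ I. x \<in> univ (X i') \<and> y \<in> univ (X j') \<and> (i', j') \<in> leq I \<and> i' \<noteq> j') \<longleftrightarrow>
      i \<noteq> j \<and> (i, j) \<in> leq I"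
    using ux uy assms(2-) by blast
  finally show ?thesis by simp
qed

lemma is_struc_lex_sum: "disj_fam I X \<Longrightarrow> is_struc I \<Longrightarrow> is_struc (lex_sum I X)"
  unfolding is_struc_def disj_fam_def lex_sum_def by fastforce

text \<open>The colouring \<open>c\<close> fixes in advance which summand contains the value of each
  variable; the reduction of a formula to the summands depends on it.\<close>

definition summand_asg :: "nat struc \<Rightarrow> (nat \<Rightarrow> nat) \<Rightarrow> (nat \<Rightarrow> 'a struc) \<Rightarrow> (nat \<Rightarrow> 'a) \<Rightarrow> bool" where
  "summand_asg I c X s \<longleftrightarrow> disj_fam I X \<and> (\<forall>v. c v \<in> univ I \<and> s v \<in> univ (X (c v)))"

lemma summand_asg_neq: "summand_asg I c X s \<Longrightarrow> c m \<noteq> c n \<Longrightarrow> s m \<noteq> s n"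
  using disj_fam_unique[of I X "c m" "c n" "s m"] unfolding summand_asg_def by auto

lemma summand_asg_leq_iff:
  assumes "summand_asg I c X s"
  shows "(s m, s n) \<in> leq (lex_sum I X) \<longleftrightarrow>
    (if c m = c n then (s m, s n) \<in> leq (X (c m)) else (c m, c n) \<in> leq I)"
  by (rule leq_lex_sum) (use assms in \<open>auto simp: summand_asg_def\<close>)

text \<open>The assignment also takes values outside \<open>X i\<close>. In the applications the
  formulas in \<open>\<Delta> i\<close> have free variables of colour \<open>i\<close> only, so
  these values are never consulted.\<close>

definition agree_on :: "nat struc \<Rightarrow> (nat \<Rightarrow> fm set) \<Rightarrow> (nat \<Rightarrow> 'a struc) \<Rightarrow> (nat \<Rightarrow> 'a) \<Rightarrow>
    (nat \<Rightarrow> 'b struc) \<Rightarrow> (nat \<Rightarrow> 'b) \<Rightarrow> bool" where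
  "agree_on I \<Delta> X s Y t \<longleftrightarrow> (\<forall>i\<in>univ I. \<forall>\<psi>\<in>\<Delta> i. sat (X i) s \<psi> = sat (Y i) t \<psi>)"

definition pattern_fm :: "fm set \<Rightarrow> fm set \<Rightarrow> fm" where
  "pattern_fm D P = Conj_set ((\<lambda>\<psi>. if \<psi> \<in> P then \<psi> else Neg \<psi>) ` D)"

lemma sat_pattern_fm:
  "finite D \<Longrightarrow> univ M \<noteq> {} \<Longrightarrow> sat M s (pattern_fm D P) \<longleftrightarrow> (\<forall>\<psi>\<in>D. sat M s \<psi> \<longleftrightarrow> \<psi> \<in> P)"
  by (simp add: pattern_fm_def sat_Conj_set if_image_distrib ball_Un) blast

lemma fv_pattern_fm: assumes "finite D" shows "fv (pattern_fm D P) = \<Union> (fv ` D)"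
proof -
  have "fv (if \<psi> \<in> P then \<psi> else Neg \<psi>) = fv \<psi>" for \<psi> by simp
  then show ?thesis using assms by (simp add: pattern_fm_def fv_Conj_set image_image del: if_image_distrib)
qed

text \<open>
  A witness in summand \<open>j\<close> matters only through the set of formulas of \<open>\<Delta> j j\<close> that it satisfies,
  and that some witness satisfies exactly a given set is expressed by one formula over summand \<open>j\<close>.
\<close>

definition witness_fms :: "nat struc \<Rightarrow> nat \<Rightarrow> (nat \<Rightarrow> nat \<Rightarrow> fm set) \<Rightarrow> nat \<Rightarrow> fm set" where
  "witness_fms I n \<Delta> j = (\<Union>i\<in>univ I - {j}. \<Delta> i j) \<union> (\<lambda>P. Ex n (pattern_fm (\<Delta> j j) P)) ` (if j \<in> univ I then Pow (\<Delta> j j) else {})"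

text \<open>One implication of the quantifier step, stated for two families so that exchanging them
  gives the converse.\<close>

lemma lex_sum_ex_step:
  assumes fin: "\<And>i j. i \<in> univ I \<Longrightarrow> finite (\<Delta> i j)"
    and fvD: "\<And>i j \<psi>. i \<in> univ I \<Longrightarrow> \<psi> \<in> \<Delta> i j \<Longrightarrow> fv \<psi> \<subseteq> {v. (c(n := i)) v = j}"
    and IH: "\<And>i s t. i \<in> univ I \<Longrightarrow> summand_asg I (c(n := i)) X s \<Longrightarrow> summand_asg I (c(n := i)) Y t \<Longrightarrow>
       agree_on I (\<Delta> i) X s Y t \<Longrightarrow> sat (lex_sum I X) s \<phi> \<Longrightarrow> sat (lex_sum I Y) t \<phi>"
    and X: "summand_asg I c X s" and Y: "summand_asg I c Y t"
    and A: "agree_on I (witness_fms I n \<Delta>) X s Y t"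
    and s: "sat (lex_sum I X) s (Ex n \<phi>)"
  shows "sat (lex_sum I Y) t (Ex n \<phi>)"
proof -
  obtain i a where i: "i \<in> univ I" "a \<in> univ (X i)" and a: "sat (lex_sum I X) (s(n := a)) \<phi>"
    using s by (auto simp: univ_lex_sum)
  \<comment> \<open>The pattern of the witness \<open>a\<close> in its own summand. In the other
    summands nothing changes, because their formulas do not contain \<open>n\<close>, which now has
    colour \<open>i\<close>.\<close>
  define P where "P = {\<psi> \<in> \<Delta> i i. sat (X i) (s(n := a)) \<psi>}"
  have ne: "univ (X i) \<noteq> {}" "univ (Y i) \<noteq> {}"
    using X Y i by (auto simp: summand_asg_def disj_fam_def is_struc_def)
  have "sat (X i) (s(n := a)) (pattern_fm (\<Delta> i i) P)"
    using sat_pattern_fm[OF fin[OF i(1)] ne(1)] by (simp add: P_def)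
  then have "sat (X i) s (Ex n (pattern_fm (\<Delta> i i) P))" using i(2) by auto
  moreover have "Ex n (pattern_fm (\<Delta> i i) P) \<in> witness_fms I n \<Delta> i" using i(1) by (auto simp: witness_fms_def P_def)
  ultimately have "sat (Y i) t (Ex n (pattern_fm (\<Delta> i i) P))" using A i(1) unfolding agree_on_def by blast
  then obtain b where b: "b \<in> univ (Y i)" "sat (Y i) (t(n := b)) (pattern_fm (\<Delta> i i) P)" by auto
  have bP: "sat (Y i) (t(n := b)) \<psi> \<longleftrightarrow> \<psi> \<in> P" if "\<psi> \<in> \<Delta> i i" for \<psi>
    using b(2) sat_pattern_fm[OF fin[OF i(1)] ne(2)] that by blast
  have "agree_on I (\<Delta> i) X (s(n := a)) Y (t(n := b))"
    unfolding agree_on_def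
  proof (intro ballI)
    fix j \<psi> assume j: "j \<in> univ I" "\<psi> \<in> \<Delta> i j"
    show "sat (X j) (s(n := a)) \<psi> = sat (Y j) (t(n := b)) \<psi>"
    proof (cases "j = i")
      case True
      then show ?thesis using bP[of \<psi>] j by (auto simp: P_def)
    next
      case False
      then have n: "n \<notin> fv \<psi>" using fvD[OF i(1) j(2)] by auto
      have "sat (X j) (s(n := a)) \<psi> = sat (X j) s \<psi>" by (rule sat_cong) (use n in auto)
      also have "\<psi> \<in> witness_fms I n \<Delta> j" using False i(1) j by (auto simp: witness_fms_def)
      then have "sat (X j) s \<psi> = sat (Y j) t \<psi>" using A j(1) unfolding agree_on_def by blast
      also have "\<dots> = sat (Y j) (t(n := b)) \<psi>" by (rule sat_cong) (use n in auto)
      finally show ?thesis .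
    qed
  qed
  moreover have "summand_asg I (c(n := i)) X (s(n := a))" "summand_asg I (c(n := i)) Y (t(n := b))"
    using X Y i b by (auto simp: summand_asg_def)
  ultimately have "sat (lex_sum I Y) (t(n := b)) \<phi>" using IH i(1) a by blast
  then show ?thesis using b(1) i(1) by (auto simp: univ_lex_sum)
qed

abbreviation determined :: "nat struc \<Rightarrow> (nat \<Rightarrow> nat) \<Rightarrow> (nat \<Rightarrow> fm set) \<Rightarrow> fm \<Rightarrow>
    (nat \<Rightarrow> 'a struc) \<Rightarrow> (nat \<Rightarrow> 'b struc) \<Rightarrow> bool" where
  "determined I c \<Delta> \<phi> X Y \<equiv> \<forall>s t. summand_asg I c X s \<longrightarrow> summand_asg I c Y t \<longrightarrow> agree_on I \<Delta> X s Y t \<longrightarrow>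
     sat (lex_sum I X) s \<phi> = sat (lex_sum I Y) t \<phi>"

text \<open>The finite sets \<open>\<Delta> i\<close> are found from the formula and the colouring
  before the summands are known, so they serve all families. Atoms between different colours are
  decided by \<open>I\<close> and need no formula. Free variables are tracked so that types of
  finite tuples can be compared.\<close>

lemma Feferman_Vaught:
  assumes I: "finite (univ I)"
  shows "(\<forall>v. c v \<in> univ I) \<Longrightarrow> \<exists>\<Delta>. (\<forall>i. finite (\<Delta> i)) \<and> (\<forall>i. \<forall>\<psi>\<in>\<Delta> i. fv \<psi> \<subseteq> {v. c v = i} \<inter> fv \<phi>) \<and>
    (\<forall>(X :: nat \<Rightarrow> 'a struc) (Y :: nat \<Rightarrow> 'b struc). determined I c \<Delta> \<phi> X Y)"
proof (induction \<phi> arbitrary: c)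
  case (Eq m n)
  show ?case
  proof (cases "c m = c n")
    case True
    show ?thesis
      by (rule exI[of _ "\<lambda>i. if i = c m then {Eq m n} else {}"]) (use True Eq in \<open>auto simp: agree_on_def summand_asg_def\<close>)
  next
    case False
    then show ?thesis by (intro exI[of _ "\<lambda>_. {}"]) (simp add: summand_asg_neq)
  qed
next
  case (Le m n)
  show ?case
  proof (cases "c m = c n")
    case True
    show ?thesis
      by (rule exI[of _ "\<lambda>i. if i = c m then {Le m n} else {}"]) (use True Le in \<open>auto simp: agree_on_def summand_asg_leq_iff\<close>)
  next
    case False
    then show ?thesis by (intro exI[of _ "\<lambda>_. {}"]) (simp add: summand_asg_leq_iff)
  qed
next
  case (Neg \<phi>)
  show ?case using Neg.IH[OF Neg.prems] by simp
next
  case (Conj \<phi> \<psi>)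
  obtain D1 where D1: "\<forall>i. finite (D1 i)" "\<forall>i. \<forall>\<psi>\<in>D1 i. fv \<psi> \<subseteq> {v. c v = i} \<inter> fv \<phi>"
    "\<forall>(X :: nat \<Rightarrow> 'a struc) (Y :: nat \<Rightarrow> 'b struc). determined I c D1 \<phi> X Y" using Conj.IH(1)[OF Conj.prems] by (elim exE conjE)
  obtain D2 where D2: "\<forall>i. finite (D2 i)" "\<forall>i. \<forall>\<chi>\<in>D2 i. fv \<chi> \<subseteq> {v. c v = i} \<inter> fv \<psi>"
    "\<forall>(X :: nat \<Rightarrow> 'a struc) (Y :: nat \<Rightarrow> 'b struc). determined I c D2 \<psi> X Y" using Conj.IH(2)[OF Conj.prems] by (elim exE conjE)
  have "agree_on I D1 X s Y t \<and> agree_on I D2 X s Y t" if "agree_on I (\<lambda>i. D1 i \<union> D2 i) X s Y t"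
    for X :: "nat \<Rightarrow> 'a struc" and Y :: "nat \<Rightarrow> 'b struc" and s t
    using that by (auto simp: agree_on_def)
  then show ?case
    using D1 D2 by (intro exI[of _ "\<lambda>i. D1 i \<union> D2 i"] conjI) (simp, fastforce, simp)
next
  case (Ex n \<phi>)
  have "\<exists>D. (\<forall>j. finite (D j)) \<and> (\<forall>j. \<forall>\<psi>\<in>D j. fv \<psi> \<subseteq> {v. (c(n := i)) v = j} \<inter> fv \<phi>) \<and>
    (\<forall>(X :: nat \<Rightarrow> 'a struc) (Y :: nat \<Rightarrow> 'b struc). determined I (c(n := i)) D \<phi> X Y)" if "i \<in> univ I" for i
    by (rule Ex.IH) (use Ex.prems that in auto)
  then have "\<forall>i\<in>univ I. \<exists>D. (\<forall>j. finite (D j)) \<and> (\<forall>j. \<forall>\<psi>\<in>D j. fv \<psi> \<subseteq> {v. (c(n := i)) v = j} \<inter> fv \<phi>) \<and>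
    (\<forall>(X :: nat \<Rightarrow> 'a struc) (Y :: nat \<Rightarrow> 'b struc). determined I (c(n := i)) D \<phi> X Y)" by (intro ballI)
  from bchoice[OF this] obtain \<Delta> where D: "\<forall>i\<in>univ I. (\<forall>j. finite (\<Delta> i j)) \<and> (\<forall>j. \<forall>\<psi>\<in>\<Delta> i j. fv \<psi> \<subseteq> {v. (c(n := i)) v = j} \<inter> fv \<phi>) \<and>
    (\<forall>(X :: nat \<Rightarrow> 'a struc) (Y :: nat \<Rightarrow> 'b struc). determined I (c(n := i)) (\<Delta> i) \<phi> X Y)" by (elim exE)
  have fin: "\<And>i j. i \<in> univ I \<Longrightarrow> finite (\<Delta> i j)" using D by simp
  have fvD: "\<And>i j \<psi>. i \<in> univ I \<Longrightarrow> \<psi> \<in> \<Delta> i j \<Longrightarrow> fv \<psi> \<subseteq> {v. (c(n := i)) v = j} \<inter> fv \<phi>" using D by simp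
  then have fvD': "\<And>i j \<psi>. i \<in> univ I \<Longrightarrow> \<psi> \<in> \<Delta> i j \<Longrightarrow> fv \<psi> \<subseteq> {v. (c(n := i)) v = j}" by blast
  have IH: "sat (lex_sum I X) s \<phi> = sat (lex_sum I Y) t \<phi>"
    if "i \<in> univ I" "summand_asg I (c(n := i)) X s" "summand_asg I (c(n := i)) Y t" "agree_on I (\<Delta> i) X s Y t"
    for i and X :: "nat \<Rightarrow> 'a struc" and Y :: "nat \<Rightarrow> 'b struc" and s t
    using D that by simp
  show ?case
  proof (intro exI[of _ "witness_fms I n \<Delta>"] conjI allI impI ballI)
    show "finite (witness_fms I n \<Delta> j)" for j using I fin by (auto simp: witness_fms_def)
    show "fv \<psi> \<subseteq> {v. c v = j} \<inter> fv (Ex n \<phi>)" if d: "\<psi> \<in> witness_fms I n \<Delta> j" for j \<psi>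
    proof (cases "\<exists>i\<in>univ I - {j}. \<psi> \<in> \<Delta> i j")
      case True
      then obtain i where i: "i \<in> univ I" "i \<noteq> j" "\<psi> \<in> \<Delta> i j" by blast
      show ?thesis
      proof
        fix v assume "v \<in> fv \<psi>"
        then have "(c(n := i)) v = j" "v \<in> fv \<phi>" using fvD[OF i(1,3)] by blast+
        then show "v \<in> {v. c v = j} \<inter> fv (Ex n \<phi>)" using i(2) by (cases "v = n") auto
      qed
    next
      case False
      then obtain P where P: "j \<in> univ I" "\<psi> = Ex n (pattern_fm (\<Delta> j j) P)" using d by (auto simp: witness_fms_def split: if_splits)
      show ?thesis
      proof
        fix v assume "v \<in> fv \<psi>"
        then have "v \<noteq> n" "\<exists>\<chi>\<in>\<Delta> j j. v \<in> fv \<chi>" using P fv_pattern_fm[OF fin[OF P(1)]] by auto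
        moreover then obtain \<chi> where "\<chi> \<in> \<Delta> j j" "v \<in> fv \<chi>" by blast
        ultimately show "v \<in> {v. c v = j} \<inter> fv (Ex n \<phi>)" using fvD[OF P(1), of \<chi> j] by auto
      qed
    qed
    fix X :: "nat \<Rightarrow> 'a struc" and Y :: "nat \<Rightarrow> 'b struc" and s t
    assume X: "summand_asg I c X s" and Y: "summand_asg I c Y t" and A: "agree_on I (witness_fms I n \<Delta>) X s Y t"
    have A': "agree_on I (witness_fms I n \<Delta>) Y t X s" using A by (simp add: agree_on_def)
    have sym: "agree_on I (\<Delta> i) X s Y t" if "agree_on I (\<Delta> i) Y t X s" for i s t using that by (simp add: agree_on_def)
    show "sat (lex_sum I X) s (Ex n \<phi>) = sat (lex_sum I Y) t (Ex n \<phi>)"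
    proof
      show "sat (lex_sum I X) s (Ex n \<phi>) \<Longrightarrow> sat (lex_sum I Y) t (Ex n \<phi>)"
        by (rule lex_sum_ex_step[OF fin fvD' _ X Y A]) (use IH in blast)+
      show "sat (lex_sum I Y) t (Ex n \<phi>) \<Longrightarrow> sat (lex_sum I X) s (Ex n \<phi>)"
        by (rule lex_sum_ex_step[OF fin fvD' _ Y X A']) (use IH sym in blast)+
    qed
  qed
qed

text \<open>Since \<open>s\<close> does not stay in one summand, \<open>u i\<close> replaces it
  there, agreeing with it on the variables below \<open>k\<close> of colour
  \<open>i\<close>.\<close>

lemma lex_sum_tp:
  fixes X :: "nat \<Rightarrow> 'a struc" and Y :: "nat \<Rightarrow> 'b struc"
  assumes I: "finite (univ I)" and X: "summand_asg I c X s" and Y: "summand_asg I c Y t"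
    and u: "\<And>i. i \<in> univ I \<Longrightarrow> tp k (X i) (u i) = tp k (Y i) (w i)"
    and us: "\<And>v. v < k \<Longrightarrow> u (c v) v = s v" and wt: "\<And>v. v < k \<Longrightarrow> w (c v) v = t v"
  shows "tp k (lex_sum I X) s = tp k (lex_sum I Y) t"
  unfolding tp_eq_iff
proof (intro allI impI)
  fix \<phi> assume p: "fv \<phi> \<subseteq> {..<k}"
  have c: "\<forall>v. c v \<in> univ I" using X by (simp add: summand_asg_def)
  obtain \<Delta> where D: "\<forall>i. finite (\<Delta> i)" "\<forall>i. \<forall>\<psi>\<in>\<Delta> i. fv \<psi> \<subseteq> {v. c v = i} \<inter> fv \<phi>"
    "\<forall>(X :: nat \<Rightarrow> 'a struc) (Y :: nat \<Rightarrow> 'b struc). determined I c \<Delta> \<phi> X Y"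
    using Feferman_Vaught[OF I c, where \<phi>=\<phi>] by (elim exE conjE)
  have "agree_on I \<Delta> X s Y t"
    unfolding agree_on_def
  proof (intro ballI)
    fix i \<psi> assume i: "i \<in> univ I" "\<psi> \<in> \<Delta> i"
    have f: "v < k" "c v = i" if "v \<in> fv \<psi>" for v using D(2) i(2) p that by blast+
    have "sat (X i) s \<psi> = sat (X i) (u i) \<psi>" by (rule sat_cong) (use f us in force)
    also have "\<dots> = sat (Y i) (w i) \<psi>" by (rule tp_eq_sat[OF u[OF i(1)]]) (use f in auto)
    also have "\<dots> = sat (Y i) t \<psi>" by (rule sat_cong) (use f wt in force)
    finally show "sat (X i) s \<psi> = sat (Y i) t \<psi>" .
  qed
  then show "sat (lex_sum I X) s \<phi> = sat (lex_sum I Y) t \<phi>" using D(3) X Y by simp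
qed

lemma lex_sum_Th:
  fixes X :: "nat \<Rightarrow> 'a struc" and Y :: "nat \<Rightarrow> 'b struc"
  assumes I: "finite (univ I)" "is_struc I" and X: "disj_fam I X" and Y: "disj_fam I Y"
    and Th: "\<And>i. i \<in> univ I \<Longrightarrow> Th (X i) = Th (Y i)"
  shows "Th (lex_sum I X) = Th (lex_sum I Y)"
proof -
  obtain i0 where i0: "i0 \<in> univ I" using I(2) by (auto simp: is_struc_def)
  have "\<forall>i\<in>univ I. \<exists>x. x \<in> univ (X i)" "\<forall>i\<in>univ I. \<exists>y. y \<in> univ (Y i)"
    using X Y by (auto simp: disj_fam_def is_struc_def)
  then obtain x y where xy: "\<And>i. i \<in> univ I \<Longrightarrow> x i \<in> univ (X i)" "\<And>i. i \<in> univ I \<Longrightarrow> y i \<in> univ (Y i)"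
    by metis
  have "tp 0 (lex_sum I X) (\<lambda>_. x i0) = tp 0 (lex_sum I Y) (\<lambda>_. y i0)"
  proof (rule lex_sum_tp[OF I(1), where c="\<lambda>_. i0"])
    fix i assume i: "i \<in> univ I"
    show "tp 0 (X i) (\<lambda>_. x i) = tp 0 (Y i) (\<lambda>_. y i)"
      using tp_0_iff[of "\<lambda>_. x i" "X i" "\<lambda>_. y i" "Y i"] xy i Th by (simp add: image_subset_iff)
  qed (use X Y i0 xy in \<open>auto simp: summand_asg_def\<close>)
  moreover have "asg (lex_sum I X) (\<lambda>_. x i0)" "asg (lex_sum I Y) (\<lambda>_. y i0)"
    using i0 xy by (auto simp: univ_lex_sum)
  ultimately show ?thesis by (simp only: tp_0_iff)
qed

lemma image_factor_subset:
  assumes "\<And>x y. x \<in> A \<Longrightarrow> y \<in> A \<Longrightarrow> h x = h y \<Longrightarrow> g x = g y"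
  shows "g ` A \<subseteq> (\<lambda>z. g (inv_into A h z)) ` (h ` A)"
proof
  fix z assume "z \<in> g ` A"
  then obtain x where x: "x \<in> A" "z = g x" by blast
  have "inv_into A h (h x) \<in> A" "h (inv_into A h (h x)) = h x"
    using x(1) by (auto intro: inv_into_into f_inv_into_f)
  then have "g (inv_into A h (h x)) = z" using assms x by blast
  then show "z \<in> (\<lambda>z. g (inv_into A h z)) ` (h ` A)" using x(1) by blast
qed

lemma finite_image_factor:
  assumes "finite (h ` A)" "\<And>x y. x \<in> A \<Longrightarrow> y \<in> A \<Longrightarrow> h x = h y \<Longrightarrow> g x = g y"
  shows "finite (g ` A)"
  by (rule finite_subset[OF image_factor_subset[of A h g, OF assms(2)] finite_imageI[OF assms(1)]])

lemma countable_image_factor: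
  assumes "countable (h ` A)" "\<And>x y. x \<in> A \<Longrightarrow> y \<in> A \<Longrightarrow> h x = h y \<Longrightarrow> g x = g y"
  shows "countable (g ` A)"
  by (rule countable_subset[OF image_factor_subset[of A h g, OF assms(2)] countable_image[OF assms(1)]])

text \<open>A \<open>k\<close>-type of the sum is determined by the colours of the first
  \<open>k\<close> variables and by one \<open>k\<close>-type in each summand, which leaves finitely
  many possibilities.\<close>

lemma lex_sum_fin_types:
  fixes X :: "nat \<Rightarrow> 'a struc"
  assumes I: "finite (univ I)" "is_struc I" and X: "disj_fam I X"
    and fin: "\<And>i. i \<in> univ I \<Longrightarrow> fin_types (Th (X i))"
  shows "fin_types (Th (lex_sum I X))"
  unfolding fin_types_def
proof
  fix k :: nat
  let ?S = "lex_sum I X"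
  define A where "A = {(c, s). summand_asg I c X s}"
  have "\<forall>i\<in>univ I. \<exists>x. x \<in> univ (X i)" using X by (auto simp: disj_fam_def is_struc_def)
  then obtain m where m: "\<And>i. i \<in> univ I \<Longrightarrow> m i \<in> univ (X i)" by metis
  \<comment> \<open>The fixed element \<open>m i\<close> pads the coordinates that do not belong to
    summand \<open>i\<close>.\<close>
  define u where "u c s i = (\<lambda>v. if v < k \<and> c v = i then s v else m i)" for c s and i :: nat
  define h where "h = (\<lambda>(c, s). (restrict c {..<k}, \<lambda>i\<in>univ I. tp k (X i) (u c s i)))"
  have ua: "asg (X i) (u c s i)" if "summand_asg I c X s" "i \<in> univ I" for c s i
    using that m by (auto simp: u_def summand_asg_def)
  have "h ` A \<subseteq> (\<Pi>\<^sub>E v\<in>{..<k}. univ I) \<times> (\<Pi>\<^sub>E i\<in>univ I. types k (Th (X i)))"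
  proof
    fix z assume "z \<in> h ` A"
    then obtain c s where cs: "summand_asg I c X s" "z = h (c, s)" by (auto simp: A_def)
    have "tp k (X i) (u c s i) \<in> types k (Th (X i))" if "i \<in> univ I" for i
      using tp_in_types[OF _ ua[OF cs(1) that]] X that by (simp add: disj_fam_def)
    then show "z \<in> (\<Pi>\<^sub>E v\<in>{..<k}. univ I) \<times> (\<Pi>\<^sub>E i\<in>univ I. types k (Th (X i)))"
      using cs by (auto simp: h_def summand_asg_def)
  qed
  moreover have "finite ((\<Pi>\<^sub>E v\<in>{..<k}. univ I) \<times> (\<Pi>\<^sub>E i\<in>univ I. types k (Th (X i))))"
    using I(1) fin by (intro finite_cartesian_product finite_PiE) (auto simp: fin_types_def)
  ultimately have fh: "finite (h ` A)" by (rule finite_subset)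
  have "finite ((\<lambda>(c, s). tp k ?S s) ` A)"
  proof (rule finite_image_factor[OF fh])
    fix x y assume "x \<in> A" "y \<in> A" and eq: "h x = h y"
    then obtain c s c' s' where x: "x = (c, s)" "summand_asg I c X s" and y: "y = (c', s')" "summand_asg I c' X s'"
      by (auto simp: A_def)
    have rc: "restrict c {..<k} = restrict c' {..<k}"
      and rt: "(\<lambda>i\<in>univ I. tp k (X i) (u c s i)) = (\<lambda>i\<in>univ I. tp k (X i) (u c' s' i))"
      using eq by (simp_all add: h_def x(1) y(1))
    have cc: "c v = c' v" if "v < k" for v using fun_cong[OF rc, of v] that by simp
    have tt: "tp k (X i) (u c s i) = tp k (X i) (u c' s' i)" if "i \<in> univ I" for i
      using fun_cong[OF rt, of i] that by simp
    \<comment> \<open>The two colourings agree only below \<open>k\<close>; replacing the rest of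
      \<open>s'\<close> by \<open>s\<close> makes \<open>c\<close> a correct colouring of
      \<open>t\<close> everywhere.\<close>
    define t where "t v = (if v < k then s' v else s v)" for v
    have gt: "summand_asg I c X t" using x(2) y(2) cc unfolding summand_asg_def t_def by auto
    have "tp k ?S s = tp k ?S t"
    proof (rule lex_sum_tp[OF I(1) x(2) gt tt])
      show "u c s (c v) v = s v" if "v < k" for v using that by (simp add: u_def)
      show "u c' s' (c v) v = t v" if "v < k" for v using that cc by (simp add: u_def t_def)
    qed
    also have "\<dots> = tp k ?S s'" by (rule tp_cong) (simp add: t_def)
    finally show "(case x of (c, s) \<Rightarrow> tp k ?S s) = (case y of (c, s) \<Rightarrow> tp k ?S s)" by (simp add: x y)
  qed
  moreover have "{tp k ?S s | s. asg ?S s} \<subseteq> (\<lambda>(c, s). tp k ?S s) ` A"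
  proof
    fix p assume "p \<in> {tp k ?S s | s. asg ?S s}"
    then obtain s where s: "asg ?S s" "p = tp k ?S s" by blast
    have "\<forall>v. \<exists>i. i \<in> univ I \<and> s v \<in> univ (X i)" using s(1) by (auto simp: univ_lex_sum)
    then obtain c where "\<forall>v. c v \<in> univ I \<and> s v \<in> univ (X (c v))" by metis
    then have "(c, s) \<in> A" using X by (simp add: A_def summand_asg_def)
    then show "p \<in> (\<lambda>(c, s). tp k ?S s) ` A" using s(2) by force
  qed
  ultimately have "finite {tp k ?S s | s. asg ?S s}" by (rule finite_subset[rotated])
  then show "finite (types k (Th ?S))" by (rule fin_types_realized[OF is_struc_lex_sum[OF X I(2)]])
qed

subsection \<open>Definability of the summands\<close>

text \<open>
  If \<open>s i\<close> is the largest element of the \<open>i\<close>-th summand, then a point lies in that summand iff it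
  is below \<open>s i\<close> but not below \<open>s j\<close> for any \<open>j\<close> strictly below \<open>i\<close>.
\<close>

definition block :: "nat struc \<Rightarrow> 'a struc \<Rightarrow> (nat \<Rightarrow> 'a) \<Rightarrow> nat \<Rightarrow> 'a set" where
  "block I M s i = {x \<in> univ M. (x, s i) \<in> leq M \<and> (\<forall>j\<in>univ I. (j, i) \<in> leq I \<and> j \<noteq> i \<longrightarrow> (x, s j) \<notin> leq M)}"

definition summand :: "nat struc \<Rightarrow> 'a struc \<Rightarrow> (nat \<Rightarrow> 'a) \<Rightarrow> nat \<Rightarrow> 'a struc" where
  "summand I M s i = substruc M (block I M s i)"

lemma univ_summand [simp]: "univ (summand I M s i) = block I M s i"
  by (simp add: summand_def)

lemma summand_cong:
  assumes "\<And>j. j \<in> univ I \<Longrightarrow> s j = t j" "i \<in> univ I"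
  shows "summand I M s i = summand I M t i"
  using assms by (simp add: summand_def block_def)

text \<open>The index \<open>i\<close> doubles as the variable that names the largest element of
  summand \<open>i\<close>.\<close>

definition summand_fm :: "nat struc \<Rightarrow> nat \<Rightarrow> nat \<Rightarrow> fm" where
  "summand_fm I i v = Conj_set (insert (Le v i) ((\<lambda>j. Neg (Le v j)) ` {j \<in> univ I. (j, i) \<in> leq I \<and> j \<noteq> i}))"

lemma fv_summand_fm:
  assumes "finite (univ I)" "univ I \<subseteq> {..<K}" "i \<in> univ I"
  shows "fv (summand_fm I i v) \<subseteq> insert v {..<K}"
proof -
  have "fv (summand_fm I i v) = {v, i} \<union> (\<Union>j\<in>{j \<in> univ I. (j, i) \<in> leq I \<and> j \<noteq> i}. {v, j})"
    using assms(1) by (simp add: summand_fm_def fv_Conj_set)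
  then show ?thesis using assms(2,3) by auto
qed

lemma sat_summand_fm:
  assumes "finite (univ I)" "univ M \<noteq> {}" "s v \<in> univ M"
  shows "sat M s (summand_fm I i v) \<longleftrightarrow> s v \<in> block I M s i"
  using assms by (simp add: summand_fm_def sat_Conj_set block_def) blast

text \<open>Variables are shifted by \<open>K\<close>, so that those below \<open>K\<close>, which name the largest elements of the
  summands, are never captured.\<close>

primrec relativize :: "nat \<Rightarrow> nat struc \<Rightarrow> nat \<Rightarrow> fm \<Rightarrow> fm" where
  "relativize K I i (Eq m n) = Eq (K + m) (K + n)"
| "relativize K I i (Le m n) = Le (K + m) (K + n)"
| "relativize K I i (Neg \<phi>) = Neg (relativize K I i \<phi>)"
| "relativize K I i (Conj \<phi> \<psi>) = Conj (relativize K I i \<phi>) (relativize K I i \<psi>)"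
| "relativize K I i (Ex n \<phi>) = Ex (K + n) (Conj (summand_fm I i (K + n)) (relativize K I i \<phi>))"

lemma fv_relativize:
  assumes "finite (univ I)" "univ I \<subseteq> {..<K}" "i \<in> univ I"
  shows "fv (relativize K I i \<phi>) \<subseteq> {..<K} \<union> (+) K ` fv \<phi>"
proof (induction \<phi>)
  case (Ex n \<phi>)
  have "fv (relativize K I i (Ex n \<phi>)) \<subseteq> ({..<K} \<union> (+) K ` fv \<phi>) - {K + n}"
    using Ex.IH fv_summand_fm[OF assms, of "K + n"] by auto
  also have "\<dots> \<subseteq> {..<K} \<union> (+) K ` (fv \<phi> - {n})" by auto
  finally show ?case by simp
qed auto

lemma fv_relativize_bound:
  assumes "finite (univ I)" "univ I \<subseteq> {..<K}" "i \<in> univ I" "fv \<phi> \<subseteq> {..<k}"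
  shows "fv (relativize K I i \<phi>) \<subseteq> {..<K + k}"
proof -
  have 1: "(+) K ` fv \<phi> \<subseteq> {..<K + k}" using assms(4) by auto
  have 2: "{..<K} \<subseteq> {..<K + k}" by auto
  show ?thesis by (rule order.trans[OF fv_relativize[OF assms(1-3)] Un_least[OF 2 1]])
qed

lemma sat_relativize:
  assumes I: "finite (univ I)" "univ I \<subseteq> {..<K}" "i \<in> univ I"
  shows "asg M w \<Longrightarrow> (\<And>v. w (K + v) \<in> block I M w i) \<Longrightarrow>
    sat M w (relativize K I i \<phi>) \<longleftrightarrow> sat (summand I M w i) (\<lambda>v. w (K + v)) \<phi>"
proof (induction \<phi> arbitrary: w)
  case (Le m n)
  then show ?case by (simp add: summand_def)
next
  case (Ex n \<phi>)
  have ps: "summand I M (w(K + n := a)) i = summand I M w i" "block I M (w(K + n := a)) i = block I M w i" for a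
  proof -
    show 1: "summand I M (w(K + n := a)) i = summand I M w i" by (rule summand_cong) (use I in auto)
    show "block I M (w(K + n := a)) i = block I M w i" using arg_cong[OF 1, of univ] by simp
  qed
  have ne: "univ M \<noteq> {}" using Ex.prems by auto
  have d: "sat M (w(K + n := a)) (summand_fm I i (K + n)) \<longleftrightarrow> a \<in> block I M w i" if "a \<in> univ M" for a
    using sat_summand_fm[OF I(1) ne, of "w(K + n := a)" "K + n" i] that by (simp add: ps(2))
  have sub: "block I M w i \<subseteq> univ M" by (auto simp: block_def)
  have "sat M w (relativize K I i (Ex n \<phi>)) \<longleftrightarrow>
    (\<exists>a\<in>univ M. sat M (w(K + n := a)) (summand_fm I i (K + n)) \<and> sat M (w(K + n := a)) (relativize K I i \<phi>))" by simp
  also have "\<dots> \<longleftrightarrow> (\<exists>a\<in>block I M w i. sat M (w(K + n := a)) (relativize K I i \<phi>))"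
    using d sub by blast
  also have "\<dots> \<longleftrightarrow> (\<exists>a\<in>block I M w i. sat (summand I M w i) ((\<lambda>v. w (K + v))(n := a)) \<phi>)"
  proof (rule bex_cong[OF refl])
    fix a assume a: "a \<in> block I M w i"
    have e: "(\<lambda>v. (w(K + n := a)) (K + v)) = (\<lambda>v. w (K + v))(n := a)" by auto
    have "sat M (w(K + n := a)) (relativize K I i \<phi>) = sat (summand I M (w(K + n := a)) i) (\<lambda>v. (w(K + n := a)) (K + v)) \<phi>"
    proof (rule Ex.IH)
      show "asg M (w(K + n := a))" by (rule asg_upd) (use Ex.prems a in \<open>auto simp: block_def\<close>)
      show "(w(K + n := a)) (K + v) \<in> block I M (w(K + n := a)) i" for v
        unfolding ps(2) using Ex.prems(2)[of v] a by simp
    qed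
    then show "sat M (w(K + n := a)) (relativize K I i \<phi>) = sat (summand I M w i) ((\<lambda>v. w (K + v))(n := a)) \<phi>"
      unfolding ps(1) e .
  qed
  finally show ?case by simp
qed auto

section \<open>Reading the summands off from types in the sum\<close>

definition shift :: "nat \<Rightarrow> (nat \<Rightarrow> 'a) \<Rightarrow> (nat \<Rightarrow> 'a) \<Rightarrow> nat \<Rightarrow> 'a" where
  "shift K s t v = (if v < K then s v else t (v - K))"

lemma sat_relativize_shift:
  assumes I: "finite (univ I)" "univ I \<subseteq> {..<K}" "i \<in> univ I" and s: "asg M s" and t: "asg (summand I M s i) t"
  shows "asg M (shift K s t)" "sat M (shift K s t) (relativize K I i \<phi>) \<longleftrightarrow> sat (summand I M s i) t \<phi>"
proof -
  have p: "summand I M (shift K s t) i = summand I M s i" by (rule summand_cong) (use I in \<open>auto simp: shift_def\<close>)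
  have p': "block I M (shift K s t) i = block I M s i" using arg_cong[OF p, of univ] by simp
  have tv: "t v \<in> block I M s i" for v using t by auto
  then have "t v \<in> univ M" for v by (auto simp: block_def)
  then show a: "asg M (shift K s t)" using s by (auto simp: shift_def)
  have "shift K s t (K + v) = t v" for v by (simp add: shift_def)
  then show "sat M (shift K s t) (relativize K I i \<phi>) \<longleftrightarrow> sat (summand I M s i) t \<phi>"
    using sat_relativize[OF I a, of \<phi>] tv unfolding p p' by simp
qed

text \<open>Relativizing a sentence leaves free only the variables below \<open>K\<close>, so its
  truth in the summand is part of the type of the tuple.\<close>

lemma summand_Th:
  assumes I: "finite (univ I)" "univ I \<subseteq> {..<K}" "i \<in> univ I"
    and s: "asg M s" "asg N t" "tp K M s = tp K N t"
    and ne: "block I M s i \<noteq> {}" "block I N t i \<noteq> {}"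
  shows "Th (summand I M s i) = Th (summand I N t i)"
proof -
  obtain u where u: "asg (summand I M s i) u" 
    using ex_asg[of "summand I M s i"] is_struc_substruc[OF ne(1)] unfolding summand_def by blast
  obtain w where w: "asg (summand I N t i) w" 
    using ex_asg[of "summand I N t i"] is_struc_substruc[OF ne(2)] unfolding summand_def by blast
  have "tp 0 (summand I M s i) u = tp 0 (summand I N t i) w"
    unfolding tp_eq_iff
  proof (intro allI impI)
    fix \<phi> assume "fv \<phi> \<subseteq> {..<0::nat}"
    then have f: "fv (relativize K I i \<phi>) \<subseteq> {..<K}" using fv_relativize_bound[OF I, of \<phi> 0] by simp
    have "sat (summand I M s i) u \<phi> = sat M (shift K s u) (relativize K I i \<phi>)" using sat_relativize_shift(2)[OF I s(1) u] by simp
    also have "\<dots> = sat M s (relativize K I i \<phi>)" by (rule sat_cong) (use f in \<open>auto simp: shift_def\<close>)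
    also have "\<dots> = sat N t (relativize K I i \<phi>)" by (rule tp_eq_sat[OF s(3) f])
    also have "\<dots> = sat N (shift K t w) (relativize K I i \<phi>)" by (rule sat_cong) (use f in \<open>auto simp: shift_def\<close>)
    also have "\<dots> = sat (summand I N t i) w \<phi>" using sat_relativize_shift(2)[OF I s(2) w] by simp
    finally show "sat (summand I M s i) u \<phi> = sat (summand I N t i) w \<phi>" .
  qed
  then show ?thesis using tp_0_iff[OF u w] by simp
qed

text \<open>Relativization reads a \<open>k\<close>-type of the summand off from a
  \<open>(K + k)\<close>-type of the sum, with the largest elements in front.\<close>

lemma summand_fin_types:
  assumes I: "finite (univ I)" "univ I \<subseteq> {..<K}" "i \<in> univ I"
    and M: "is_struc M" "asg M s" "fin_types (Th M)" and ne: "block I M s i \<noteq> {}"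
  shows "fin_types (Th (summand I M s i))"
  unfolding fin_types_def
proof
  fix k :: nat
  let ?P = "summand I M s i"
  have "{tp k ?P t | t. asg ?P t} \<subseteq> (\<lambda>p. {\<phi>. fv \<phi> \<subseteq> {..<k} \<and> relativize K I i \<phi> \<in> p}) ` types (K + k) (Th M)"
  proof
    fix p assume "p \<in> {tp k ?P t | t. asg ?P t}"
    then obtain t where t: "asg ?P t" "p = tp k ?P t" by blast
    have "p = {\<phi>. fv \<phi> \<subseteq> {..<k} \<and> relativize K I i \<phi> \<in> tp (K + k) M (shift K s t)}"
      unfolding t(2) tp_def using sat_relativize_shift(2)[OF I M(2) t(1)] fv_relativize_bound[OF I] by auto
    moreover have "tp (K + k) M (shift K s t) \<in> types (K + k) (Th M)"
      by (rule tp_in_types[OF M(1) sat_relativize_shift(1)[OF I M(2) t(1)]])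
    ultimately show "p \<in> (\<lambda>p. {\<phi>. fv \<phi> \<subseteq> {..<k} \<and> relativize K I i \<phi> \<in> p}) ` types (K + k) (Th M)" by blast
  qed
  moreover have "finite (types (K + k) (Th M))" using M(3) by (simp add: fin_types_def)
  ultimately have "finite {tp k ?P t | t. asg ?P t}" by (meson finite_imageI finite_subset)
  then show "finite (types k (Th ?P))"
    by (rule fin_types_realized[rotated]) (simp add: summand_def is_struc_substruc ne)
qed

text \<open>A first-order condition on the tuple: its blocks contain their tops, cover the universe,
  are disjoint, and are ordered among each other as \<open>I\<close> prescribes.\<close>

definition decomposes :: "nat struc \<Rightarrow> 'a struc \<Rightarrow> (nat \<Rightarrow> 'a) \<Rightarrow> bool" where
  "decomposes I M s \<longleftrightarrow> (\<forall>i\<in>univ I. s i \<in> block I M s i) \<and> (\<forall>x\<in>univ M. \<exists>i\<in>univ I. x \<in> block I M s i) \<and>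
    (\<forall>i\<in>univ I. \<forall>j\<in>univ I. i \<noteq> j \<longrightarrow> (\<forall>x\<in>block I M s i. \<forall>y\<in>block I M s j.
       x \<noteq> y \<and> ((x, y) \<in> leq M \<longleftrightarrow> (i, j) \<in> leq I)))"

definition decomp_pair_fm :: "nat \<Rightarrow> nat struc \<Rightarrow> nat \<Rightarrow> nat \<Rightarrow> fm" where
  "decomp_pair_fm K I i j = Neg (Ex K (Ex (Suc K) (Conj (Conj (summand_fm I i K) (summand_fm I j (Suc K)))
     (Neg (Conj (Neg (Eq K (Suc K))) (if (i, j) \<in> leq I then Le K (Suc K) else Neg (Le K (Suc K))))))))"

definition decomp_fm :: "nat \<Rightarrow> nat struc \<Rightarrow> fm" where
  "decomp_fm K I = Conj_set ((\<lambda>i. summand_fm I i i) ` univ I \<union> {Neg (Ex K (Conj_set ((\<lambda>i. Neg (summand_fm I i K)) ` univ I)))} \<union>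
     (\<lambda>(i, j). decomp_pair_fm K I i j) ` {(i, j). i \<in> univ I \<and> j \<in> univ I \<and> i \<noteq> j})"

lemma finite_off_diagonal: "finite A \<Longrightarrow> finite {(i, j). i \<in> A \<and> j \<in> A \<and> i \<noteq> j}"
  by (rule finite_subset[of _ "A \<times> A"]) auto

lemma block_upd:
  assumes "univ I \<subseteq> {..<K}" "i \<in> univ I" "K \<le> v"
  shows "block I M (s(v := a)) i = block I M s i"
proof -
  have "summand I M (s(v := a)) i = summand I M s i" by (rule summand_cong) (use assms in auto)
  from arg_cong[OF this, of univ] show ?thesis by simp
qed

lemma sat_decomp_pair_fm:
  assumes I: "finite (univ I)" "univ I \<subseteq> {..<K}" "i \<in> univ I" "j \<in> univ I" and s: "asg M s"
  shows "sat M s (decomp_pair_fm K I i j) \<longleftrightarrow>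
    (\<forall>x\<in>block I M s i. \<forall>y\<in>block I M s j. x \<noteq> y \<and> ((x, y) \<in> leq M \<longleftrightarrow> (i, j) \<in> leq I))"
proof -
  have ne: "univ M \<noteq> {}" using s by auto
  have d1: "sat M (s(K := x, Suc K := y)) (summand_fm I i K) \<longleftrightarrow> x \<in> block I M s i" if "x \<in> univ M" for x y
    using sat_summand_fm[OF I(1) ne, of "s(K := x, Suc K := y)" K i] that by (simp add: block_upd[OF I(2,3)])
  have d2: "sat M (s(K := x, Suc K := y)) (summand_fm I j (Suc K)) \<longleftrightarrow> y \<in> block I M s j" if "y \<in> univ M" for x y
    using sat_summand_fm[OF I(1) ne, of "s(K := x, Suc K := y)" "Suc K" j] that by (simp add: block_upd[OF I(2,4)])
  have sub: "block I M s i \<subseteq> univ M" for i by (auto simp: block_def)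
  have "sat M s (decomp_pair_fm K I i j) \<longleftrightarrow> (\<forall>x\<in>univ M. \<forall>y\<in>univ M. x \<in> block I M s i \<longrightarrow> y \<in> block I M s j \<longrightarrow>
     x \<noteq> y \<and> ((x, y) \<in> leq M \<longleftrightarrow> (i, j) \<in> leq I))"
    unfolding decomp_pair_fm_def by (simp add: d1 d2)
  then show ?thesis using sub by blast
qed

lemma sat_decomp_fm:
  assumes I: "finite (univ I)" "univ I \<subseteq> {..<K}" and s: "asg M s"
  shows "sat M s (decomp_fm K I) \<longleftrightarrow> decomposes I M s"
proof -
  have ne: "univ M \<noteq> {}" using s by auto
  have 1: "sat M s (summand_fm I i i) \<longleftrightarrow> s i \<in> block I M s i" for i
    by (rule sat_summand_fm[OF I(1) ne]) (use s in auto)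
  have d: "sat M (s(K := x)) (summand_fm I i K) \<longleftrightarrow> x \<in> block I M s i" if "x \<in> univ M" "i \<in> univ I" for x i
    using sat_summand_fm[OF I(1) ne, of "s(K := x)" K i] that by (simp add: block_upd[OF I(2) that(2)])
  have 2: "sat M s (Neg (Ex K (Conj_set ((\<lambda>i. Neg (summand_fm I i K)) ` univ I)))) \<longleftrightarrow> (\<forall>x\<in>univ M. \<exists>i\<in>univ I. x \<in> block I M s i)"
    using I(1) ne d by (simp add: sat_Conj_set)
  show ?thesis
    unfolding decomp_fm_def decomposes_def using I(1) ne finite_off_diagonal[OF I(1)]
    by (subst sat_Conj_set) (simp_all add: ball_Un 1 2 sat_decomp_pair_fm[OF I _ _ s] del: sat.simps, blast)
qed

lemma decomposes_decomposition:
  assumes I: "poset I" "finite (univ I)" and M: "poset M" and d: "decomposes I M s"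
  shows "fld1_decomposition I (summand I M s)" "lex_sum I (summand I M s) = M" "disj_fam I (summand I M s)"
proof -
  have sM: "is_struc M" and po: "partial_order_on (univ M) (leq M)" using M by (auto simp: poset_def)
  have ps: "block I M s i \<subseteq> univ M" for i by (auto simp: block_def)
  have ne: "block I M s i \<noteq> {}" if "i \<in> univ I" for i using d that by (auto simp: decomposes_def)
  have st: "is_struc (summand I M s i)" if "i \<in> univ I" for i
    unfolding summand_def by (rule is_struc_substruc[OF ne[OF that]])
  have disj: "disjoint_family_on (\<lambda>i. univ (summand I M s i)) (univ I)"
    using d unfolding disjoint_family_on_def decomposes_def univ_summand by blast
  show df: "disj_fam I (summand I M s)" using st disj by (simp add: disj_fam_def)
  have pp: "poset (summand I M s i)" if "i \<in> univ I" for i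
  proof -
    have "partial_order_on (block I M s i) (leq M \<inter> block I M s i \<times> block I M s i)"
      using po ps[of i] unfolding partial_order_on_def preorder_on_def refl_on_def trans_def antisym_def by blast
    then show ?thesis using st[OF that] by (simp add: poset_def summand_def)
  qed
  have hl: "has_largest (summand I M s i)" if "i \<in> univ I" for i
    unfolding has_largest_def univ_summand
  proof
    show si: "s i \<in> block I M s i" using d that by (simp add: decomposes_def)
    show "\<forall>x\<in>block I M s i. (x, s i) \<in> leq (summand I M s i)"
      using si by (auto simp: summand_def) (auto simp: block_def)
  qed
  show "fld1_decomposition I (summand I M s)"
    using I pp hl disj by (simp add: fld1_decomposition_def)
  have U: "univ (lex_sum I (summand I M s)) = univ M"
    using d ps by (auto simp: univ_lex_sum decomposes_def)
  have "(x, y) \<in> leq (lex_sum I (summand I M s)) \<longleftrightarrow> (x, y) \<in> leq M" if xy: "x \<in> univ M" "y \<in> univ M" for x y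
  proof -
    have cov: "\<exists>i\<in>univ I. z \<in> block I M s i" if "z \<in> univ M" for z using d that by (simp add: decomposes_def)
    obtain i where i: "i \<in> univ I" "x \<in> block I M s i" using cov[OF xy(1)] by blast
    obtain j where j: "j \<in> univ I" "y \<in> block I M s j" using cov[OF xy(2)] by blast
    have "(x, y) \<in> leq (lex_sum I (summand I M s)) \<longleftrightarrow> (if i = j then (x, y) \<in> leq (summand I M s i) else (i, j) \<in> leq I)"
      by (rule leq_lex_sum[OF df i(1) j(1)]) (use i j in auto)
    also have "\<dots> \<longleftrightarrow> (x, y) \<in> leq M"
    proof (cases "i = j")
      case True
      then show ?thesis using i j by (simp add: summand_def)
    next
      case False
      then show ?thesis using d i j unfolding decomposes_def by simp
    qed
    finally show ?thesis .
  qed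
  moreover have "leq (lex_sum I (summand I M s)) \<subseteq> univ M \<times> univ M" "leq M \<subseteq> univ M \<times> univ M"
    using is_struc_lex_sum[OF df] I(1) sM unfolding is_struc_def U poset_def by auto
  ultimately have "leq (lex_sum I (summand I M s)) = leq M" by blast
  with U show "lex_sum I (summand I M s) = M" by simp
qed

lemma decomposition_disj_fam: "fld1_decomposition I X \<Longrightarrow> disj_fam I X"
  by (auto simp: fld1_decomposition_def disj_fam_def poset_def)

text \<open>A point of summand \<open>j\<close> is below the largest element of summand
  \<open>i\<close> precisely when \<open>j\<close> equals \<open>i\<close> or is below it in
  \<open>I\<close>. The exclusion of strictly smaller indices in \<open>block\<close> thus recovers
  exactly the summand.\<close>

lemma decomposition_decomposes:
  assumes D: "fld1_decomposition I X"
    and s: "\<And>i. i \<in> univ I \<Longrightarrow> s i \<in> univ (X i) \<and> (\<forall>x\<in>univ (X i). (x, s i) \<in> leq (X i))"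
  shows "decomposes I (lex_sum I X) s" "\<And>i. i \<in> univ I \<Longrightarrow> summand I (lex_sum I X) s i = X i"
proof -
  let ?S = "lex_sum I X"
  have df: "disj_fam I X" by (rule decomposition_disj_fam[OF D])
  have anti: "i = j" if "(i, j) \<in> leq I" "(j, i) \<in> leq I" for i j
    using D that unfolding fld1_decomposition_def poset_def partial_order_on_def antisym_def by blast
  have le: "(x, s i) \<in> leq ?S \<longleftrightarrow> j = i \<or> (j, i) \<in> leq I" if "i \<in> univ I" "j \<in> univ I" "x \<in> univ (X j)" for i j x
    using leq_lex_sum[OF df that(2,1,3), of "s i"] s that by auto
  have ps: "block I ?S s i = univ (X i)" if i: "i \<in> univ I" for i
  proof
    show "univ (X i) \<subseteq> block I ?S s i"
    proof
      fix x assume x: "x \<in> univ (X i)"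
      have "(x, s j) \<notin> leq ?S" if "j \<in> univ I" "(j, i) \<in> leq I" "j \<noteq> i" for j
        using le[OF that(1) i x] anti that by blast
      then show "x \<in> block I ?S s i" using le[OF i i x] i x by (auto simp: block_def univ_lex_sum)
    qed
    show "block I ?S s i \<subseteq> univ (X i)"
    proof
      fix x assume x: "x \<in> block I ?S s i"
      then obtain j where j: "j \<in> univ I" "x \<in> univ (X j)" by (auto simp: block_def univ_lex_sum)
      have "(x, s i) \<in> leq ?S" using x by (simp add: block_def)
      then have "j = i \<or> (j, i) \<in> leq I" using le[OF i j] by simp
      moreover have "(x, s j) \<in> leq ?S" using le[OF j(1) j] by simp
      ultimately have "j = i" using x j by (auto simp: block_def)
      then show "x \<in> univ (X i)" using j by simp
    qed
  qed
  show "decomposes I ?S s"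
    unfolding decomposes_def
  proof (intro conjI ballI impI)
    show "s i \<in> block I ?S s i" if "i \<in> univ I" for i using ps[OF that] s[OF that] by simp
    show "\<exists>i\<in>univ I. x \<in> block I ?S s i" if "x \<in> univ ?S" for x
      using that ps by (auto simp: univ_lex_sum)
    fix i j x y assume ij: "i \<in> univ I" "j \<in> univ I" "i \<noteq> j" and xy: "x \<in> block I ?S s i" "y \<in> block I ?S s j"
    then have xy': "x \<in> univ (X i)" "y \<in> univ (X j)" using ps by auto
    then show "x \<noteq> y" using disj_fam_unique[OF df ij(1,2)] ij(3) by blast
    show "(x, y) \<in> leq ?S \<longleftrightarrow> (i, j) \<in> leq I" using leq_lex_sum[OF df ij(1,2) xy'] ij(3) by simp
  qed
  fix i assume i: "i \<in> univ I"
  have "leq (X i) \<subseteq> univ (X i) \<times> univ (X i)" using df i by (auto simp: disj_fam_def is_struc_def)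
  moreover have "(x, y) \<in> leq ?S \<longleftrightarrow> (x, y) \<in> leq (X i)" if "x \<in> univ (X i)" "y \<in> univ (X i)" for x y
    using leq_lex_sum[OF df i i that] by simp
  ultimately have "leq ?S \<inter> univ (X i) \<times> univ (X i) = leq (X i)" by auto
  then show "summand I ?S s i = X i" using ps[OF i] by (simp add: summand_def substruc_def)
qed

section \<open>Summands and sums under isomorphisms\<close>

lemma summand_iso:
  assumes f: "iso_map f M N" and s: "asg M s"
  shows "iso_map f (summand I M s i) (summand I N (f \<circ> s) i)"
proof -
  have le: "(f x, f y) \<in> leq N \<longleftrightarrow> (x, y) \<in> leq M" if "x \<in> univ M" "y \<in> univ M" for x y
    using f that by (auto simp: iso_map_def)
  have sv: "s v \<in> univ M" for v using s by auto
  have fp: "f x \<in> block I N (f \<circ> s) i \<longleftrightarrow> x \<in> block I M s i" if "x \<in> univ M" for x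
    using that le[OF that sv] f by (auto simp: block_def iso_map_def bij_betw_def)
  have sub: "block I M s i \<subseteq> univ M" by (auto simp: block_def)
  have UN: "univ N = f ` univ M" using f by (auto simp: iso_map_def bij_betw_def)
  have "block I N (f \<circ> s) i \<subseteq> f ` univ M" unfolding UN[symmetric] by (auto simp: block_def)
  then have im: "f ` block I M s i = block I N (f \<circ> s) i" using fp sub by blast
  moreover have "inj_on f (block I M s i)"
    using f sub inj_on_subset by (auto simp: iso_map_def bij_betw_def)
  ultimately have "bij_betw f (block I M s i) (block I N (f \<circ> s) i)" by (simp add: bij_betw_def)
  moreover have "(x, y) \<in> leq M \<longleftrightarrow> (f x, f y) \<in> leq N" if "x \<in> block I M s i" "y \<in> block I M s i" for x y
    using le sub that by blast
  ultimately show ?thesis using im unfolding iso_map_def by (auto simp: summand_def)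
qed

lemma lex_sum_iso:
  assumes X: "disj_fam I X" and Y: "disj_fam I Y" and iso: "\<And>i. i \<in> univ I \<Longrightarrow> isomorphic (X i) (Y i)"
  shows "isomorphic (lex_sum I X) (lex_sum I Y)"
proof -
  have "\<forall>i\<in>univ I. \<exists>f. iso_map f (X i) (Y i)" using iso by (simp add: isomorphic_iff)
  from bchoice[OF this] obtain f where f: "\<And>i. i \<in> univ I \<Longrightarrow> iso_map (f i) (X i) (Y i)" by blast
  define c where "c x = (THE i. i \<in> univ I \<and> x \<in> univ (X i))" for x
  have c: "c x = i" if "i \<in> univ I" "x \<in> univ (X i)" for x i
    unfolding c_def by (rule the_equality) (use disj_fam_unique[OF X] that in auto)
  define F where "F x = f (c x) x" for x
  have F: "F x = f i x" if "i \<in> univ I" "x \<in> univ (X i)" for x i using c[OF that] by (simp add: F_def)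
  have im: "f i ` univ (X i) = univ (Y i)" "inj_on (f i) (univ (X i))" if "i \<in> univ I" for i
    using f[OF that] by (auto simp: iso_map_def bij_betw_def)
  have FY: "F x \<in> univ (Y i)" if "i \<in> univ I" "x \<in> univ (X i)" for x i
    using F[OF that] im(1)[OF that(1)] that(2) by auto
  have "F ` univ (lex_sum I X) = univ (lex_sum I Y)"
  proof
    show "F ` univ (lex_sum I X) \<subseteq> univ (lex_sum I Y)" using FY by (auto simp: univ_lex_sum)
    show "univ (lex_sum I Y) \<subseteq> F ` univ (lex_sum I X)"
    proof
      fix y assume "y \<in> univ (lex_sum I Y)"
      then obtain i where i: "i \<in> univ I" "y \<in> univ (Y i)" by (auto simp: univ_lex_sum)
      then obtain x where "x \<in> univ (X i)" "y = f i x" using im(1)[OF i(1)] by auto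
      then show "y \<in> F ` univ (lex_sum I X)" using F[OF i(1)] i(1) by (auto simp: univ_lex_sum image_iff intro!: bexI[of _ x])
    qed
  qed
  moreover have "inj_on F (univ (lex_sum I X))"
  proof
    fix x y assume x: "x \<in> univ (lex_sum I X)" and y: "y \<in> univ (lex_sum I X)" and eq: "F x = F y"
    obtain i j where i: "i \<in> univ I" "x \<in> univ (X i)" and j: "j \<in> univ I" "y \<in> univ (X j)"
      using x y by (auto simp: univ_lex_sum)
    have "i = j" by (rule disj_fam_unique[OF Y i(1) j(1) FY[OF i]]) (use FY[OF j] eq in simp)
    then show "x = y" using eq F[OF i] F[OF j] im(2)[OF i(1)] i j by (simp add: inj_on_eq_iff)
  qed
  moreover have "(x, y) \<in> leq (lex_sum I X) \<longleftrightarrow> (F x, F y) \<in> leq (lex_sum I Y)"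
    if x: "x \<in> univ (lex_sum I X)" and y: "y \<in> univ (lex_sum I X)" for x y
  proof -
    obtain i j where i: "i \<in> univ I" "x \<in> univ (X i)" and j: "j \<in> univ I" "y \<in> univ (X j)"
      using x y by (auto simp: univ_lex_sum)
    have "(x, y) \<in> leq (X i) \<longleftrightarrow> (F x, F y) \<in> leq (Y i)" if "i = j"
      using f[OF i(1)] i j that F[OF i] F[OF j] by (simp add: iso_map_def)
    then show ?thesis
      using leq_lex_sum[OF X i(1) j(1) i(2) j(2)] leq_lex_sum[OF Y i(1) j(1) FY[OF i] FY[OF j]] by simp
  qed
  ultimately have "iso_map F (lex_sum I X) (lex_sum I Y)" by (simp add: iso_map_def bij_betw_def)
  then show ?thesis unfolding isomorphic_iff by blast
qed

subsection \<open>Counting isomorphism classes\<close>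

definition iso_class :: "nat struc \<Rightarrow> nat struc set" where
  "iso_class N = iso_rel `` {N}"

definition Mods :: "fm set \<Rightarrow> nat struc set" where
  "Mods T = {N. is_model N T}"

lemma num_models_iso_class: "num_models T = |iso_class ` Mods T|"
  by (simp add: num_models_def quotient_def iso_class_def Mods_def UNION_singleton_eq_range)

lemma iso_class_eq_iff: "is_struc N \<Longrightarrow> is_struc N' \<Longrightarrow> iso_class N = iso_class N' \<longleftrightarrow> isomorphic N N'"
  unfolding iso_class_def iso_rel_def using isomorphic_refl isomorphic_sym isomorphic_trans by blast

lemma Mods_Th_iff: "is_struc M \<Longrightarrow> N \<in> Mods (Th M) \<longleftrightarrow> is_struc N \<and> Th N = Th M"
  by (simp add: Mods_def model_Th_iff)

lemma continuum_card: "continuum = |UNIV :: (nat \<Rightarrow> bool) set|"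
  by (simp add: continuum_def cexp_def ctwo_def Field_natLeq Func_def Field_card_of)

lemma card_nat_struc: "|A :: nat struc set| \<le>o continuum"
proof -
  \<comment> \<open>Even positions record the universe, odd positions the relation through the
    pairing function.\<close>
  define g :: "nat struc \<Rightarrow> nat \<Rightarrow> bool" where
    "g M k = (if even k then k div 2 \<in> univ M else prod_decode (k div 2) \<in> leq M)" for M k
  have "inj_on g A"
  proof
    fix M N assume eq: "g M = g N"
    have "x \<in> univ M \<longleftrightarrow> x \<in> univ N" for x using fun_cong[OF eq, of "2 * x"] by (simp add: g_def)
    moreover have "(x, y) \<in> leq M \<longleftrightarrow> (x, y) \<in> leq N" for x y
      using fun_cong[OF eq, of "Suc (2 * prod_encode (x, y))"] by (simp add: g_def)
    ultimately have "univ M = univ N" "leq M = leq N" by auto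
    then show "M = N" by simp
  qed
  then show ?thesis unfolding continuum_card using card_of_ordLeq[of A UNIV] by blast
qed

lemma num_models_le_continuum: "num_models T \<le>o continuum"
  unfolding num_models_iso_class using ordLeq_transitive[OF card_of_image card_nat_struc] .

lemma card_countable_iff: "|A| \<le>o natLeq \<longleftrightarrow> countable A"
proof -
  have "|A| \<le>o natLeq \<longleftrightarrow> |A| \<le>o |UNIV :: nat set|"
    using ordLeq_ordIso_trans[OF _ card_of_nat] ordLeq_ordIso_trans[OF _ ordIso_symmetric[OF card_of_nat]] by blast
  also have "\<dots> \<longleftrightarrow> countable A" unfolding countable_def card_of_ordLeq[symmetric] by simp
  finally show ?thesis .
qed

text \<open>Pairing a value with the number of the point inside its countable fibre embeds
  \<open>A\<close> into \<open>B \<times> UNIV\<close>, and a factor of countable size does not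
  enlarge the infinite set \<open>B\<close>.\<close>

lemma countable_to_one_continuum:
  fixes f :: "'x \<Rightarrow> 'y"
  assumes A: "continuum \<le>o |A|" and f: "f ` A \<subseteq> B" and B: "|B| \<le>o continuum"
    and fib: "\<And>a. a \<in> A \<Longrightarrow> countable {a' \<in> A. f a' = f a}"
  shows "|B| =o continuum"
proof -
  define h where "h a = (f a, to_nat_on {a' \<in> A. f a' = f a} a)" for a
  have "inj_on h A"
  proof
    fix a b assume ab: "a \<in> A" "b \<in> A" and eq: "h a = h b"
    have e: "f a = f b" using eq by (simp add: h_def)
    have "to_nat_on {a' \<in> A. f a' = f a} a = to_nat_on {a' \<in> A. f a' = f a} b" using eq e by (simp add: h_def)
    then show "a = b" using inj_on_to_nat_on[OF fib[OF ab(1)]] ab e by (simp add: inj_on_def)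
  qed
  moreover have "h ` A \<subseteq> B \<times> (UNIV :: nat set)" using f by (auto simp: h_def)
  ultimately have "|A| \<le>o |B \<times> (UNIV :: nat set)|" using card_of_ordLeq by blast
  with A have le: "continuum \<le>o |B \<times> (UNIV :: nat set)|" by (rule ordLeq_transitive)
  have "infinite B"
  proof
    assume "finite B"
    then have "countable (B \<times> (UNIV :: nat set))" by (simp add: countable_finite)
    moreover obtain g :: "(nat \<Rightarrow> bool) \<Rightarrow> 'y \<times> nat" where "inj g" "range g \<subseteq> B \<times> UNIV"
      using le unfolding continuum_card using card_of_ordLeq[of "UNIV :: (nat \<Rightarrow> bool) set" "B \<times> (UNIV :: nat set)"] by blast
    ultimately have "countable (UNIV :: (nat \<Rightarrow> bool) set)" by (meson countable_image_inj_on countable_subset)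
    then show False using uncountable_nat_bool by blast
  qed
  then have "|B \<times> (UNIV :: nat set)| =o |B|"
    using card_of_Times_infinite[of B "UNIV :: nat set"] infinite_iff_card_of_nat by blast
  with le have "continuum \<le>o |B|" by (rule ordLeq_ordIso_trans)
  with B show ?thesis by (simp add: ordIso_iff_ordLeq)
qed

section \<open>Many types give many countable models\<close>

lemma countable_realized:
  fixes N :: "nat struc"
  shows "countable {tp n N s | s. asg N s}"
proof (rule countable_subset)
  show "{tp n N s | s. asg N s} \<subseteq> (\<lambda>xs. tp n N (\<lambda>i. xs ! i)) ` UNIV"
  proof
    fix p assume "p \<in> {tp n N s | s. asg N s}"
    then obtain s where "p = tp n N s" by blast
    also have "\<dots> = tp n N (\<lambda>i. map s [0..<n] ! i)" by (rule tp_cong) simp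
    finally show "p \<in> (\<lambda>xs. tp n N (\<lambda>i. xs ! i)) ` UNIV" by blast
  qed
qed simp

lemma types_realized_iso:
  fixes N N' :: "nat struc"
  assumes "isomorphic N N'" "asg N s"
  shows "tp n N s \<in> {tp n N' t | t. asg N' t}"
proof -
  obtain f where f: "iso_map f N N'" using assms(1) isomorphic_iff by blast
  have "tp n N s = tp n N' (f \<circ> s)" using tp_iso[OF f assms(2)] by simp
  then show ?thesis using iso_map_asg[OF f assms(2)] by blast
qed

text \<open>Formulas lying in uncountably many types always split into two such formulas. This is a
  Cantor-Bendixson argument, and it gives continuum many types rather than merely uncountably
  many.\<close>

lemma large_many_types:
  fixes M :: "'a struc"
  assumes M: "is_struc M" and unc: "uncountable (types n (Th M))"
  shows "continuum \<le>o |types n (Th M)|"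
proof -
  let ?T = "types n (Th M)"
  define S where "S \<phi> = {p \<in> ?T. \<phi> \<in> p}" for \<phi>
  define B where "B \<phi> \<longleftrightarrow> fv \<phi> \<subseteq> {..<n} \<and> uncountable (S \<phi>)" for \<phi>
  obtain s where s: "asg M s" using ex_asg M by blast
  have tpE: "\<exists>(N :: nat struc) t. Th N = Th M \<and> asg N t \<and> p = tp n N t" if "p \<in> ?T" for p
    using typesE[OF that M] by metis
  have conj: "Conj \<phi> \<psi> \<in> p \<longleftrightarrow> \<phi> \<in> p \<and> \<psi> \<in> p" if "p \<in> ?T" for p \<phi> \<psi>
    using tpE[OF that] by (auto simp: tp_def)
  have neg: "Neg \<phi> \<in> p \<longleftrightarrow> \<phi> \<notin> p" if "p \<in> ?T" "fv \<phi> \<subseteq> {..<n}" for p \<phi>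
    using tpE[OF that(1)] that(2) by (auto simp: tp_def)
  have pf: "fv \<phi> \<subseteq> {..<n}" if "p \<in> ?T" "\<phi> \<in> p" for p \<phi>
    using tpE[OF that(1)] that(2) by (auto simp: tp_def)
  have B1: "fv \<phi> \<subseteq> {..<n} \<and> (\<exists>t. asg M t \<and> (\<forall>i<0. t i = s i) \<and> sat M t \<phi>)" if \<phi>: "B \<phi>" for \<phi>
  proof -
    have "S \<phi> \<noteq> {}" using \<phi> by (auto simp: B_def)
    then obtain p where p: "p \<in> ?T" "\<phi> \<in> p" by (auto simp: S_def)
    obtain N :: "nat struc" and t where N: "Th N = Th M" "asg N t" "p = tp n N t" using tpE[OF p(1)] by blast
    have "\<forall>\<psi>\<in>{\<phi>}. sat N t \<psi>" using p(2) N(3) by (simp add: tp_def)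
    from Th_transfer[OF N(1) M N(2) _ this] show ?thesis using \<phi> by (auto simp: B_def)
  qed
  have B2: "\<exists>\<psi>. B (Conj \<phi> \<psi>) \<and> B (Conj \<phi> (Neg \<psi>))" if \<phi>: "B \<phi>" for \<phi>
  proof (rule ccontr)
    assume no: "\<not> ?thesis"
    \<comment> \<open>If nothing splits, each \<open>\<psi>\<close> has a side shared by only
      countably many types containing \<open>\<phi>\<close>. A type other than \<open>q\<close> lies
      on such a small side for some \<open>\<psi>\<close>, and there are only countably many
      \<open>\<psi>\<close>.\<close>
    define q where "q = {\<psi>. fv \<psi> \<subseteq> {..<n} \<and> uncountable (S (Conj \<phi> \<psi>))}"
    define E where "E \<psi> = (if \<psi> \<in> q then S (Conj \<phi> (Neg \<psi>)) else S (Conj \<phi> \<psi>))" for \<psi>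
    have cE: "countable (E \<psi>)" if "fv \<psi> \<subseteq> {..<n}" for \<psi>
    proof -
      have "fv \<phi> \<subseteq> {..<n}" using \<phi> by (simp add: B_def)
      then show ?thesis using no that by (auto simp: E_def q_def B_def)
    qed
    have "S \<phi> \<subseteq> insert q (\<Union>\<psi>\<in>{\<psi>. fv \<psi> \<subseteq> {..<n}}. E \<psi>)"
    proof
      fix p assume p: "p \<in> S \<phi>"
      then have pT: "p \<in> ?T" "\<phi> \<in> p" by (auto simp: S_def)
      show "p \<in> insert q (\<Union>\<psi>\<in>{\<psi>. fv \<psi> \<subseteq> {..<n}}. E \<psi>)"
      proof (cases "p = q")
        case False
        then obtain \<psi> where \<psi>: "(\<psi> \<in> p) \<noteq> (\<psi> \<in> q)" by blast
        have f: "fv \<psi> \<subseteq> {..<n}" using \<psi> pf[OF pT(1)] by (auto simp: q_def)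
        have "p \<in> E \<psi>" using \<psi> pT conj[OF pT(1)] neg[OF pT(1) f] by (auto simp: E_def S_def)
        then show ?thesis using f by blast
      qed simp
    qed
    moreover have "countable (insert q (\<Union>\<psi>\<in>{\<psi>. fv \<psi> \<subseteq> {..<n}}. E \<psi>))"
      by (intro countable_insert countable_UN[OF countableI_type]) (use cE in simp)
    ultimately have "countable (S \<phi>)" by (rule countable_subset)
    then show False using \<phi> by (simp add: B_def)
  qed
  have "Ex 0 (Eq 0 0) \<in> p" if "p \<in> ?T" for p
    using tpE[OF that] by (auto simp: tp_def)
  then have "S (Ex 0 (Eq 0 0)) = ?T" by (auto simp: S_def)
  then have B0: "B (Ex 0 (Eq 0 0))" using unc by (simp add: B_def)
  obtain g :: "(nat \<Rightarrow> bool) \<Rightarrow> fm set" where "inj g" "range g \<subseteq> types n (Th M)"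
    using splitting_many_types[of M s B n 0, OF M s B1 B2 B0] by blast
  then show ?thesis unfolding continuum_card using card_of_ordLeq[of "UNIV :: (nat \<Rightarrow> bool) set"] by blast
qed

text \<open>Sending each type to a chosen model realizing it is countable-to-one up to
  isomorphism.\<close>

lemma large_num_models:
  fixes M :: "'a struc"
  assumes M: "is_struc M" and l: "\<not> small (Th M)"
  shows "num_models (Th M) =o continuum"
proof -
  obtain n where n: "uncountable (types n (Th M))" using l by (auto simp: small_def)
  have "\<forall>p\<in>types n (Th M). \<exists>N :: nat struc. N \<in> Mods (Th M) \<and> p \<in> {tp n N t | t. asg N t}"
  proof
    fix p assume p: "p \<in> types n (Th M)"
    obtain N :: "nat struc" and t where "is_struc N" "Th N = Th M" "asg N t" "p = tp n N t"
      using typesE[OF p M] by blast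
    then show "\<exists>N :: nat struc. N \<in> Mods (Th M) \<and> p \<in> {tp n N t | t. asg N t}"
      using Mods_Th_iff[OF M, of N] by blast
  qed
  from bchoice[OF this] obtain N where
    N0: "\<forall>p\<in>types n (Th M). N p \<in> Mods (Th M) \<and> p \<in> {tp n (N p) t | t. asg (N p) t}" by (elim exE)
  note N = bspec[OF N0, THEN conjunct1] bspec[OF N0, THEN conjunct2]
  show ?thesis unfolding num_models_iso_class
  proof (rule countable_to_one_continuum[where f="\<lambda>p. iso_class (N p)", OF large_many_types[OF M n]])
    show "(\<lambda>p. iso_class (N p)) ` types n (Th M) \<subseteq> iso_class ` Mods (Th M)" using N(1) by blast
    show "|iso_class ` Mods (Th M)| \<le>o continuum" using num_models_le_continuum[of "Th M"] by (simp add: num_models_iso_class)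
    fix a assume a: "a \<in> types n (Th M)"
    have "{p \<in> types n (Th M). iso_class (N p) = iso_class (N a)} \<subseteq> {tp n (N a) t | t. asg (N a) t}"
    proof
      fix p assume p: "p \<in> {p \<in> types n (Th M). iso_class (N p) = iso_class (N a)}"
      then have iso: "isomorphic (N p) (N a)"
        using iso_class_eq_iff[of "N p" "N a"] N(1) a Mods_Th_iff[OF M] by blast
      have "p \<in> {tp n (N p) t | t. asg (N p) t}" by (rule N(2)) (use p in simp)
      then obtain t where t: "asg (N p) t" "p = tp n (N p) t" by (elim CollectE exE conjE)
      have "tp n (N p) t \<in> {tp n (N a) t | t. asg (N a) t}" by (rule types_realized_iso[OF iso t(1)])
      then show "p \<in> {tp n (N a) t | t. asg (N a) t}" by (simp only: t(2)[symmetric])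
    qed
    then show "countable {p \<in> types n (Th M). iso_class (N p) = iso_class (N a)}"
      by (rule countable_subset[OF _ countable_realized])
  qed
qed

lemma cone_singleton: "|A| =o cone \<longleftrightarrow> (\<exists>x. A = {x})"
proof
  assume "|A| =o cone"
  then obtain f where "bij_betw f A {()}" unfolding cone_def using card_of_ordIso by blast
  then have "card A = 1" using bij_betw_same_card[of f A "{()}"] by simp
  then show "\<exists>x. A = {x}" by (rule card_1_singletonE) blast
next
  assume "\<exists>x. A = {x}"
  then obtain x where "A = {x}" by blast
  then have "bij_betw (\<lambda>_. ()) A {()}" by (simp add: bij_betw_def)
  then show "|A| =o cone" unfolding cone_def using card_of_ordIso by blast
qed

text \<open>The Ryll-Nardzewski theorem, with finite structures included. A unique countable model
  realizes all types, so the theory is small; infinite type spaces would then give non-isomorphic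
  models.\<close>

lemma num_models_cone_iff:
  fixes M :: "'a struc"
  assumes M: "is_struc M"
  shows "num_models (Th M) =o cone \<longleftrightarrow> fin_types (Th M)"
proof
  assume "num_models (Th M) =o cone"
  then obtain c where c: "iso_class ` Mods (Th M) = {c}" unfolding num_models_iso_class cone_singleton by blast
  have iso: "isomorphic N N'" if "N \<in> Mods (Th M)" "N' \<in> Mods (Th M)" for N N'
  proof -
    have "iso_class N = iso_class N'" using c that by blast
    then show ?thesis using iso_class_eq_iff that Mods_Th_iff[OF M] by blast
  qed
  have "small (Th M)"
    unfolding small_def
  proof
    fix n
    obtain N :: "nat struc" where N: "is_struc N" "Th N = Th M" using nat_model_of[OF M] by metis
    have "types n (Th M) \<subseteq> {tp n N t | t. asg N t}"
    proof
      fix p assume p: "p \<in> types n (Th M)"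
      obtain K :: "nat struc" and t where K: "is_struc K" "Th K = Th M" "asg K t" "p = tp n K t"
        using typesE[OF p M] by blast
      have "isomorphic K N" by (rule iso) (use K N Mods_Th_iff[OF M] in auto)
      then show "p \<in> {tp n N t | t. asg N t}" unfolding K(4) by (rule types_realized_iso[OF _ K(3)])
    qed
    then show "countable (types n (Th M))" by (rule countable_subset[OF _ countable_realized])
  qed
  show "fin_types (Th M)"
  proof (rule ccontr)
    assume "\<not> fin_types (Th M)"
    then obtain A B C :: "nat struc" where "is_model A (Th M)" "is_model B (Th M)" "\<not> isomorphic A B"
      using three_models[OF M \<open>small (Th M)\<close>] by blast
    then show False using iso by (simp add: Mods_def)
  qed
next
  assume f: "fin_types (Th M)"
  obtain N :: "nat struc" where N: "is_struc N" "Th N = Th M" using nat_model_of[OF M] by metis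
  have "iso_class K = iso_class N" if "K \<in> Mods (Th M)" for K
    using that Mods_Th_iff[OF M] iso_class_eq_iff fin_types_categorical[OF M f _ _ N] N by metis
  moreover have "N \<in> Mods (Th M)" using N Mods_Th_iff[OF M] by blast
  ultimately have "iso_class ` Mods (Th M) = {iso_class N}" by blast
  then show "num_models (Th M) =o cone" unfolding num_models_iso_class cone_singleton by blast
qed

lemma three_le_num_models:
  fixes M :: "'a struc"
  assumes M: "is_struc M" and sm: "small (Th M)" and nf: "\<not> fin_types (Th M)"
  shows "natLeq_on 3 \<le>o num_models (Th M)"
proof -
  obtain A B C :: "nat struc" where m: "is_model A (Th M)" "is_model B (Th M)" "is_model C (Th M)"
    and n: "\<not> isomorphic A B" "\<not> isomorphic A C" "\<not> isomorphic B C"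
    using three_models[OF M sm nf] by blast
  have st: "is_struc A" "is_struc B" "is_struc C" using m by (auto simp: is_model_def)
  define f where "f = (\<lambda>i::nat. if i = 0 then iso_class A else if i = 1 then iso_class B else iso_class C)"
  have d: "iso_class A \<noteq> iso_class B" "iso_class A \<noteq> iso_class C" "iso_class B \<noteq> iso_class C" using n st iso_class_eq_iff by blast+
  have lt: "x < 3 \<longleftrightarrow> x = 0 \<or> x = 1 \<or> x = 2" for x :: nat by auto
  have "inj_on f {x. x < 3}" using d by (auto simp: inj_on_def f_def lt)
  moreover have "f ` {x. x < 3} \<subseteq> iso_class ` Mods (Th M)" using m by (auto simp: f_def Mods_def)
  ultimately have "|{x::nat. x < 3}| \<le>o num_models (Th M)" unfolding num_models_iso_class using card_of_ordLeq by blast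
  moreover have "natLeq_on 3 =o |{x::nat. x < 3}|"
    by (rule finite_well_order_on_ordIso[OF _ natLeq_on_well_order_on card_of_well_order_on]) simp
  ultimately show ?thesis using ordIso_ordLeq_trans by blast
qed

text \<open>Single sentences for being a partial order and for having a largest element let a
  summand be exchanged for an elementarily equivalent one.\<close>

definition order_fm :: fm where
  "order_fm = Conj (Neg (Ex 0 (Neg (Le 0 0))))
     (Conj (Neg (Ex 0 (Ex 1 (Conj (Conj (Le 0 1) (Le 1 0)) (Neg (Eq 0 1))))))
       (Neg (Ex 0 (Ex 1 (Ex 2 (Conj (Conj (Le 0 1) (Le 1 2)) (Neg (Le 0 2))))))))"

definition largest_fm :: fm where
  "largest_fm = Ex 0 (Neg (Ex 1 (Neg (Le 1 0))))"

lemma sat_order_fm: assumes "is_struc M" shows "sat M s order_fm \<longleftrightarrow> poset M"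
proof -
  have sub: "leq M \<subseteq> univ M \<times> univ M" using assms by (simp add: is_struc_def)
  have "sat M s order_fm \<longleftrightarrow> (\<forall>x\<in>univ M. (x, x) \<in> leq M) \<and>
    (\<forall>x\<in>univ M. \<forall>y\<in>univ M. (x, y) \<in> leq M \<longrightarrow> (y, x) \<in> leq M \<longrightarrow> x = y) \<and>
    (\<forall>x\<in>univ M. \<forall>y\<in>univ M. \<forall>z\<in>univ M. (x, y) \<in> leq M \<longrightarrow> (y, z) \<in> leq M \<longrightarrow> (x, z) \<in> leq M)"
    by (simp add: order_fm_def) blast
  also have "\<dots> \<longleftrightarrow> poset M"
    using assms sub unfolding poset_def partial_order_on_def preorder_on_def refl_on_def antisym_def trans_def
    by blast
  finally show ?thesis .
qed

lemma sat_largest_fm: "sat M s largest_fm \<longleftrightarrow> has_largest M"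
  by (simp add: largest_fm_def has_largest_def)

lemma Th_poset:
  assumes "Th M = Th N" "is_struc M" "is_struc N"
  shows "poset M \<longleftrightarrow> poset N" "has_largest M \<longleftrightarrow> has_largest N"
proof -
  obtain s t where st: "asg M s" "asg N t" using ex_asg assms by metis
  have "sentence order_fm" "sentence largest_fm" by (auto simp: sentence_def order_fm_def largest_fm_def)
  then show "poset M \<longleftrightarrow> poset N" "has_largest M \<longleftrightarrow> has_largest N"
    using Th_eq_sat[OF assms(1) st] sat_order_fm assms(2,3) sat_largest_fm by metis+
qed

lemma decomposition_tops:
  assumes D: "fld1_decomposition I X"
  obtains s where "asg (lex_sum I X) s"
    "\<And>i. i \<in> univ I \<Longrightarrow> s i \<in> univ (X i) \<and> (\<forall>x\<in>univ (X i). (x, s i) \<in> leq (X i))"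
proof -
  have "\<forall>i\<in>univ I. \<exists>m. m \<in> univ (X i) \<and> (\<forall>x\<in>univ (X i). (x, m) \<in> leq (X i))"
    using D unfolding fld1_decomposition_def has_largest_def by blast
  from bchoice[OF this] obtain m where m: "\<And>i. i \<in> univ I \<Longrightarrow> m i \<in> univ (X i) \<and> (\<forall>x\<in>univ (X i). (x, m i) \<in> leq (X i))"
    by blast
  \<comment> \<open>Assignments are total, so variables outside the index set also need a
    value.\<close>
  obtain i0 where i0: "i0 \<in> univ I" using D by (auto simp: fld1_decomposition_def poset_def is_struc_def)
  show thesis
  proof (rule that[of "\<lambda>i. if i \<in> univ I then m i else m i0"])
    show "asg (lex_sum I X) (\<lambda>i. if i \<in> univ I then m i else m i0)"
      using m i0 by (auto simp: univ_lex_sum)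
  qed (use m in simp)
qed

lemma decomposition_index:
  assumes "fld1_decomposition I X"
  obtains K where "finite (univ I)" "is_struc I" "poset I" "univ I \<subseteq> {..<K}"
  using assms finite_nat_set_iff_bounded[of "univ I"] by (auto simp: fld1_decomposition_def poset_def)

text \<open>All summands except number \<open>i0\<close> are kept fixed, and the latter runs through
  its countable models. The map to isomorphism classes of sums is shown to be countable-to-one by
  recovering the varied summand from a finite tuple of the sum.\<close>

lemma summand_continuum:
  fixes X :: "nat \<Rightarrow> 'a struc"
  assumes D: "fld1_decomposition I X" and i0: "i0 \<in> univ I" and c: "num_models_of (X i0) =o continuum"
  shows "num_models (Th (lex_sum I X)) =o continuum"
proof -
  let ?T = "Th (lex_sum I X)"
  obtain K where I: "finite (univ I)" "is_struc I" "poset I" "univ I \<subseteq> {..<K}" using decomposition_index[OF D] by blast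
  have df: "disj_fam I X" by (rule decomposition_disj_fam[OF D])
  have sX: "is_struc (X i)" if "i \<in> univ I" for i using df that by (simp add: disj_fam_def)
  have sS: "is_struc (lex_sum I X)" by (rule is_struc_lex_sum[OF df I(2)])
  have "\<forall>i\<in>univ I. \<exists>W :: nat struc. is_struc W \<and> Th W = Th (X i)" using nat_model_of[OF sX] by metis
  from bchoice[OF this] obtain W :: "nat \<Rightarrow> nat struc" where W: "\<And>i. i \<in> univ I \<Longrightarrow> is_struc (W i) \<and> Th (W i) = Th (X i)" by blast
  let ?A = "iso_class ` Mods (Th (X i0))"
  define Y where "Y C = inv_into (Mods (Th (X i0))) iso_class C" for C
  have Y: "Y C \<in> Mods (Th (X i0))" "iso_class (Y C) = C" if "C \<in> ?A" for C
    using that by (simp_all add: Y_def inv_into_into f_inv_into_f)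
  have Y': "is_struc (Y C)" "Th (Y C) = Th (X i0)" if "C \<in> ?A" for C
    using Y(1)[OF that] Mods_Th_iff[OF sX[OF i0]] by auto
  \<comment> \<open>Tagging each element with its index makes the exchanged summands
    disjoint.\<close>
  define e where "e j x = prod_encode (j, x)" for j x :: nat
  define V where "V C j = image_struc (e j) (if j = i0 then Y C else W j)" for C j
  have ie: "inj_on (e j) Z" for j Z by (auto simp: e_def inj_on_def)
  have V: "is_struc (V C j)" "Th (V C j) = Th (X j)" "isomorphic (if j = i0 then Y C else W j) (V C j)"
    if C: "C \<in> ?A" "j \<in> univ I" for C j
  proof -
    have 1: "is_struc (if j = i0 then Y C else W j)" using Y'[OF C(1)] W[OF C(2)] by simp
    show "is_struc (V C j)" unfolding V_def by (rule is_struc_image_struc[OF 1])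
    have 2: "iso_map (e j) (if j = i0 then Y C else W j) (V C j)" unfolding V_def by (rule iso_map_image_struc[OF 1 ie])
    then show "isomorphic (if j = i0 then Y C else W j) (V C j)" using isomorphic_iff by blast
    show "Th (V C j) = Th (X j)" using Th_iso[OF 1 2] Y'[OF C(1)] W[OF C(2)] by simp
  qed
  have DV: "fld1_decomposition I (V C)" if C: "C \<in> ?A" for C
    unfolding fld1_decomposition_def
  proof (intro conjI ballI I)
    fix i assume i: "i \<in> univ I"
    show "poset (V C i)" "has_largest (V C i)"
      using Th_poset[OF V(2)[OF C i] V(1)[OF C i] sX[OF i]] D i by (auto simp: fld1_decomposition_def)
  next
    show "disjoint_family_on (\<lambda>i. univ (V C i)) (univ I)"
      by (auto simp: disjoint_family_on_def V_def e_def)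
  qed
  define Z where "Z C = lex_sum I (V C)" for C
  have Z: "is_struc (Z C)" "Th (Z C) = ?T" if C: "C \<in> ?A" for C
    unfolding Z_def
    using is_struc_lex_sum[OF decomposition_disj_fam[OF DV[OF C]] I(2)]
      lex_sum_Th[OF I(1,2) decomposition_disj_fam[OF DV[OF C]] df V(2)[OF C]] by simp_all
  have "\<forall>C\<in>?A. \<exists>s. asg (Z C) s \<and> summand I (Z C) s i0 = V C i0"
  proof
    fix C assume C: "C \<in> ?A"
    obtain s where s: "asg (lex_sum I (V C)) s"
      "\<And>i. i \<in> univ I \<Longrightarrow> s i \<in> univ (V C i) \<and> (\<forall>x\<in>univ (V C i). (x, s i) \<in> leq (V C i))"
      using decomposition_tops[OF DV[OF C]] by blast
    have "summand I (lex_sum I (V C)) s i0 = V C i0" by (rule decomposition_decomposes(2)[OF DV[OF C] s(2) i0])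
    then show "\<exists>s. asg (Z C) s \<and> summand I (Z C) s i0 = V C i0" using s(1) unfolding Z_def by blast
  qed
  from bchoice[OF this] obtain s where s: "\<And>C. C \<in> ?A \<Longrightarrow> asg (Z C) (s C) \<and> summand I (Z C) (s C) i0 = V C i0" by blast
  have cA: "continuum \<le>o |?A|" using c unfolding num_models_of_def num_models_iso_class by (simp add: ordIso_iff_ordLeq)
  show ?thesis unfolding num_models_iso_class
  proof (rule countable_to_one_continuum[where f="\<lambda>C. iso_class (Z C)", OF cA])
    show "(\<lambda>C. iso_class (Z C)) ` ?A \<subseteq> iso_class ` Mods ?T"
    proof (rule image_subsetI)
      fix C assume C: "C \<in> ?A"
      have "Z C \<in> Mods ?T" using Mods_Th_iff[OF sS, of "Z C"] Z[OF C] by simp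
      then show "iso_class (Z C) \<in> iso_class ` Mods ?T" by (rule imageI)
    qed
    show "|iso_class ` Mods ?T| \<le>o continuum" using num_models_le_continuum[of ?T] by (simp add: num_models_iso_class)
    fix C0 assume C0: "C0 \<in> ?A"
    let ?F = "{C \<in> ?A. iso_class (Z C) = iso_class (Z C0)}"
    \<comment> \<open>An isomorphism onto \<open>Z C0\<close> carries the tuple defining the varied
      summand of \<open>Z C\<close> to a tuple of \<open>Z C0\<close>. Its first \<open>K\<close>
      entries determine the class \<open>C\<close>, and there are only countably many lists of
      numbers.\<close>
    have "\<forall>C\<in>?F. \<exists>t. isomorphic (Y C) (summand I (Z C0) t i0)"
    proof
      fix C assume "C \<in> ?F"
      then have C: "C \<in> ?A" "iso_class (Z C) = iso_class (Z C0)" by auto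
      obtain g where g: "iso_map g (Z C) (Z C0)"
        using iso_class_eq_iff[OF Z(1)[OF C(1)] Z(1)[OF C0]] C(2) isomorphic_iff by blast
      have "iso_map g (summand I (Z C) (s C) i0) (summand I (Z C0) (g \<circ> s C) i0)"
        by (rule summand_iso[OF g]) (use s[OF C(1)] in simp)
      then have "isomorphic (V C i0) (summand I (Z C0) (g \<circ> s C) i0)" using s[OF C(1)] isomorphic_iff by metis
      moreover have "isomorphic (Y C) (V C i0)" using V(3)[OF C(1) i0] by simp
      ultimately show "\<exists>t. isomorphic (Y C) (summand I (Z C0) t i0)" using isomorphic_trans by blast
    qed
    from bchoice[OF this] obtain t where t: "\<And>C. C \<in> ?F \<Longrightarrow> isomorphic (Y C) (summand I (Z C0) (t C) i0)" by blast
    have "inj_on (\<lambda>C. map (t C) [0..<K]) ?F"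
    proof
      fix C C' assume C: "C \<in> ?F" "C' \<in> ?F" and eq: "map (t C) [0..<K] = map (t C') [0..<K]"
      have "t C j = t C' j" if "j \<in> univ I" for j using eq that I(4) by auto
      then have "summand I (Z C0) (t C) i0 = summand I (Z C0) (t C') i0" by (rule summand_cong[OF _ i0])
      then have "isomorphic (Y C) (Y C')" using t[OF C(1)] t[OF C(2)] isomorphic_sym isomorphic_trans by metis
      then have "iso_class (Y C) = iso_class (Y C')" using iso_class_eq_iff Y'(1) C by blast
      then show "C = C'" using Y(2) C by simp
    qed
    then show "countable ?F" by (rule countableI')
  qed
qed

lemma decomposes_nonempty: "decomposes I M s \<Longrightarrow> i \<in> univ I \<Longrightarrow> block I M s i \<noteq> {}"
  unfolding decomposes_def by blast

text \<open>The premise \<open>cnt\<close> concerns only structures on \<open>'a\<close> with a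
  decomposing tuple whose summand satisfies \<open>\<tau> i\<close>, which matches what being
  actually Vaught's can provide.\<close>

lemma countably_many_models:
  fixes X :: "nat \<Rightarrow> 'a::infinite struc"
  assumes D: "fld1_decomposition I X" and sm: "small (Th (lex_sum I X))" and po: "poset (lex_sum I X)"
    and \<tau>: "\<And>i. i \<in> univ I \<Longrightarrow> \<tau> i \<in> Th (X i)"
    and cnt: "\<And>(M :: 'a struc) s i. is_struc M \<Longrightarrow> Th M = Th (lex_sum I X) \<Longrightarrow> asg M s \<Longrightarrow> decomposes I M s \<Longrightarrow>
       i \<in> univ I \<Longrightarrow> \<tau> i \<in> Th (summand I M s i) \<Longrightarrow> countable (iso_class ` Mods (Th (summand I M s i)))"
  shows "countable (iso_class ` Mods (Th (lex_sum I X)))"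
proof -
  let ?M = "lex_sum I X"
  obtain K where I: "finite (univ I)" "is_struc I" "poset I" "univ I \<subseteq> {..<K}" using decomposition_index[OF D] by blast
  have df: "disj_fam I X" by (rule decomposition_disj_fam[OF D])
  have sM: "is_struc ?M" by (rule is_struc_lex_sum[OF df I(2)])
  have sent: "sentence (\<tau> i)" if "i \<in> univ I" for i using \<tau>[OF that] by (simp add: Th_def)
  have reltau: "sat N s (relativize K I i (\<tau> i)) \<longleftrightarrow> \<tau> i \<in> Th (summand I N s i)"
    if "asg N s" "decomposes I N s" "i \<in> univ I" for N :: "'b struc" and s i
  proof -
    have "is_struc (summand I N s i)"
      unfolding summand_def by (rule is_struc_substruc[OF decomposes_nonempty[OF that(2,3)]])
    then obtain u where u: "asg (summand I N s i) u" using ex_asg by blast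
    have "fv (\<tau> i) \<subseteq> {..<0}" using sent[OF that(3)] by (simp add: sentence_def)
    then have f: "fv (relativize K I i (\<tau> i)) \<subseteq> {..<K}"
      using fv_relativize_bound[OF I(1,4) that(3), of "\<tau> i" 0] by simp
    have "sat N s (relativize K I i (\<tau> i)) = sat N (shift K s u) (relativize K I i (\<tau> i))"
      by (rule sat_cong) (use f in \<open>auto simp: shift_def\<close>)
    also have "\<dots> = sat (summand I N s i) u (\<tau> i)" by (rule sat_relativize_shift(2)[OF I(1,4) that(3,1) u])
    finally show ?thesis using Th_iff[OF u] sent[OF that(3)] by simp
  qed
  \<comment> \<open>The finite condition on the tuple that every countable model of the theory can
    satisfy.\<close>
  let ?F = "insert (decomp_fm K I) ((\<lambda>i. relativize K I i (\<tau> i)) ` univ I)"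
  obtain s0 where s0: "asg ?M s0"
    "\<And>i. i \<in> univ I \<Longrightarrow> s0 i \<in> univ (X i) \<and> (\<forall>x\<in>univ (X i). (x, s0 i) \<in> leq (X i))"
    using decomposition_tops[OF D] by blast
  have d0: "decomposes I ?M s0" by (rule decomposition_decomposes(1)[OF D s0(2)])
  have p0: "summand I ?M s0 i = X i" if "i \<in> univ I" for i by (rule decomposition_decomposes(2)[OF D s0(2) that])
  have "sat ?M s0 (relativize K I i (\<tau> i))" if "i \<in> univ I" for i
    using reltau[OF s0(1) d0 that] p0[OF that] \<tau>[OF that] by simp
  then have F0: "\<forall>\<phi>\<in>?F. sat ?M s0 \<phi>" using sat_decomp_fm[OF I(1,4) s0(1)] d0 by simp
  define G where "G N s \<longleftrightarrow> asg N s \<and> decomposes I N s \<and> (\<forall>i\<in>univ I. \<tau> i \<in> Th (summand I N s i))" for N :: "nat struc" and s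
  have "\<forall>N\<in>Mods (Th ?M). \<exists>s. G N s"
  proof
    fix N assume "N \<in> Mods (Th ?M)"
    then have N: "is_struc N" "Th ?M = Th N" using Mods_Th_iff[OF sM, of N] by simp_all
    have "finite ?F" using I(1) by simp
    from Th_transfer[OF N(2,1) s0(1) this F0] obtain s where s: "asg N s" "\<forall>\<phi>\<in>?F. sat N s \<phi>" by (elim exE conjE)
    have d: "decomposes I N s" using sat_decomp_fm[OF I(1,4) s(1)] s(2) by simp
    then have "G N s" using s reltau[OF s(1) d] by (simp add: G_def)
    then show "\<exists>s. G N s" by blast
  qed
  from bchoice[OF this] obtain S where S: "\<forall>N\<in>Mods (Th ?M). G N (S N)" by (elim exE)
  have N: "is_struc N" "Th N = Th ?M" "poset N" "asg N (S N)" "decomposes I N (S N)"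
    "\<And>i. i \<in> univ I \<Longrightarrow> \<tau> i \<in> Th (summand I N (S N) i)" if "N \<in> Mods (Th ?M)" for N
  proof -
    show 1: "is_struc N" "Th N = Th ?M" using Mods_Th_iff[OF sM, of N] that by simp_all
    show "poset N" using Th_poset(1)[OF 1(2) 1(1) sM] po by simp
    show "asg N (S N)" "decomposes I N (S N)" "\<And>i. i \<in> univ I \<Longrightarrow> \<tau> i \<in> Th (summand I N (S N) i)"
      using bspec[OF S that] by (auto simp: G_def)
  qed
  have sP: "is_struc (summand I N (S N) i)" if "N \<in> Mods (Th ?M)" "i \<in> univ I" for N i
    unfolding summand_def by (rule is_struc_substruc[OF decomposes_nonempty[OF N(5)[OF that(1)] that(2)]])
  have cN: "countable (iso_class ` Mods (Th (summand I N (S N) i)))" if NM: "N \<in> Mods (Th ?M)" and i: "i \<in> univ I" for N i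
  proof -
    \<comment> \<open>The countable model is copied to \<open>'a\<close>, with its tuple, in order
      to use \<open>cnt\<close>; the theory of the summand is unchanged.\<close>
    obtain f and M :: "'a struc" where M: "is_struc M" "iso_map f N M" using copy_to_infinite[OF N(1)[OF NM]] by blast
    let ?s = "f \<circ> S N"
    have s: "asg M ?s" by (rule iso_map_asg[OF M(2) N(4)[OF NM]])
    have "sat N (S N) (decomp_fm K I)" using sat_decomp_fm[OF I(1,4) N(4)[OF NM]] N(5)[OF NM] by simp
    then have d: "decomposes I M ?s" using sat_decomp_fm[OF I(1,4) s] sat_iso[OF M(2) N(4)[OF NM]] by simp
    have T: "Th (summand I M ?s i) = Th (summand I N (S N) i)"
      by (rule Th_iso[OF sP[OF NM i] summand_iso[OF M(2) N(4)[OF NM]]])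
    have "Th M = Th ?M" using Th_iso[OF N(1)[OF NM] M(2)] N(2)[OF NM] by simp
    from cnt[OF M(1) this s d i] N(6)[OF NM i] show ?thesis unfolding T by simp
  qed
  \<comment> \<open>For fixed \<open>p\<close> these summands are all elementarily equivalent, so
    their classes lie among the countable models of a single theory.\<close>
  define H where "H p i = iso_class ` {summand I N (S N) i | N. N \<in> Mods (Th ?M) \<and> tp K N (S N) = p}" for p i
  have cH: "countable (H p i)" if i: "i \<in> univ I" for p i
  proof (cases "\<exists>N0. N0 \<in> Mods (Th ?M) \<and> tp K N0 (S N0) = p")
    case True
    then obtain N0 where N0: "N0 \<in> Mods (Th ?M)" "tp K N0 (S N0) = p" by (elim exE conjE)
    have "summand I N (S N) i \<in> Mods (Th (summand I N0 (S N0) i))" if n: "N \<in> Mods (Th ?M)" "tp K N (S N) = p" for N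
    proof -
      have "Th (summand I N (S N) i) = Th (summand I N0 (S N0) i)"
      proof (rule summand_Th[OF I(1,4) i N(4)[OF n(1)] N(4)[OF N0(1)]])
        show "tp K N (S N) = tp K N0 (S N0)" using n(2) N0(2) by simp
        show "block I N (S N) i \<noteq> {}" "block I N0 (S N0) i \<noteq> {}"
          by (rule decomposes_nonempty[OF N(5)[OF n(1)] i] decomposes_nonempty[OF N(5)[OF N0(1)] i])+
      qed
      then show ?thesis using Mods_Th_iff[OF sP[OF N0(1) i]] sP[OF n(1) i] by simp
    qed
    then have "H p i \<subseteq> iso_class ` Mods (Th (summand I N0 (S N0) i))" unfolding H_def by blast
    then show ?thesis using cN[OF N0(1) i] by (rule countable_subset)
  next
    case False
    then have "H p i = {}" by (simp add: H_def)
    then show ?thesis by simp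
  qed
  define L where "L N = map (\<lambda>i. iso_class (summand I N (S N) i)) (sorted_list_of_set (univ I))" for N
  have "L ` Mods (Th ?M) \<subseteq> lists (\<Union>p\<in>types K (Th ?M). \<Union>i\<in>univ I. H p i)"
  proof (rule image_subsetI)
    fix N assume n: "N \<in> Mods (Th ?M)"
    have p: "tp K N (S N) \<in> types K (Th ?M)" using tp_in_types[OF N(1,4)[OF n]] N(2)[OF n] by simp
    have "iso_class (summand I N (S N) i) \<in> H (tp K N (S N)) i" for i unfolding H_def using n by blast
    with p have "iso_class (summand I N (S N) i) \<in> (\<Union>p\<in>types K (Th ?M). \<Union>i\<in>univ I. H p i)" if "i \<in> univ I" for i
      using that by (intro UN_I)
    then show "L N \<in> lists (\<Union>p\<in>types K (Th ?M). \<Union>i\<in>univ I. H p i)" using I(1) unfolding L_def by (simp add: in_lists_conv_set del: UN_iff)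
  qed
  moreover have "countable (lists (\<Union>p\<in>types K (Th ?M). \<Union>i\<in>univ I. H p i))"
    using sm cH I(1) by (intro countable_lists countable_UN) (auto simp: small_def countable_finite)
  ultimately have cL: "countable (L ` Mods (Th ?M))" by (rule countable_subset)
  show ?thesis
  proof (rule countable_image_factor[OF cL])
    fix N N' assume n: "N \<in> Mods (Th ?M)" "N' \<in> Mods (Th ?M)" and eq: "L N = L N'"
    have e: "iso_class (summand I N (S N) i) = iso_class (summand I N' (S N') i)" if "i \<in> univ I" for i
      using eq that I(1) by (simp add: L_def)
    have "isomorphic (summand I N (S N) i) (summand I N' (S N') i)" if "i \<in> univ I" for i
      using iso_class_eq_iff[OF sP[OF n(1) that] sP[OF n(2) that]] e[OF that] by simp
    then have "isomorphic (lex_sum I (summand I N (S N))) (lex_sum I (summand I N' (S N')))"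
      by (rule lex_sum_iso[OF decomposes_decomposition(3)[OF I(3,1) N(3,5)[OF n(1)]] decomposes_decomposition(3)[OF I(3,1) N(3,5)[OF n(2)]]])
    then have "isomorphic N N'"
      by (simp only: decomposes_decomposition(2)[OF I(3,1) N(3,5)[OF n(1)]] decomposes_decomposition(2)[OF I(3,1) N(3,5)[OF n(2)]])
    then show "iso_class N = iso_class N'" using iso_class_eq_iff[OF N(1)[OF n(1)] N(1)[OF n(2)]] by simp
  qed
qed

section \<open>From the given axioms to the complete theory of a model\<close>

lemma model_iff_Th: "\<forall>\<phi>\<in>T. sentence \<phi> \<Longrightarrow> is_model N T \<longleftrightarrow> is_struc N \<and> T \<subseteq> Th N"
  by (auto simp: is_model_def Th_def)

lemma complete_theory_Th:
  fixes M N :: "'a struc"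
  assumes T: "complete_theory TYPE('a) T" and M: "is_model M T" and N: "is_model N T"
  shows "Th N \<subseteq> Th M"
proof
  fix \<phi> assume p: "\<phi> \<in> Th N"
  obtain t where t: "asg N t" using ex_asg[of N] N unfolding is_model_def by blast
  have "\<not> holds N (Neg \<phi>)" using p t by (auto simp: Th_def holds_def)
  moreover have "entails TYPE('a) T \<phi> \<or> entails TYPE('a) T (Neg \<phi>)"
    using T p by (auto simp: complete_theory_def Th_def)
  ultimately have "entails TYPE('a) T \<phi>" using N by (auto simp: entails_def)
  then show "\<phi> \<in> Th M" using M p by (auto simp: entails_def Th_def)
qed

text \<open>Completeness is tested on structures on \<open>'a\<close> alone. It reaches countable
  models because each of them has a copy on the infinite type \<open>'a\<close> with the same
  theory.\<close>

lemma complete_theory_models: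
  fixes M :: "'a::infinite struc"
  assumes T: "complete_theory TYPE('a) T" and M: "is_model M T"
  shows "\<And>N :: 'a struc. is_model N T \<longleftrightarrow> is_struc N \<and> Th N = Th M"
    and "Mods T = Mods (Th M)"
    and "small_theory TYPE('a) T \<longleftrightarrow> small (Th M)"
proof -
  have sent: "\<forall>\<phi>\<in>T. sentence \<phi>" using T by (simp add: complete_theory_def)
  have sM: "is_struc M" and TM: "T \<subseteq> Th M" using M model_iff_Th[OF sent] by auto
  show 1: "is_model N T \<longleftrightarrow> is_struc N \<and> Th N = Th M" for N :: "'a struc"
    using complete_theory_Th[OF T M] complete_theory_Th[OF T _ M] TM model_iff_Th[OF sent, of N] by blast
  have 2: "is_model N T \<longleftrightarrow> is_struc N \<and> Th N = Th M" for N :: "nat struc"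
  proof (cases "is_struc N")
    case True
    obtain f and N' :: "'a struc" where N': "is_struc N'" "iso_map f N N'" using copy_to_infinite[OF True] by blast
    have "Th N' = Th N" by (rule Th_iso[OF True N'(2)])
    then show ?thesis using 1[of N'] model_iff_Th[OF sent, of N'] model_iff_Th[OF sent, of N] N'(1) True by simp
  qed (simp add: is_model_def)
  show "Mods T = Mods (Th M)" unfolding Mods_def using 2 model_Th_iff[OF sM] by auto
  have "complete_types TYPE('a) n T = types n (Th M)" for n
  proof
    show "complete_types TYPE('a) n T \<subseteq> types n (Th M)"
    proof
      fix p assume "p \<in> complete_types TYPE('a) n T"
      then obtain N :: "'a struc" and s where p: "\<forall>\<phi>\<in>p. fv \<phi> \<subseteq> {..<n}" "\<forall>\<phi>. fv \<phi> \<subseteq> {..<n} \<longrightarrow> \<phi> \<in> p \<or> Neg \<phi> \<in> p"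
        and N: "is_model N T" "asg N s" "\<forall>\<phi>\<in>p. sat N s \<phi>" unfolding complete_types_def by blast
      have "p = tp n N s"
      proof
        show "p \<subseteq> tp n N s" using p(1) N(3) by (auto simp: tp_def)
        show "tp n N s \<subseteq> p"
        proof
          fix \<phi> assume q: "\<phi> \<in> tp n N s"
          then have "\<not> sat N s (Neg \<phi>)" "fv \<phi> \<subseteq> {..<n}" by (auto simp: tp_def)
          then show "\<phi> \<in> p" using p(2) N(3) by blast
        qed
      qed
      then show "p \<in> types n (Th M)" using tp_in_types[OF _ N(2), of n] 1[of N] N(1) by simp
    qed
    show "types n (Th M) \<subseteq> complete_types TYPE('a) n T"
    proof
      fix p assume p: "p \<in> types n (Th M)"
      obtain N :: "nat struc" and s where N: "is_struc N" "Th N = Th M" "asg N s" "p = tp n N s"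
        using typesE[OF p sM] by blast
      obtain f and N' :: "'a struc" where N': "is_struc N'" "iso_map f N N'" using copy_to_infinite[OF N(1)] by blast
      have s': "asg N' (f \<circ> s)" by (rule iso_map_asg[OF N'(2) N(3)])
      have p': "p = tp n N' (f \<circ> s)" unfolding N(4) by (rule tp_iso[OF N'(2) N(3), symmetric])
      have m: "is_model N' T" using 1[of N'] N' Th_iso[OF N(1) N'(2)] N(2) by simp
      have a: "\<forall>\<phi>\<in>p. fv \<phi> \<subseteq> {..<n}" and b: "\<forall>\<phi>\<in>p. sat N' (f \<circ> s) \<phi>"
        and c: "\<forall>\<phi>. fv \<phi> \<subseteq> {..<n} \<longrightarrow> \<phi> \<in> p \<or> Neg \<phi> \<in> p"
        unfolding p' by (simp_all add: tp_def)
      show "p \<in> complete_types TYPE('a) n T"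
        unfolding complete_types_def
        by (intro CollectI conjI a c exI[of _ N'] exI[of _ "f \<circ> s"] m s' b)
    qed
  qed
  then show "small_theory TYPE('a) T \<longleftrightarrow> small (Th M)" by (simp add: small_theory_def small_def)
qed

theorem theorem4p1:
  fixes T :: "fm set"
  assumes "fld1_theory TYPE('a::infinite) T"
    and "actually_vaught TYPE('a) T"
  shows "(num_models T \<le>o natLeq \<or> num_models T =o continuum) \<and>
    (let A = ((\<exists>(I, X) \<in> decompositions TYPE('a) T. \<exists>i\<in>univ I. num_models_of (X i) =o continuum)
              \<or> large_theory TYPE('a) T);
         B = (\<exists>(I, X) \<in> decompositions TYPE('a) T. \<forall>i\<in>univ I. num_models_of (X i) =o cone)
     in (A \<longrightarrow> num_models T =o continuum) \<and>
        (B \<longrightarrow> num_models T =o cone) \<and>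
        (\<not> A \<and> \<not> B \<longrightarrow> natLeq_on 3 \<le>o num_models T \<and> num_models T \<le>o natLeq))"
proof -
  have comp: "complete_theory TYPE('a) T" and posets: "\<And>M :: 'a struc. is_model M T \<Longrightarrow> poset M"
    using assms(1) by (auto simp: fld1_theory_def)
  obtain I X \<tau> where IX: "(I, X) \<in> decompositions TYPE('a) T" and \<tau>: "\<forall>i\<in>univ I. \<tau> i \<in> Th (X i)"
    and vaught: "\<forall>i\<in>univ I. \<forall>Z :: 'a struc. poset Z \<and> holds Z (\<tau> i) \<longrightarrow>
       num_models_of Z \<le>o natLeq \<or> num_models_of Z =o continuum"
    using assms(2) unfolding actually_vaught_def by auto
  let ?M = "lex_sum I X"
  have D: "fld1_decomposition I X" and mM: "is_model ?M T" using IX by (auto simp: decompositions_def)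
  have sM: "is_struc ?M" using mM by (simp add: is_model_def)
  note mods = complete_theory_models[OF comp mM]
  have nT: "num_models T = num_models (Th ?M)" unfolding num_models_iso_class mods(2) ..
  obtain K where I: "finite (univ I)" "is_struc I" "poset I" "univ I \<subseteq> {..<K}" using decomposition_index[OF D] by blast
  \<comment> \<open>Decompositions other than the given one may witness the alternatives of the
    theorem; their sums all have the theory of \<open>?M\<close>.\<close>
  have Th_decomp: "Th (lex_sum J Y) = Th ?M" if "(J, Y) \<in> decompositions TYPE('a) T" for J Y
    using that mods(1)[of "lex_sum J Y"] by (simp add: decompositions_def)
  have A: "num_models T =o continuum"
    if "(\<exists>(I, X) \<in> decompositions TYPE('a) T. \<exists>i\<in>univ I. num_models_of (X i) =o continuum) \<or> large_theory TYPE('a) T"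
    using that
  proof
    assume "large_theory TYPE('a) T"
    then show ?thesis unfolding nT using large_num_models[OF sM] mods(3) by simp
  next
    assume "\<exists>(I, X) \<in> decompositions TYPE('a) T. \<exists>i\<in>univ I. num_models_of (X i) =o continuum"
    then obtain J Y i where J: "(J, Y) \<in> decompositions TYPE('a) T" "i \<in> univ J" "num_models_of (Y i) =o continuum"
      by auto
    have "fld1_decomposition J Y" using J(1) by (simp add: decompositions_def)
    from summand_continuum[OF this J(2,3)] show ?thesis unfolding nT Th_decomp[OF J(1)] .
  qed
  have notA: "num_models T \<le>o natLeq"
    if no: "\<not> ((\<exists>(I, X) \<in> decompositions TYPE('a) T. \<exists>i\<in>univ I. num_models_of (X i) =o continuum) \<or> large_theory TYPE('a) T)"
    unfolding num_models_iso_class mods(2) card_countable_iff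
  proof (rule countably_many_models[OF D _ posets[OF mM]])
    show "small (Th ?M)" using no mods(3) by simp
    show "\<tau> i \<in> Th (X i)" if "i \<in> univ I" for i using \<tau> that by simp
    fix M :: "'a struc" and s i
    assume M: "is_struc M" "Th M = Th ?M" "asg M s" "decomposes I M s" and i: "i \<in> univ I" and t: "\<tau> i \<in> Th (summand I M s i)"
    have m: "is_model M T" using mods(1)[of M] M(1,2) by simp
    have dec: "fld1_decomposition I (summand I M s)" "lex_sum I (summand I M s) = M"
      by (rule decomposes_decomposition(1,2)[OF I(3,1) posets[OF m] M(4)])+
    then have "(I, summand I M s) \<in> decompositions TYPE('a) T" using m by (simp add: decompositions_def)
    \<comment> \<open>The summands of any model on \<open>'a\<close> form a decomposition in the
      class, so excluding the first alternative bounds them as well as the original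
      \<open>X i\<close>.\<close>
    then have "\<not> num_models_of (summand I M s i) =o continuum" using no i by blast
    moreover have "poset (summand I M s i)" using dec(1) i by (simp add: fld1_decomposition_def)
    ultimately have "num_models_of (summand I M s i) \<le>o natLeq" using vaught i t by (auto simp: Th_def)
    then show "countable (iso_class ` Mods (Th (summand I M s i)))"
      by (simp add: num_models_of_def num_models_iso_class card_countable_iff)
  qed
  have B: "num_models T =o cone"
    if B: "\<exists>(I, X) \<in> decompositions TYPE('a) T. \<forall>i\<in>univ I. num_models_of (X i) =o cone"
  proof -
    obtain J Y where J: "(J, Y) \<in> decompositions TYPE('a) T" "\<forall>i\<in>univ J. num_models_of (Y i) =o cone" using B by auto
    have DJ: "fld1_decomposition J Y" using J(1) by (simp add: decompositions_def)
    have df: "disj_fam J Y" by (rule decomposition_disj_fam[OF DJ])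
    have "fin_types (Th (Y i))" if "i \<in> univ J" for i
      using J(2) that df num_models_cone_iff[of "Y i"] by (simp add: num_models_of_def disj_fam_def)
    then have "fin_types (Th (lex_sum J Y))"
      using lex_sum_fin_types[OF _ _ df] DJ by (simp add: fld1_decomposition_def poset_def)
    then show ?thesis unfolding nT using num_models_cone_iff[OF sM] Th_decomp[OF J(1)] by simp
  qed
  have three: "natLeq_on 3 \<le>o num_models T"
    if nB: "\<not> (\<exists>(I, X) \<in> decompositions TYPE('a) T. \<forall>i\<in>univ I. num_models_of (X i) =o cone)"
      and small: "small_theory TYPE('a) T"
    unfolding nT
  proof (rule three_le_num_models[OF sM])
    show "small (Th ?M)" using small mods(3) by simp
    show "\<not> fin_types (Th ?M)"
    proof
      \<comment> \<open>Finite type spaces would pass from the sum to each \<open>X i\<close>, and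
        the given decomposition would then witness the second alternative.\<close>
      assume fin: "fin_types (Th ?M)"
      obtain s where s: "asg ?M s"
        "\<And>i. i \<in> univ I \<Longrightarrow> s i \<in> univ (X i) \<and> (\<forall>x\<in>univ (X i). (x, s i) \<in> leq (X i))"
        using decomposition_tops[OF D] by blast
      have "num_models_of (X i) =o cone" if i: "i \<in> univ I" for i
      proof -
        have p: "summand I ?M s i = X i" by (rule decomposition_decomposes(2)[OF D s(2) i])
        have "block I ?M s i = univ (X i)" using arg_cong[OF p, of univ] by simp
        then have ne: "block I ?M s i \<noteq> {}" using s(2)[OF i] by auto
        have "fin_types (Th (X i))" using summand_fin_types[OF I(1,4) i sM s(1) fin ne] unfolding p .
        moreover have "is_struc (X i)" using decomposition_disj_fam[OF D] i by (simp add: disj_fam_def)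
        ultimately show ?thesis using num_models_cone_iff by (auto simp: num_models_of_def)
      qed
      then show False using nB IX by blast
    qed
  qed
  show ?thesis unfolding Let_def using A notA B three by blast
qed

end
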